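(* Let $\Bbbk$ be a field of characteristic zero and $n\ge 1$. The maximal finite-dimensional $\mathfrak{sl}_2$-subrepresentation of $\mathrm{NH}_n$ is a subalgebra, which maps isomorphically onto the semisimplification $\mathrm{NH}_n/\mathrm{Jac}(\mathrm{NH}_n)$ under the quotient map. Moreover, under the identification $\mathrm{NH}_n\cong\mathrm{Mat}_{n!}(R_n^{S_n})$ described in the context, this subalgebra is precisely $\mathrm{Mat}_{n!}(\Bbbk)$.
   Context: Let $R_n=\Bbbk[x_1,\dots,x_n]$ with $\deg x_i=2$ and $S_n$ permuting the variables. The nilHecke algebra $\mathrm{NH}_n$ is the graded $\Bbbk$-algebra generated by $x_1,\dots,x_n$ (degree $2$) and $\partial_1,\dots,\partial_{n-1}$ (degree $-2$) with relations: the $x_i$ commute; $\partial_i^2=0$; $\partial_i\partial_{i+1}\partial_i=\partial_{i+1}\partial_i\partial_{i+1}$; $\partial_i\partial_j=\partial_j\partial_i$ for $|i-j|>1$; $x_j\partial_i=\partial_ix_j$ for $j\ne i,i+1$; $x_i\partial_i-\partial_ix_{i+1}=1=\partial_ix_i-x_{i+1}\partial_i$. It acts on $R_n$, with $x_i$ acting by multiplication and $\partial_i(f)=(f-s_if)/(x_i-x_{i+1})$, and this gives an isomorphism $\mathrm{NH}_n\cong\mathrm{End}_{R_n^{S_n}}(R_n)$. $\mathfrak{sl}_2$-action on $\mathrm{NH}_n$: derivations $\mathbf{d},\mathbf{h},\mathbf{z}$ with $\mathbf{d}(x_i)=x_i^2$, $\mathbf{d}(\partial_i)=-x_i\partial_i-\partial_ix_{i+1}$,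 $\mathbf{z}(x_i)=1$, $\mathbf{z}(\partial_i)=0$, and $\mathbf{h}(f)=\deg(f)f$ for homogeneous $f$; $(\mathbf{d},\mathbf{h},-\mathbf{z})$ is the $\mathfrak{sl}_2$-triple. Matrix identification: $R_n$ is free over $R_n^{S_n}$ with basis $\{x_1^{a_1}\cdots x_n^{a_n}\mid 0\le a_i\le n-i\}$; let $H$ be the $\Bbbk$-span of this basis. Using this basis (or any other $\Bbbk$-basis of $H$, e.g. Schubert polynomials), $\mathrm{NH}_n\cong\mathrm{End}_{R_n^{S_n}}(R_n)\cong\mathrm{Mat}_{n!}(R_n^{S_n})$, and $\mathrm{Mat}_{n!}(\Bbbk)$ corresponds to $\{\phi\in\mathrm{NH}_n\mid\phi(H)\subset H\}$. $\mathrm{Jac}(\mathrm{NH}_n)$ is the graded Jacobson radical; under the matrix identification it is $\mathrm{Mat}_{n!}(R^{S_n}_+)$, where $R^{S_n}_+\subset R_n^{S_n}$ is the ideal spanned by homogeneous elements of positive degree. The semisimplification of $\mathrm{NH}_n$ is the quotient $\mathrm{NH}_n/\mathrm{Jac}(\mathrm{NH}_n)$. *)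

theory Defs
  imports
    "HOL-Library.Poly_Mapping"
    "HOL-Combinatorics.Permutations"
    "HOL-Algebra.Ideal"
    "HOL-Algebra.QuotRing"
    "HOL-Algebra.Generated_Groups"
    "HOL-Algebra.Embedded_Algebras"
    "Jordan_Normal_Form.Matrix"
begin

section \<open>Polynomials, symmetric polynomials and divided differences\<close>

text \<open>Polynomials in countably many variables, indexed by \<^typ>\<open>nat\<close>; a monomial is its
  finitely supported exponent vector.\<close>

type_synonym 'k mpoly = "(nat \<Rightarrow>\<^sub>0 nat) \<Rightarrow>\<^sub>0 'k"

definition mp_const :: "'k::zero \<Rightarrow> 'k mpoly" where
  "mp_const c = Poly_Mapping.single 0 c"

definition mp_var :: "nat \<Rightarrow> 'k::{zero,one} mpoly" where
  "mp_var i = Poly_Mapping.single (Poly_Mapping.single i 1) 1"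

definition poly_ring :: "nat \<Rightarrow> 'k::zero mpoly set" where
  "poly_ring n = {f. \<forall>m\<in>Poly_Mapping.keys f. Poly_Mapping.keys m \<subseteq> {1..n}}"

text \<open>For bijective \<open>\<sigma>\<close> this is the substitution of \<open>x\<^bsub>\<sigma> i\<^esub>\<close> for \<open>x\<^sub>i\<close>: the
  coefficient of \<open>m\<close> in the result is the coefficient of \<open>m \<circ> \<sigma>\<close> in \<open>f\<close>.\<close>

definition perm_poly :: "(nat \<Rightarrow> nat) \<Rightarrow> 'k::zero mpoly \<Rightarrow> 'k mpoly" where
  "perm_poly \<sigma> f = Poly_Mapping.map_key (Poly_Mapping.map_key \<sigma>) f"

definition sym_ring :: "nat \<Rightarrow> 'k::zero mpoly set" where
  "sym_ring n = {f \<in> poly_ring n. \<forall>\<sigma>. \<sigma> permutes {1..n} \<longrightarrow> perm_poly \<sigma> f = f}"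

text \<open>The exact quotient of \<open>f - s\<^sub>i f\<close> by \<open>x\<^sub>i - x\<^bsub>i+1\<^esub>\<close>; it is unique because polynomials
  form an integral domain.\<close>

definition divided_difference :: "nat \<Rightarrow> 'k::field_char_0 mpoly \<Rightarrow> 'k mpoly" where
  "divided_difference i f =
     (THE g. (mp_var i - mp_var (Suc i)) * g = f - perm_poly (transpose i (Suc i)) f)"

text \<open>The span \<open>H\<close> of the monomials \<open>x\<^sup>a\<close> with \<open>0 \<le> a\<^sub>i \<le> n - i\<close>.\<close>

definition H_span :: "nat \<Rightarrow> 'k::zero mpoly set" where
  "H_span n = {f \<in> poly_ring n. \<forall>m\<in>Poly_Mapping.keys f. \<forall>i\<in>{1..n}. Poly_Mapping.lookup m i \<le> n - i}"

definition is_basis_of_H :: "nat \<Rightarrow> (nat \<Rightarrow> 'k::field_char_0 mpoly) \<Rightarrow> bool" where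
  "is_basis_of_H n b \<longleftrightarrow>
     (\<forall>j<fact n. b j \<in> H_span n) \<and>
     (\<forall>f\<in>H_span n. \<exists>!c. c \<in> carrier_vec (fact n) \<and> f = (\<Sum>j<fact n. mp_const (c $ j) * b j))"


section \<open>The nilHecke algebra\<close>

datatype nh_gen = XGen nat | DGen nat

text \<open>The free monoid on the generators, written additively so that \<open>nh_word \<Rightarrow>\<^sub>0 'k\<close> with
  its convolution product is the free associative algebra.\<close>

datatype nh_word = Word (letters: "nh_gen list")

instantiation nh_word :: monoid_add
begin
definition "0 = Word []"
definition "u + v = Word (letters u @ letters v)"
instance by standard (simp_all add: zero_nh_word_def plus_nh_word_def)
end

type_synonym 'k free_nh = "nh_word \<Rightarrow>\<^sub>0 'k"

definition fr_const :: "'k::zero \<Rightarrow> 'k free_nh" where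
  "fr_const c = Poly_Mapping.single 0 c"

definition fr_word :: "nh_gen list \<Rightarrow> 'k::{zero,one} free_nh" where
  "fr_word w = Poly_Mapping.single (Word w) 1"

abbreviation fr_x :: "nat \<Rightarrow> 'k::{zero,one} free_nh" where
  "fr_x i \<equiv> fr_word [XGen i]"

abbreviation fr_d :: "nat \<Rightarrow> 'k::{zero,one} free_nh" where
  "fr_d i \<equiv> fr_word [DGen i]"

definition nh_gens :: "nat \<Rightarrow> nh_gen set" where
  "nh_gens n = XGen ` {1..n} \<union> DGen ` {1..<n}"

definition free_alg :: "nat \<Rightarrow> 'k::field_char_0 free_nh ring" where
  "free_alg n = \<lparr>carrier = {f. \<forall>w\<in>Poly_Mapping.keys f. set (letters w) \<subseteq> nh_gens n},
                 monoid.mult = (*), one = 1, zero = 0, add = (+)\<rparr>"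

definition nh_relations :: "nat \<Rightarrow> 'k::field_char_0 free_nh set" where
  "nh_relations n =
     {fr_x i * fr_x j - fr_x j * fr_x i | i j. i \<in> {1..n} \<and> j \<in> {1..n}} \<union>
     {fr_d i * fr_d i | i. i \<in> {1..<n}} \<union>
     {fr_d i * fr_d (i+1) * fr_d i - fr_d (i+1) * fr_d i * fr_d (i+1) | i.
        i \<in> {1..<n} \<and> i + 1 \<in> {1..<n}} \<union>
     {fr_d i * fr_d j - fr_d j * fr_d i | i j.
        i \<in> {1..<n} \<and> j \<in> {1..<n} \<and> \<bar>int i - int j\<bar> > 1} \<union>
     {fr_x j * fr_d i - fr_d i * fr_x j | i j.
        i \<in> {1..<n} \<and> j \<in> {1..n} \<and> j \<noteq> i \<and> j \<noteq> i + 1} \<union>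
     {fr_x i * fr_d i - fr_d i * fr_x (i+1) - 1 | i. i \<in> {1..<n}} \<union>
     {fr_d i * fr_x i - fr_x (i+1) * fr_d i - 1 | i. i \<in> {1..<n}}"

definition nh_ideal :: "nat \<Rightarrow> 'k::field_char_0 free_nh set" where
  "nh_ideal n = Idl\<^bsub>free_alg n\<^esub> (nh_relations n)"

type_synonym 'k nh = "'k free_nh set"

definition NH :: "nat \<Rightarrow> 'k::field_char_0 nh ring" where
  "NH n = free_alg n Quot nh_ideal n"

definition nh_class :: "nat \<Rightarrow> 'k::field_char_0 free_nh \<Rightarrow> 'k nh" where
  "nh_class n f = nh_ideal n +>\<^bsub>free_alg n\<^esub> f"

text \<open>The copy of the ground field inside \<^term>\<open>NH n\<close>. The \<open>\<Bbbk>\<close>-linear structure of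
  \<^term>\<open>NH n\<close> is multiplication by it, so a linear subspace \<open>V\<close> is
  \<open>subalgebra (nh_scalars n) V (NH n)\<close>; despite its name, that library predicate does not
  ask for closure under products.\<close>

definition nh_scalars :: "nat \<Rightarrow> 'k::field_char_0 nh set" where
  "nh_scalars n = range (\<lambda>c. nh_class n (fr_const c))"


section \<open>Grading and graded Jacobson radical\<close>

fun gen_deg :: "nh_gen \<Rightarrow> int" where
  "gen_deg (XGen i) = 2"
| "gen_deg (DGen i) = - 2"

definition word_deg :: "nh_word \<Rightarrow> int" where
  "word_deg w = sum_list (map gen_deg (letters w))"

definition nh_homogeneous :: "nat \<Rightarrow> int \<Rightarrow> 'k::field_char_0 nh set" where
  "nh_homogeneous n m =
     nh_class n ` {f \<in> carrier (free_alg n). \<forall>w\<in>Poly_Mapping.keys f. word_deg w = m}"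

text \<open>Below, \<open>G m\<close> is the homogeneous part of degree \<open>m\<close> of a \<open>\<int>\<close>-graded ring \<open>R\<close>. A left ideal
  is graded iff it is additively generated by the homogeneous elements it contains.\<close>

definition graded_left_ideal ::
    "('a, 'b) ring_scheme \<Rightarrow> (int \<Rightarrow> 'a set) \<Rightarrow> 'a set \<Rightarrow> bool" where
  "graded_left_ideal R G L \<longleftrightarrow>
     additive_subgroup L R \<and>
     (\<forall>r\<in>carrier R. \<forall>a\<in>L. r \<otimes>\<^bsub>R\<^esub> a \<in> L) \<and>
     generate (add_monoid R) (L \<inter> (\<Union>m. G m)) = L"

definition maximal_graded_left_ideal ::
    "('a, 'b) ring_scheme \<Rightarrow> (int \<Rightarrow> 'a set) \<Rightarrow> 'a set \<Rightarrow> bool" where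
  "maximal_graded_left_ideal R G L \<longleftrightarrow>
     graded_left_ideal R G L \<and> L \<noteq> carrier R \<and>
     (\<forall>L'. graded_left_ideal R G L' \<and> L \<subseteq> L' \<longrightarrow> L' = L \<or> L' = carrier R)"

definition graded_jacobson_radical ::
    "('a, 'b) ring_scheme \<Rightarrow> (int \<Rightarrow> 'a set) \<Rightarrow> 'a set" where
  "graded_jacobson_radical R G = carrier R \<inter> \<Inter>{L. maximal_graded_left_ideal R G L}"

definition Jac_NH :: "nat \<Rightarrow> 'k::field_char_0 nh set" where
  "Jac_NH n = graded_jacobson_radical (NH n) (nh_homogeneous n)"


section \<open>The action of the Lie algebra\<close>

text \<open>The derivation of the free algebra with prescribed values \<open>v\<close> on the generators.\<close>

fun word_derivation :: "(nh_gen \<Rightarrow> 'k::field_char_0 free_nh) \<Rightarrow> nh_gen list \<Rightarrow> 'k free_nh" where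
  "word_derivation v [] = 0"
| "word_derivation v (g # w) = v g * fr_word w + fr_word [g] * word_derivation v w"

definition free_derivation ::
    "(nh_gen \<Rightarrow> 'k::field_char_0 free_nh) \<Rightarrow> 'k free_nh \<Rightarrow> 'k free_nh" where
  "free_derivation v f =
     (\<Sum>w\<in>Poly_Mapping.keys f.
        fr_const (Poly_Mapping.lookup f w) * word_derivation v (letters w))"

fun d_gen :: "nh_gen \<Rightarrow> 'k::field_char_0 free_nh" where
  "d_gen (XGen i) = fr_x i * fr_x i"
| "d_gen (DGen i) = - (fr_x i * fr_d i) - fr_d i * fr_x (i+1)"

fun z_gen :: "nh_gen \<Rightarrow> 'k::field_char_0 free_nh" where
  "z_gen (XGen i) = 1"
| "z_gen (DGen i) = 0"

definition free_h :: "'k::field_char_0 free_nh \<Rightarrow> 'k free_nh" where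
  "free_h f = (\<Sum>w\<in>Poly_Mapping.keys f.
     Poly_Mapping.single w (of_int (word_deg w) * Poly_Mapping.lookup f w))"

text \<open>The map on \<^term>\<open>NH n\<close> induced by an additive map of the free algebra that preserves the
  defining ideal: all representatives \<open>f \<in> a\<close> then give the same coset.\<close>

definition nh_induced ::
    "nat \<Rightarrow> ('k::field_char_0 free_nh \<Rightarrow> 'k free_nh) \<Rightarrow> 'k nh \<Rightarrow> 'k nh" where
  "nh_induced n D a = (\<Union>f\<in>a. nh_class n (D f))"

definition nh_d :: "nat \<Rightarrow> 'k::field_char_0 nh \<Rightarrow> 'k nh" where
  "nh_d n = nh_induced n (free_derivation d_gen)"

definition nh_h :: "nat \<Rightarrow> 'k::field_char_0 nh \<Rightarrow> 'k nh" where
  "nh_h n = nh_induced n free_h"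

definition nh_z :: "nat \<Rightarrow> 'k::field_char_0 nh \<Rightarrow> 'k nh" where
  "nh_z n = nh_induced n (free_derivation z_gen)"

definition fd_sl2_subrep :: "nat \<Rightarrow> 'k::field_char_0 nh set \<Rightarrow> bool" where
  "fd_sl2_subrep n V \<longleftrightarrow>
     subalgebra (nh_scalars n) V (NH n) \<and>
     ring.finite_dimension (NH n) (nh_scalars n) V \<and>
     nh_d n ` V \<subseteq> V \<and> nh_h n ` V \<subseteq> V \<and> nh_z n ` V \<subseteq> V"

text \<open>Sums of two finite-dimensional subrepresentations are again such, so maximal
  and greatest agree.\<close>

definition is_max_fd_sl2_subrep :: "nat \<Rightarrow> 'k::field_char_0 nh set \<Rightarrow> bool" where
  "is_max_fd_sl2_subrep n M \<longleftrightarrow>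
     fd_sl2_subrep n M \<and> (\<forall>V. fd_sl2_subrep n V \<longrightarrow> V \<subseteq> M)"


section \<open>The action on polynomials and the matrix identification\<close>

fun gen_act :: "nh_gen \<Rightarrow> 'k::field_char_0 mpoly \<Rightarrow> 'k mpoly" where
  "gen_act (XGen i) f = mp_var i * f"
| "gen_act (DGen i) f = divided_difference i f"

definition free_act :: "'k::field_char_0 free_nh \<Rightarrow> 'k mpoly \<Rightarrow> 'k mpoly" where
  "free_act \<phi> f =
     (\<Sum>w\<in>Poly_Mapping.keys \<phi>.
        mp_const (Poly_Mapping.lookup \<phi> w) * foldr gen_act (letters w) f)"

text \<open>The value common to all representatives.\<close>

definition nh_act :: "'k::field_char_0 nh \<Rightarrow> 'k mpoly \<Rightarrow> 'k mpoly" where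
  "nh_act a f = (THE g. \<forall>\<phi>\<in>a. free_act \<phi> f = g)"

definition sym_matrix_ring :: "nat \<Rightarrow> 'k::field_char_0 mpoly mat ring" where
  "sym_matrix_ring n =
     (ring_mat TYPE('k mpoly) (fact n) ())
       \<lparr>carrier := {A \<in> carrier_mat (fact n) (fact n). elements_mat A \<subseteq> sym_ring n}\<rparr>"

definition const_matrices :: "nat \<Rightarrow> 'k::field_char_0 mpoly mat set" where
  "const_matrices n = map_mat mp_const ` carrier_mat (fact n) (fact n)"

text \<open>Column \<open>j\<close> holds the coordinates of \<open>a \<cdot> b\<^sub>j\<close> in the \<^term>\<open>sym_ring n\<close>-basis \<open>b\<close>.\<close>

definition nh_matrix :: "nat \<Rightarrow> (nat \<Rightarrow> 'k::field_char_0 mpoly) \<Rightarrow> 'k nh \<Rightarrow> 'k mpoly mat" where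
  "nh_matrix n b a =
     (THE A. A \<in> carrier (sym_matrix_ring n) \<and>
        (\<forall>j<fact n. nh_act a (b j) = (\<Sum>i<fact n. A $$ (i, j) * b i)))"

end

theory Submission
  imports Defs "HOL-Computational_Algebra.Polynomial"
begin

text \<open>Write \<open>R\<close> for the polynomial ring, \<open>S\<close> for its ring of symmetric polynomials and \<open>D\<close> for the
  product of divided differences along a reduced word of the longest permutation. The relations
  imply \<open>\<partial>\<^sub>i D = 0\<close> for all \<open>i\<close> (\<open>longest_annihilated\<close>), so the left ideal generated by \<open>D\<close> is a copy
  of \<open>R\<close>: \<open>\<phi> f D = \<phi>(f) D\<close>. They also imply, by induction on the number of strands, a
  decomposition of the identity \<open>1 = \<Sum> u D v\<close> in which every \<open>u\<close> is one of the monomials that span \<open>H\<close>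
  (\<open>one_in_longest_span\<close>). Three consequences describe the nilHecke algebra.

  First, it acts faithfully: if \<open>\<phi>\<close> kills \<open>R\<close>, then \<open>\<phi> = \<Sum> \<phi> u D v = \<Sum> \<phi>(u) D v = 0\<close>
  (\<open>nh_ideal_iff_acts_zero\<close>). Second, the monomials of \<open>H\<close> span \<open>R\<close> over \<open>S\<close>, because \<open>p = \<Sum> u D(v p)\<close>
  and \<open>D\<close> takes symmetric values (\<open>stairs_span\<close>); they are independent by a Vandermonde argument
  (\<open>stair_independent\<close>). Third, every \<open>S\<close>-linear operator \<open>\<Phi>\<close> on \<open>R\<close> is given by \<open>\<Sum> \<Phi>(u) D v\<close>
  (\<open>sym_linear_is_free_act\<close>). Hence the nilHecke algebra is the algebra of \<open>S\<close>-linear operators on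
  the free module \<open>R\<close>, and the rest is done with these operators.

  The Lie algebra acts on an operator by its commutator with an operator on \<open>R\<close>; for \<open>\<d>\<close> this
  is the derivation \<open>x\<^sub>i \<mapsto> x\<^sub>i\<^sup>2\<close> minus multiplication by \<open>\<Sum> (n - i) x\<^sub>i\<close>. These operators preserve
  \<open>H\<close>, so the operators that map \<open>H\<close> into itself form a subrepresentation \<open>M\<close>, which is a matrix
  algebra over the ground field. Conversely let \<open>V\<close> be a finite-dimensional subrepresentation.
  The coordinates of its operators have bounded degree in each variable, but a derivation with
  \<open>x\<^sub>i \<mapsto> x\<^sub>i\<^sup>2\<close> raises any positive degree in \<open>x\<^sub>i\<close> by one. So the coordinates are constant, that is
  \<open>V \<subseteq> M\<close> (\<open>fd_subrep_coord_deg_le_0\<close>).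

  Let \<open>J\<close> consist of the operators whose coordinates all have constant term zero. The
  coordinates are the sum of their constant terms and the rest, so \<open>M\<close> is a complement of \<open>J\<close>. It
  remains to see that \<open>J\<close> is the graded radical. It is the intersection of the annihilators of the
  monomials of \<open>H\<close> modulo \<open>J R\<close>, which are maximal left ideals (\<open>stair_annihilator_maximal\<close>). On the
  other hand, elements of \<open>J\<close> of degree zero are nilpotent, since their coordinates have positive
  degree and they must lower the degree of the monomials; so \<open>J\<close> lies in every maximal graded
  left ideal (\<open>one_in_graded_left_ideal\<close>).\<close>

section \<open>Polynomials and permutations of the variables\<close>

abbreviation lookup :: "('a \<Rightarrow>\<^sub>0 'b::zero) \<Rightarrow> 'a \<Rightarrow> 'b" where
  "lookup \<equiv> Poly_Mapping.lookup"

abbreviation keys :: "('a \<Rightarrow>\<^sub>0 'b::zero) \<Rightarrow> 'a set" where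
  "keys \<equiv> Poly_Mapping.keys"

abbreviation single :: "'a \<Rightarrow> 'b \<Rightarrow> 'a \<Rightarrow>\<^sub>0 'b::zero" where
  "single \<equiv> Poly_Mapping.single"

abbreviation map_key :: "('a \<Rightarrow> 'b) \<Rightarrow> ('b \<Rightarrow>\<^sub>0 'c::zero) \<Rightarrow> 'a \<Rightarrow>\<^sub>0 'c" where
  "map_key \<equiv> Poly_Mapping.map_key"

lemma poly_mapping_sum_single:
  fixes p :: "'a \<Rightarrow>\<^sub>0 'b::comm_monoid_add"
  shows "(\<Sum>m\<in>keys p. single m (lookup p m)) = p"
  by (rule poly_mapping_eqI)
    (auto simp: lookup_sum lookup_single when_def in_keys_iff)

lemma poly_mapping_add_induct [consumes 1, case_names zero single add]:
  fixes p :: "'a \<Rightarrow>\<^sub>0 'b::comm_monoid_add"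
  assumes "keys p \<subseteq> A"
    and zero: "P 0"
    and single: "\<And>m c. m \<in> A \<Longrightarrow> P (single m c)"
    and add: "\<And>f g. P f \<Longrightarrow> P g \<Longrightarrow> P (f + g)"
  shows "P p"
proof -
  have "P (\<Sum>m\<in>B. single m (lookup p m))" if "finite B" "B \<subseteq> A" for B
    using that by (induction B rule: finite_induct) (auto intro: zero single add)
  from this[OF finite_keys assms(1)] show ?thesis
    by (simp add: poly_mapping_sum_single)
qed

lemma mp_const_simps [simp]:
  shows "mp_const 0 = 0" and "mp_const (1::'k::field_char_0) = 1"
    and "mp_const (a + b :: 'k) = mp_const a + mp_const b"
    and "mp_const (a * b :: 'k) = mp_const a * mp_const b"
    and "mp_const (a - b :: 'k) = mp_const a - mp_const b"
    and "mp_const (- a :: 'k) = - mp_const a"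
  by (simp_all add: mp_const_def single_add mult_single single_diff single_uminus)

lemma lookup_single_zero_mult:
  fixes c :: "'k::semiring_0"
  shows "lookup (single 0 c * p) m = c * lookup p m"
  by (auto simp: mult_map_scale_conv_mult[symmetric] map.rep_eq when_def)

lemma lookup_mp_const_mult [simp]:
  fixes c :: "'k::field_char_0"
  shows "lookup (mp_const c * p) m = c * lookup p m"
  by (simp add: mp_const_def lookup_single_zero_mult)

lemma mp_const_inject [simp]: "mp_const a = mp_const b \<longleftrightarrow> a = b"
  unfolding mp_const_def by (metis lookup_single_eq)

lemma mp_const_eq_0 [simp]: "mp_const a = 0 \<longleftrightarrow> a = 0"
  by (metis mp_const_inject mp_const_simps(1))

lemma mp_var_inject [simp]: "(mp_var i :: 'k::field_char_0 mpoly) = mp_var j \<longleftrightarrow> i = j"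
  unfolding mp_var_def by (metis lookup_single_eq lookup_single_not_eq zero_neq_one)

text \<open>The set of variables is a parameter so that one induction rule serves both \<^term>\<open>poly_ring n\<close>
  and the ring of all polynomials.\<close>

definition mpolys_in :: "nat set \<Rightarrow> 'k::zero mpoly set" where
  "mpolys_in A = {f. \<forall>m\<in>keys f. keys m \<subseteq> A}"

lemma poly_ring_eq_mpolys_in: "poly_ring n = mpolys_in {1..n}"
  by (simp add: poly_ring_def mpolys_in_def)

lemma mpolys_in_add: "f \<in> mpolys_in A \<Longrightarrow> g \<in> mpolys_in A \<Longrightarrow> f + g \<in> mpolys_in A"
  for f g :: "'k::field_char_0 mpoly"
  unfolding mpolys_in_def using Poly_Mapping.keys_add[of f g] by blast

lemma mpolys_in_mult: "f \<in> mpolys_in A \<Longrightarrow> g \<in> mpolys_in A \<Longrightarrow> f * g \<in> mpolys_in A"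
  for f g :: "'k::field_char_0 mpoly"
proof -
  assume *: "f \<in> mpolys_in A" "g \<in> mpolys_in A"
  have "keys m \<subseteq> A" if m: "m \<in> keys (f * g)" for m
  proof -
    obtain a b where ab: "m = a + b" "a \<in> keys f" "b \<in> keys g"
      using subsetD[OF keys_mult m] by blast
    then show ?thesis using * Poly_Mapping.keys_add[of a b] unfolding mpolys_in_def by blast
  qed
  then show ?thesis by (simp add: mpolys_in_def)
qed

lemma mpolys_in_const: "mp_const c \<in> mpolys_in A" for c :: "'k::field_char_0"
  by (simp add: mpolys_in_def mp_const_def)

lemma mpolys_in_var: "i \<in> A \<Longrightarrow> (mp_var i :: 'k::field_char_0 mpoly) \<in> mpolys_in A"
  by (simp add: mpolys_in_def mp_var_def)

lemma mpolys_in_uminus: "f \<in> mpolys_in A \<Longrightarrow> - f \<in> mpolys_in A" for f :: "'k::field_char_0 mpoly"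
  by (auto simp: mpolys_in_def in_keys_iff)

lemma mpolys_in_diff: "f \<in> mpolys_in A \<Longrightarrow> g \<in> mpolys_in A \<Longrightarrow> f - g \<in> mpolys_in A"
  for f g :: "'k::field_char_0 mpoly"
  using mpolys_in_add[of f A "- g"] mpolys_in_uminus[of g A] by simp

lemma mpolys_in_0 [simp]: "0 \<in> mpolys_in A"
  by (simp add: mpolys_in_def)

lemma mpolys_in_1 [simp]: "(1 :: 'k::field_char_0 mpoly) \<in> mpolys_in A"
  by (simp add: mpolys_in_def)

lemma mpolys_in_sum:
  fixes f :: "'a \<Rightarrow> 'k::field_char_0 mpoly"
  shows "(\<And>i. i \<in> I \<Longrightarrow> f i \<in> mpolys_in A) \<Longrightarrow> (\<Sum>i\<in>I. f i) \<in> mpolys_in A"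
  by (induction I rule: infinite_finite_induct) (auto intro: mpolys_in_add)

lemma mpolys_in_UNIV [simp]: "mpolys_in UNIV = UNIV"
  by (simp add: mpolys_in_def)

lemma mon_Suc: "single (single i (Suc k)) 1
    = mp_var i * (single (single i k) 1 :: 'k::field_char_0 mpoly)"
  by (simp add: mp_var_def mult_single flip: single_add)

lemma mpolys_in_induct [consumes 1, case_names const var add]:
  fixes p :: "'k::field_char_0 mpoly"
  assumes p: "p \<in> mpolys_in A"
    and const: "\<And>c. P (mp_const c)"
    and var: "\<And>i p. i \<in> A \<Longrightarrow> p \<in> mpolys_in A \<Longrightarrow> P p \<Longrightarrow> P (mp_var i * p)"
    and add: "\<And>p q. p \<in> mpolys_in A \<Longrightarrow> q \<in> mpolys_in A \<Longrightarrow> P p \<Longrightarrow> P q \<Longrightarrow> P (p + q)"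
  shows "P p"
proof -
  let ?R = "\<lambda>p. p \<in> mpolys_in A \<and> P p"
  have mon: "\<forall>p. ?R p \<longrightarrow> ?R (single m 1 * p)" if "keys m \<subseteq> A" for m
    using that
  proof (induction m rule: poly_mapping_add_induct)
    case (single i k)
    show ?case
    proof (induction k)
      case (Suc k)
      then show ?case
        using single
        by (auto simp only: mon_Suc mult.assoc intro: var mpolys_in_mult mpolys_in_var)
    qed simp
  next
    case (add f g)
    have "single (f + g) 1 * p
        = single f 1 * (single g 1 * p)" for p :: "'k mpoly"
      by (simp add: mult_single flip: mult.assoc)
    with add show ?case by metis
  qed simp
  have "keys p \<subseteq> {m. keys m \<subseteq> A}"
    using p by (auto simp: mpolys_in_def)
  then have "?R p"
  proof (induction p rule: poly_mapping_add_induct)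
    case (single m c)
    have "single m c = single m 1 * mp_const c"
      by (simp add: mp_const_def mult_single)
    then show ?case using mon single const mpolys_in_const by fastforce
  next
    case zero
    show ?case using const[of 0] by simp
  qed (auto intro: add mpolys_in_add)
  then show ?thesis by simp
qed

lemmas mpoly_induct = mpolys_in_induct[of _ UNIV, simplified, case_names const var add]

lemma map_key_inv:
  assumes "bij \<sigma>"
  shows "map_key (inv_into UNIV \<sigma>) (map_key \<sigma> m) = m"
    and "map_key \<sigma> (map_key (inv_into UNIV \<sigma>) m) = m"
proof -
  have "inj \<sigma>" "inj (inv_into UNIV \<sigma>)" using assms by (auto simp: bij_is_inj bij_imp_bij_inv)
  then show "map_key (inv_into UNIV \<sigma>) (map_key \<sigma> m) = m"
    and "map_key \<sigma> (map_key (inv_into UNIV \<sigma>) m) = m"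
    using assms map_key_id[of m] surj_iff[THEN iffD1, OF bij_is_surj[OF assms]]
    by (simp_all add: map_key_compose id_def)
qed

lemma inj_map_key: "bij (\<sigma> :: 'a \<Rightarrow> 'a) \<Longrightarrow> inj (map_key \<sigma>)"
  by (rule inj_on_inverseI[of _ "map_key (inv_into UNIV \<sigma>)"]) (rule map_key_inv(1))

lemma lookup_perm_poly:
  "bij \<sigma> \<Longrightarrow> lookup (perm_poly \<sigma> f) m = lookup f (map_key \<sigma> m)"
  by (simp add: perm_poly_def map_key.rep_eq inj_map_key)

lemma perm_poly_single:
  assumes "bij \<sigma>"
  shows "perm_poly \<sigma> (single m c)
    = single (map_key (inv_into UNIV \<sigma>) m) c"
  using map_key_single[OF inj_map_key[OF assms], of "map_key (inv_into UNIV \<sigma>) m" c]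
  unfolding perm_poly_def map_key_inv(2)[OF assms] .

lemma perm_poly_add: "bij \<sigma> \<Longrightarrow> perm_poly \<sigma> (f + g) = perm_poly \<sigma> f + perm_poly \<sigma> g"
  by (simp add: perm_poly_def inj_map_key map_key_plus)

lemma perm_poly_0 [simp]: "bij \<sigma> \<Longrightarrow> perm_poly \<sigma> 0 = 0"
  by (simp add: perm_poly_def inj_map_key)

lemma perm_poly_uminus: "bij \<sigma> \<Longrightarrow> perm_poly \<sigma> (- f) = - perm_poly \<sigma> f"
  for f :: "'k::field_char_0 mpoly"
  by (rule poly_mapping_eqI) (simp add: lookup_perm_poly)

lemma perm_poly_diff: "bij \<sigma> \<Longrightarrow> perm_poly \<sigma> (f - g) = perm_poly \<sigma> f - perm_poly \<sigma> g"
  for f :: "'k::field_char_0 mpoly"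
  using perm_poly_add[of \<sigma> f "- g"] by (simp add: perm_poly_uminus)

lemma perm_poly_mult:
  fixes f g :: "'k::field_char_0 mpoly"
  assumes "bij \<sigma>"
  shows "perm_poly \<sigma> (f * g) = perm_poly \<sigma> f * perm_poly \<sigma> g"
  using subset_UNIV[of "keys f"]
proof (induction f rule: poly_mapping_add_induct)
  case (single m c)
  have inj: "inj (inv_into UNIV \<sigma>)" using assms bij_imp_bij_inv bij_is_inj by blast
  show ?case
    using subset_UNIV[of "keys g"]
  proof (induction g rule: poly_mapping_add_induct)
    case (single m' c')
    show ?case by (simp only: perm_poly_single[OF assms] mult_single map_key_plus[OF inj])
  next
    case (add f g)
    then show ?case by (simp only: perm_poly_add[OF assms] distrib_left)
  qed (simp add: assms)
next
  case (add f g)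
  then show ?case by (simp only: perm_poly_add[OF assms] distrib_right)
qed (simp add: assms)

lemma inj_inv_bij: "bij \<sigma> \<Longrightarrow> inj (inv_into UNIV \<sigma>)"
  by (rule bij_is_inj[OF bij_imp_bij_inv])

lemma perm_poly_const [simp]: "bij \<sigma> \<Longrightarrow> perm_poly \<sigma> (mp_const c) = mp_const c"
  by (simp only: mp_const_def perm_poly_single map_key_zero[OF inj_inv_bij])

lemma perm_poly_1 [simp]: "bij \<sigma> \<Longrightarrow> perm_poly \<sigma> (1 :: 'k::field_char_0 mpoly) = 1"
  using perm_poly_const[of \<sigma> "1::'k"] by simp

lemma perm_poly_var [simp]:
  assumes "bij \<sigma>"
  shows "perm_poly \<sigma> (mp_var i) = mp_var (\<sigma> i)"
  using map_key_single[OF inj_inv_bij[OF assms], of "\<sigma> i" "1::nat"] assms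
  by (simp add: mp_var_def perm_poly_single inv_f_f bij_is_inj del: One_nat_def)

lemma perm_poly_comp:
  "bij \<sigma> \<Longrightarrow> bij \<tau> \<Longrightarrow> perm_poly \<sigma> (perm_poly \<tau> f) = perm_poly (\<sigma> \<circ> \<tau>) f"
  by (rule poly_mapping_eqI)
    (simp add: lookup_perm_poly bij_comp map_key_compose bij_is_inj)

lemma perm_poly_id [simp]: "perm_poly id f = f"
  by (rule poly_mapping_eqI) (simp add: lookup_perm_poly map_key_id[unfolded id_def[symmetric]])

lemma perm_poly_sum:
  fixes f :: "'a \<Rightarrow> 'k::field_char_0 mpoly"
  assumes "bij \<sigma>"
  shows "perm_poly \<sigma> (\<Sum>i\<in>I. f i) = (\<Sum>i\<in>I. perm_poly \<sigma> (f i))"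
  by (induction I rule: infinite_finite_induct) (auto simp: perm_poly_add assms)

lemma perm_poly_mpolys_in:
  fixes f :: "'k::field_char_0 mpoly"
  assumes b: "bij \<sigma>" and "\<sigma> ` A \<subseteq> A" and "f \<in> mpolys_in A"
  shows "perm_poly \<sigma> f \<in> mpolys_in A"
  using assms(3)
  by (induction rule: mpolys_in_induct)
    (use b assms(2) in \<open>auto simp: perm_poly_mult perm_poly_add mpolys_in_const
       intro!: mpolys_in_mult mpolys_in_add mpolys_in_var\<close>)


section \<open>Divided differences\<close>

abbreviation swap_poly :: "nat \<Rightarrow> 'k::zero mpoly \<Rightarrow> 'k mpoly" where
  "swap_poly i \<equiv> perm_poly (transpose i (Suc i))"

lemma swap_poly_swap_poly [simp]: "swap_poly i (swap_poly i f) = f"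
  by (simp add: perm_poly_comp)

lemma swap_poly_cases:
  fixes i j :: nat
  shows "(mp_var j :: 'k::field_char_0 mpoly) - swap_poly i (mp_var j)
    = (mp_var i - mp_var (Suc i)) * (if j = i then 1 else if j = Suc i then - 1 else 0)"
  by (simp add: transpose_def)

text \<open>The twisted Leibniz rule reduces divisibility to the variables.\<close>

lemma divided_difference_exists:
  fixes f :: "'k::field_char_0 mpoly"
  shows "\<exists>g. (mp_var i - mp_var (Suc i)) * g = f - swap_poly i f"
proof (induction f rule: mpoly_induct)
  case (const c)
  show ?case by (rule exI[of _ 0]) simp
next
  case (var j p)
  then obtain g where g: "(mp_var i - mp_var (Suc i)) * g = p - swap_poly i p" by blast
  define e :: "'k mpoly" where "e = (if j = i then 1 else if j = Suc i then - 1 else 0)"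
  have e: "(mp_var i - mp_var (Suc i)) * e = mp_var j - swap_poly i (mp_var j)"
    by (simp only: swap_poly_cases e_def)
  have "mp_var j * p - swap_poly i (mp_var j * p)
      = (mp_var j - swap_poly i (mp_var j)) * p + swap_poly i (mp_var j) * (p - swap_poly i p)"
    by (simp add: perm_poly_mult algebra_simps)
  also have "\<dots> = (mp_var i - mp_var (Suc i)) * (e * p + swap_poly i (mp_var j) * g)"
    by (simp only: e[symmetric] g[symmetric]) (simp add: algebra_simps)
  finally show ?case by metis
next
  case (add p q)
  then obtain g h where "(mp_var i - mp_var (Suc i)) * g = p - swap_poly i p"
    "(mp_var i - mp_var (Suc i)) * h = q - swap_poly i q" by blast
  then show ?case by (intro exI[of _ "g + h"]) (simp add: perm_poly_add algebra_simps)
qed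

lemma var_diff_cancel:
  fixes g h :: "'k::field_char_0 mpoly"
  shows "i \<noteq> j \<Longrightarrow> (mp_var i - mp_var j) * g = (mp_var i - mp_var j) * h \<longleftrightarrow> g = h"
  by simp

lemma divided_difference_eqI:
  fixes f g :: "'k::field_char_0 mpoly"
  shows "(mp_var i - mp_var (Suc i)) * g = f - swap_poly i f \<Longrightarrow> divided_difference i f = g"
  unfolding divided_difference_def
  by (rule the_equality) (assumption, rule var_diff_cancel[of i "Suc i", THEN iffD1], simp_all)

lemma divided_difference_spec:
  "(mp_var i - mp_var (Suc i)) * divided_difference i f = f - swap_poly i f"
  using divided_difference_exists[of i f] divided_difference_eqI by metis

lemma divided_difference_add:
  "divided_difference i (f + g) = divided_difference i f + divided_difference i g"
  by (rule divided_difference_eqI)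
    (simp add: distrib_left divided_difference_spec perm_poly_add)

lemma divided_difference_mult:
  "divided_difference i (f * g) = divided_difference i f * g + swap_poly i f * divided_difference i g"
proof (rule divided_difference_eqI)
  have "(mp_var i - mp_var (Suc i)) * (divided_difference i f * g + swap_poly i f * divided_difference i g)
     = ((mp_var i - mp_var (Suc i)) * divided_difference i f) * g
       + swap_poly i f * ((mp_var i - mp_var (Suc i)) * divided_difference i g)"
    by (simp add: algebra_simps)
  also have "\<dots> = f * g - swap_poly i (f * g)"
    by (simp only: divided_difference_spec) (simp add: perm_poly_mult algebra_simps)
  finally show "(mp_var i - mp_var (Suc i)) * (divided_difference i f * g + swap_poly i f * divided_difference i g)
     = f * g - swap_poly i (f * g)" .
qed

lemma divided_difference_eq_0_iff: "divided_difference i f = 0 \<longleftrightarrow> swap_poly i f = f"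
  using divided_difference_spec[of i f]
  by (metis divided_difference_eqI mult_zero_right n_not_Suc_n right_minus_eq)

lemma divided_difference_sym_mult:
  "swap_poly i f = f \<Longrightarrow> divided_difference i (f * g) = f * divided_difference i g"
  by (simp add: divided_difference_mult divided_difference_eq_0_iff[THEN iffD2])

lemma divided_difference_const [simp]: "divided_difference i (mp_const c) = 0"
  by (simp add: divided_difference_eq_0_iff)

lemma divided_difference_0 [simp]: "divided_difference i 0 = 0"
  by (simp add: divided_difference_eq_0_iff)

lemma divided_difference_const_mult:
  "divided_difference i (mp_const c * f) = mp_const c * divided_difference i f"
  by (simp add: divided_difference_sym_mult)

lemma divided_difference_var:
  "divided_difference i (mp_var j) = (if j = i then 1 else if j = Suc i then - 1 else 0)"
  by (rule divided_difference_eqI) (simp only: swap_poly_cases)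

lemma divided_difference_mpolys_in:
  fixes f :: "'k::field_char_0 mpoly"
  assumes "i \<in> A" "Suc i \<in> A" "f \<in> mpolys_in A"
  shows "divided_difference i f \<in> mpolys_in A"
  using assms(3)
proof (induction rule: mpolys_in_induct)
  case (var j p)
  then show ?case
    using assms(1,2) perm_poly_mpolys_in[of "transpose i (Suc i)" A "mp_var j"]
    by (auto simp: divided_difference_mult divided_difference_var transpose_def
        intro!: mpolys_in_add mpolys_in_mult mpolys_in_var mpolys_in_diff)
qed (auto simp: divided_difference_add intro: mpolys_in_add)

text \<open>These identities and the next ones make the action of the nilHecke algebra well defined.\<close>

lemma divided_difference_var_mult:
  fixes f :: "'k::field_char_0 mpoly"
  shows "divided_difference i (mp_var i * f) = f + mp_var (Suc i) * divided_difference i f"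
    and "divided_difference i (mp_var (Suc i) * f) = mp_var i * divided_difference i f - f"
    and "j \<noteq> i \<Longrightarrow> j \<noteq> Suc i \<Longrightarrow>
      divided_difference i (mp_var j * f) = mp_var j * divided_difference i f"
  by (simp_all add: divided_difference_mult divided_difference_var)

text \<open>A divided difference is symmetric in the two variables concerned, because numerator and
  denominator both change sign.\<close>

lemma divided_difference_square: "divided_difference i (divided_difference i f) = 0"
proof -
  let ?D = "divided_difference i f"
  have "(mp_var (Suc i) - mp_var i) * swap_poly i ?D = swap_poly i f - f"
    using arg_cong[OF divided_difference_spec[of i f], of "swap_poly i"]
    by (simp add: perm_poly_mult perm_poly_diff)
  then have "(mp_var i - mp_var (Suc i)) * swap_poly i ?D = f - swap_poly i f"
    by (simp add: algebra_simps)
  then have "(mp_var i - mp_var (Suc i)) * swap_poly i ?D = (mp_var i - mp_var (Suc i)) * ?D"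
    by (simp only: divided_difference_spec)
  then show ?thesis by (simp add: divided_difference_eq_0_iff)
qed

lemma divided_difference_commute:
  fixes f :: "'k::field_char_0 mpoly"
  assumes "Suc i < j"
  shows "divided_difference i (divided_difference j f) = divided_difference j (divided_difference i f)"
proof -
  let ?a = "mp_var i - mp_var (Suc i) :: 'k mpoly" and ?b = "mp_var j - mp_var (Suc j) :: 'k mpoly"
  have sa: "swap_poly j ?a = ?a" and sb: "swap_poly i ?b = ?b"
    using assms by (simp_all add: perm_poly_diff transpose_def)
  have comm: "swap_poly i (swap_poly j f) = swap_poly j (swap_poly i f)"
  proof -
    have "transpose i (Suc i) \<circ> transpose j (Suc j) = transpose j (Suc j) \<circ> transpose i (Suc i)"
      using assms by (auto simp: transpose_def fun_eq_iff)
    then show ?thesis by (simp add: perm_poly_comp)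
  qed
  have 1: "?b * (?a * divided_difference i (divided_difference j f))
      = f - swap_poly j f - swap_poly i f + swap_poly i (swap_poly j f)"
  proof -
    have "?b * (?a * divided_difference i (divided_difference j f))
        = ?b * (divided_difference j f - swap_poly i (divided_difference j f))"
      by (simp only: divided_difference_spec)
    also have "\<dots> = ?b * divided_difference j f - swap_poly i (?b * divided_difference j f)"
      by (simp only: perm_poly_mult[OF bij_transpose] sb right_diff_distrib)
    finally show ?thesis by (simp only: divided_difference_spec) (simp add: perm_poly_diff algebra_simps)
  qed
  have 2: "?a * (?b * divided_difference j (divided_difference i f))
      = f - swap_poly i f - swap_poly j f + swap_poly j (swap_poly i f)"
  proof -
    have "?a * (?b * divided_difference j (divided_difference i f))
        = ?a * (divided_difference i f - swap_poly j (divided_difference i f))"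
      by (simp only: divided_difference_spec)
    also have "\<dots> = ?a * divided_difference i f - swap_poly j (?a * divided_difference i f)"
      by (simp only: perm_poly_mult[OF bij_transpose] sa right_diff_distrib)
    finally show ?thesis by (simp only: divided_difference_spec) (simp add: perm_poly_diff algebra_simps)
  qed
  have "(?a * ?b) * divided_difference i (divided_difference j f)
      = (?a * ?b) * divided_difference j (divided_difference i f)"
    using 1 2 comm by (simp add: ac_simps)
  moreover have "?a * ?b \<noteq> 0" by simp
  ultimately show ?thesis by (metis mult_cancel_left)
qed

text \<open>Multiplied by the Vandermonde product of three variables, either side of the braid relation
  becomes the alternating sum over the symmetric group on these variables. The two sides use the
  two reduced words of its longest element, so their last summands agree because the
  transpositions satisfy the braid relation.\<close>

lemma divided_difference_braid:
  fixes f :: "'k::field_char_0 mpoly"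
  shows "divided_difference i (divided_difference (Suc i) (divided_difference i f))
    = divided_difference (Suc i) (divided_difference i (divided_difference (Suc i) f))"
proof -
  define s t where "s = (swap_poly i :: 'k mpoly \<Rightarrow> _)" and "t = (swap_poly (Suc i) :: 'k mpoly \<Rightarrow> _)"
  define a b c where "a = (mp_var i :: 'k mpoly)" and "b = (mp_var (Suc i) :: 'k mpoly)"
    and "c = (mp_var (Suc (Suc i)) :: 'k mpoly)"
  have hom: "s (p * q) = s p * s q" "t (p * q) = t p * t q" "s (p - q) = s p - s q"
    "t (p - q) = t p - t q" "s (p + q) = s p + s q" "t (p + q) = t p + t q" for p q
    by (simp_all add: s_def t_def perm_poly_mult perm_poly_diff perm_poly_add)
  have vars: "s a = b" "s b = a" "s c = c" "t a = a" "t b = c" "t c = b"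
    by (simp_all add: s_def t_def a_def b_def c_def transpose_def)
  have sq: "s (s p) = p" "t (t p) = p" for p by (simp_all add: s_def t_def)
  have braid: "s (t (s f)) = t (s (t f))"
  proof -
    have "transpose i (Suc i) \<circ> (transpose (Suc i) (Suc (Suc i)) \<circ> transpose i (Suc i))
        = transpose (Suc i) (Suc (Suc i)) \<circ> (transpose i (Suc i) \<circ> transpose (Suc i) (Suc (Suc i)))"
      by (auto simp: transpose_def fun_eq_iff)
    then show ?thesis by (simp add: s_def t_def perm_poly_comp bij_comp)
  qed
  have Ds: "(a - b) * divided_difference i p = p - s p" for p
    by (simp add: a_def b_def s_def divided_difference_spec)
  have Dt: "(b - c) * divided_difference (Suc i) p = p - t p" for p
    by (simp add: c_def b_def t_def divided_difference_spec)
  have 1: "((a - b) * (b - c) * (a - c)) * divided_difference i (divided_difference (Suc i) (divided_difference i f))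
      = f - s f - t f + t (s f) + s (t f) - s (t (s f))" (is "?V * ?L = _")
  proof -
    define P Q where "P = divided_difference i f" and "Q = divided_difference (Suc i) P"
    have P: "(a - b) * P = f - s f" and Q: "(b - c) * Q = P - t P"
      by (simp_all only: P_def Q_def Ds Dt)
    have sP: "s P = P" by (simp add: P_def s_def divided_difference_square flip: divided_difference_eq_0_iff)
    have tP: "(a - c) * t P = t f - t (s f)" using arg_cong[OF P, of t] by (simp only: hom vars)
    have stP: "(b - c) * s (t P) = s (t f) - s (t (s f))"
      using arg_cong[OF tP, of s] by (simp only: hom vars)
    have sQ: "(a - c) * s Q = P - s (t P)" using arg_cong[OF Q, of s] by (simp only: hom vars sP)
    have "?V * ?L = (b - c) * (a - c) * ((a - b) * divided_difference i Q)"
      by (simp only: Q_def P_def ac_simps)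
    also have "\<dots> = (a - c) * ((b - c) * Q) - (b - c) * ((a - c) * s Q)"
      by (simp only: Ds) (simp add: algebra_simps)
    also have "\<dots> = (a - b) * P - (a - c) * t P + (b - c) * s (t P)"
      by (simp only: Q sQ) (simp add: algebra_simps)
    finally show ?thesis by (simp only: P tP stP) (simp add: algebra_simps)
  qed
  have 2: "((a - b) * (b - c) * (a - c)) * divided_difference (Suc i) (divided_difference i (divided_difference (Suc i) f))
      = f - t f - s f + s (t f) + t (s f) - t (s (t f))" (is "?V * ?R = _")
  proof -
    define P Q where "P = divided_difference (Suc i) f" and "Q = divided_difference i P"
    have P: "(b - c) * P = f - t f" and Q: "(a - b) * Q = P - s P"
      by (simp_all only: P_def Q_def Ds Dt)
    have tP: "t P = P" by (simp add: P_def t_def divided_difference_square flip: divided_difference_eq_0_iff)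
    have sP: "(a - c) * s P = s f - s (t f)" using arg_cong[OF P, of s] by (simp only: hom vars)
    have tsP: "(a - b) * t (s P) = t (s f) - t (s (t f))"
      using arg_cong[OF sP, of t] by (simp only: hom vars)
    have tQ: "(a - c) * t Q = P - t (s P)" using arg_cong[OF Q, of t] by (simp only: hom vars tP)
    have "?V * ?R = (a - b) * (a - c) * ((b - c) * divided_difference (Suc i) Q)"
      by (simp only: Q_def P_def ac_simps)
    also have "\<dots> = (a - c) * ((a - b) * Q) - (a - b) * ((a - c) * t Q)"
      by (simp only: Dt) (simp add: algebra_simps)
    also have "\<dots> = (b - c) * P - (a - c) * s P + (a - b) * t (s P)"
      by (simp only: Q tQ) (simp add: algebra_simps)
    finally show ?thesis by (simp only: P sP tsP) (simp add: algebra_simps)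
  qed
  have "?V * ?L = ?V * ?R" by (simp only: 1 2 braid) (simp add: algebra_simps)
  moreover have "?V \<noteq> 0"
    by (simp add: a_def b_def c_def)
  ultimately show ?thesis by (metis mult_cancel_left)
qed

lemma transpose_invariant:
  fixes f :: "'k::field_char_0 mpoly"
  assumes adj: "\<And>i. i \<in> {1..<n} \<Longrightarrow> swap_poly i f = f"
    and "1 \<le> i" "i < j" "j \<le> n"
  shows "perm_poly (transpose i j) f = f"
  using Suc_leI[OF \<open>i < j\<close>] \<open>j \<le> n\<close>
proof (induction j rule: nat_induct_at_least)
  case base
  then show ?case using adj[of i] \<open>1 \<le> i\<close> by simp
next
  case (Suc j)
  have s: "swap_poly j f = f" using adj[of j] Suc \<open>1 \<le> i\<close> by simp
  have "transpose i (Suc j) = transpose j (Suc j) \<circ> (transpose i j \<circ> transpose j (Suc j))"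
    using Suc.hyps by (auto simp: transpose_def fun_eq_iff)
  then have "perm_poly (transpose i (Suc j)) f = swap_poly j (perm_poly (transpose i j) (swap_poly j f))"
    by (simp add: perm_poly_comp bij_comp)
  then show ?case using Suc s by simp
qed

text \<open>Adjacent transpositions generate the symmetric group, so it is enough to test these.\<close>

lemma sym_ringI:
  fixes f :: "'k::field_char_0 mpoly"
  assumes "f \<in> poly_ring n" and adj: "\<And>i. i \<in> {1..<n} \<Longrightarrow> swap_poly i f = f"
  shows "f \<in> sym_ring n"
proof -
  have "perm_poly \<sigma> f = f" if "\<sigma> permutes {1..n}" for \<sigma>
    using that finite_atLeastAtMost
  proof (induction rule: permutes_induct)
    case id show ?case by (simp flip: id_def)
  next
    case (swap a b p)
    have "perm_poly (transpose a b) f = f"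
      using transpose_invariant[OF adj, of n a b] transpose_invariant[OF adj, of n b a] swap
      by (cases a b rule: linorder_cases) (auto simp: transpose_commute)
    moreover have "bij p" using swap permutes_bij by blast
    ultimately show ?case using swap perm_poly_comp[of "transpose a b" p f] by (simp del: o_apply add: o_def[symmetric])
  qed
  then show ?thesis using assms(1) by (simp add: sym_ring_def)
qed

lemma sym_ringD:
  "f \<in> sym_ring n \<Longrightarrow> f \<in> poly_ring n"
  "f \<in> sym_ring n \<Longrightarrow> i \<in> {1..n} \<Longrightarrow> j \<in> {1..n} \<Longrightarrow> perm_poly (transpose i j) f = f"
  by (auto simp: sym_ring_def permutes_swap_id)

lemma sym_ring_const: "mp_const (c::'k::field_char_0) \<in> sym_ring n"
  by (auto simp: sym_ring_def poly_ring_eq_mpolys_in mpolys_in_const permutes_bij)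

lemma sym_ring_add: "f \<in> sym_ring n \<Longrightarrow> g \<in> sym_ring n \<Longrightarrow> f + g \<in> sym_ring n"
  for f :: "'k::field_char_0 mpoly"
  by (auto simp: sym_ring_def poly_ring_eq_mpolys_in mpolys_in_add permutes_bij perm_poly_add)

lemma sym_ring_mult: "f \<in> sym_ring n \<Longrightarrow> g \<in> sym_ring n \<Longrightarrow> f * g \<in> sym_ring n"
  for f :: "'k::field_char_0 mpoly"
  by (auto simp: sym_ring_def poly_ring_eq_mpolys_in mpolys_in_mult permutes_bij perm_poly_mult)

lemma sym_ring_uminus: "f \<in> sym_ring n \<Longrightarrow> - f \<in> sym_ring n"
  for f :: "'k::field_char_0 mpoly"
  by (auto simp: sym_ring_def poly_ring_eq_mpolys_in mpolys_in_uminus permutes_bij perm_poly_uminus)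

lemma sym_ring_diff: "f \<in> sym_ring n \<Longrightarrow> g \<in> sym_ring n \<Longrightarrow> f - g \<in> sym_ring n"
  for f :: "'k::field_char_0 mpoly"
  using sym_ring_add[of f n "- g"] sym_ring_uminus[of g n] by simp

lemma sym_ring_0: "(0::'k::field_char_0 mpoly) \<in> sym_ring n"
  using sym_ring_const[of 0] by simp

lemma sym_ring_1: "(1::'k::field_char_0 mpoly) \<in> sym_ring n"
  using sym_ring_const[of 1] by simp

lemma sym_ring_sum:
  fixes f :: "'a \<Rightarrow> 'k::field_char_0 mpoly"
  shows "(\<And>i. i \<in> I \<Longrightarrow> f i \<in> sym_ring n) \<Longrightarrow> (\<Sum>i\<in>I. f i) \<in> sym_ring n"
  by (induction I rule: infinite_finite_induct) (auto intro: sym_ring_add sym_ring_0)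


section \<open>The free algebra and its action on polynomials\<close>

lemma gen_act_add: "gen_act g (p + q) = gen_act g p + gen_act g q"
  by (cases g) (simp_all add: distrib_left divided_difference_add)

lemma gen_act_const_mult: "gen_act g (mp_const c * p) = mp_const c * gen_act g p"
  by (cases g) (simp_all add: mult.left_commute divided_difference_const_mult)

lemma gen_act_0 [simp]: "gen_act g 0 = 0"
  by (cases g) simp_all

abbreviation word_act :: "nh_gen list \<Rightarrow> 'k::field_char_0 mpoly \<Rightarrow> 'k mpoly" where
  "word_act w \<equiv> foldr gen_act w"

lemma word_act_add: "word_act w (p + q) = word_act w p + word_act w q"
  by (induction w) (simp_all add: gen_act_add)

lemma word_act_const_mult: "word_act w (mp_const c * p) = mp_const c * word_act w p"
  by (induction w) (simp_all add: gen_act_const_mult)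

lemma word_act_0 [simp]: "word_act w 0 = 0"
  by (induction w) simp_all

lemma free_act_single: "free_act (single w c) p = mp_const c * word_act (letters w) p"
  by (simp add: free_act_def)

lemma free_act_0 [simp]: "free_act 0 p = 0"
  by (simp add: free_act_def)

lemma free_act_add: "free_act (\<phi> + \<psi>) p = free_act \<phi> p + free_act \<psi> p"
  unfolding free_act_def
  by (rule setsum_keys_plus_distrib) (simp_all add: distrib_right)

lemma free_act_uminus: "free_act (- \<phi>) p = - free_act \<phi> p"
  using free_act_add[of "- \<phi>" \<phi> p] by (simp add: eq_neg_iff_add_eq_0)

lemma free_act_diff: "free_act (\<phi> - \<psi>) p = free_act \<phi> p - free_act \<psi> p"
  using free_act_add[of \<phi> "- \<psi>" p] by (simp add: free_act_uminus)

lemma free_act_add_right: "free_act \<phi> (p + q) = free_act \<phi> p + free_act \<phi> q"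
  by (simp add: free_act_def word_act_add distrib_left sum.distrib)

lemma free_act_0_right [simp]: "free_act \<phi> 0 = 0"
  by (simp add: free_act_def)

lemma free_act_uminus_right: "free_act \<phi> (- p) = - free_act \<phi> p"
  using free_act_add_right[of \<phi> "- p" p] by (simp add: eq_neg_iff_add_eq_0)

lemma free_act_diff_right: "free_act \<phi> (p - q) = free_act \<phi> p - free_act \<phi> q"
  using free_act_add_right[of \<phi> p "- q"] by (simp add: free_act_uminus_right)

lemma letters_add [simp]: "letters (u + v) = letters u @ letters v"
  by (simp add: plus_nh_word_def)

lemma letters_0 [simp]: "letters 0 = []"
  by (simp add: zero_nh_word_def)

lemma free_act_mult: "free_act (\<phi> * \<psi>) p = free_act \<phi> (free_act \<psi> p)"
  using subset_UNIV[of "keys \<phi>"]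
proof (induction \<phi> rule: poly_mapping_add_induct)
  case (single w c)
  show ?case
    using subset_UNIV[of "keys \<psi>"]
    by (induction \<psi> rule: poly_mapping_add_induct)
      (simp_all add: mult_single free_act_single word_act_const_mult mult.assoc distrib_left
        free_act_add free_act_add_right)
qed (simp_all add: distrib_right free_act_add)

lemma fr_const_simps [simp]:
  shows "fr_const 0 = 0" and "fr_const (1::'k::field_char_0) = 1"
    and "fr_const (a + b :: 'k) = fr_const a + fr_const b"
    and "fr_const (a * b :: 'k) = fr_const a * fr_const b"
    and "fr_const (- a :: 'k) = - fr_const a"
  by (simp_all add: fr_const_def single_add mult_single single_uminus)

lemma fr_const_commute: "\<phi> * fr_const c = fr_const (c::'k::field_char_0) * \<phi>"
  using subset_UNIV[of "keys \<phi>"]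
  by (induction \<phi> rule: poly_mapping_add_induct)
    (simp_all add: fr_const_def mult_single mult.commute distrib_left distrib_right)

lemma fr_word_Nil [simp]: "fr_word [] = 1"
  by (simp add: fr_word_def flip: zero_nh_word_def)

lemma fr_word_append: "fr_word (u @ v) = fr_word u * (fr_word v :: 'k::field_char_0 free_nh)"
  by (simp add: fr_word_def mult_single plus_nh_word_def)

lemma fr_word_Cons: "fr_word (g # w) = fr_word [g] * (fr_word w :: 'k::field_char_0 free_nh)"
  using fr_word_append[of "[g]" w] by simp

lemma free_act_const [simp]: "free_act (fr_const c) p = mp_const c * p"
  by (simp add: fr_const_def free_act_single)

lemma free_act_1 [simp]: "free_act 1 p = p"
  using free_act_const[of 1 p] by simp

lemma free_act_word [simp]: "free_act (fr_word w) p = word_act w p"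
  by (simp add: fr_word_def free_act_single)

lemma free_alg_sel [simp]:
  "monoid.mult (free_alg n) = (*)" "one (free_alg n) = 1" "zero (free_alg n) = 0"
  "add (free_alg n) = (+)"
  by (simp_all add: free_alg_def)

lemma free_alg_carrier_iff:
  "\<phi> \<in> carrier (free_alg n) \<longleftrightarrow> (\<forall>w\<in>keys \<phi>. set (letters w) \<subseteq> nh_gens n)"
  by (simp add: free_alg_def)

lemma free_alg_add: "\<phi> \<in> carrier (free_alg n) \<Longrightarrow> \<psi> \<in> carrier (free_alg n) \<Longrightarrow> \<phi> + \<psi> \<in> carrier (free_alg n)"
  unfolding free_alg_carrier_iff using Poly_Mapping.keys_add[of \<phi> \<psi>] by blast

lemma free_alg_uminus: "\<phi> \<in> carrier (free_alg n) \<Longrightarrow> - \<phi> \<in> carrier (free_alg n)"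
  by (auto simp: free_alg_carrier_iff in_keys_iff)

lemma free_alg_diff: "\<phi> \<in> carrier (free_alg n) \<Longrightarrow> \<psi> \<in> carrier (free_alg n) \<Longrightarrow> \<phi> - \<psi> \<in> carrier (free_alg n)"
  using free_alg_add[of \<phi> n "- \<psi>"] free_alg_uminus[of \<psi> n] by simp

lemma free_alg_mult:
  assumes "\<phi> \<in> carrier (free_alg n)" "\<psi> \<in> carrier (free_alg n)"
  shows "\<phi> * \<psi> \<in> carrier (free_alg n)"
proof -
  have "set (letters w) \<subseteq> nh_gens n" if w: "w \<in> keys (\<phi> * \<psi>)" for w
  proof -
    obtain a b where ab: "w = a + b" "a \<in> keys \<phi>" "b \<in> keys \<psi>"
      using subsetD[OF keys_mult w] by blast
    then show ?thesis using assms unfolding free_alg_carrier_iff by auto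
  qed
  then show ?thesis by (simp add: free_alg_carrier_iff)
qed

lemma free_alg_const [simp]: "fr_const c \<in> carrier (free_alg n)"
  by (simp add: free_alg_carrier_iff fr_const_def)

lemma free_alg_0 [simp]: "0 \<in> carrier (free_alg n)"
  by (simp add: free_alg_carrier_iff)

lemma free_alg_1 [simp]: "1 \<in> carrier (free_alg n)"
  by (simp add: free_alg_carrier_iff)

lemma free_alg_word: "set w \<subseteq> nh_gens n \<Longrightarrow> fr_word w \<in> carrier (free_alg n)"
  by (simp add: free_alg_carrier_iff fr_word_def)

lemma free_alg_x [simp]: "i \<in> {1..n} \<Longrightarrow> fr_x i \<in> carrier (free_alg n)"
  by (simp add: free_alg_word nh_gens_def)

lemma free_alg_d [simp]: "i \<in> {1..<n} \<Longrightarrow> fr_d i \<in> carrier (free_alg n)"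
  by (simp add: free_alg_word nh_gens_def)

lemmas free_alg_closed = free_alg_add free_alg_uminus free_alg_diff free_alg_mult

lemma free_alg_induct [consumes 1, case_names const gen add]:
  assumes \<phi>: "\<phi> \<in> carrier (free_alg n)"
    and const: "\<And>c. P (fr_const c)"
    and gen: "\<And>g \<phi>. g \<in> nh_gens n \<Longrightarrow> \<phi> \<in> carrier (free_alg n) \<Longrightarrow> P \<phi> \<Longrightarrow> P (fr_word [g] * \<phi>)"
    and add: "\<And>\<phi> \<psi>. \<phi> \<in> carrier (free_alg n) \<Longrightarrow> \<psi> \<in> carrier (free_alg n) \<Longrightarrow>
      P \<phi> \<Longrightarrow> P \<psi> \<Longrightarrow> P (\<phi> + \<psi>)"
  shows "P \<phi>"
proof -
  let ?R = "\<lambda>\<phi>. \<phi> \<in> carrier (free_alg n) \<and> P \<phi>"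
  have word: "?R (single (Word w) c)" if "set w \<subseteq> nh_gens n" for w c
    using that
  proof (induction w)
    case Nil
    show ?case using const[of c] free_alg_const[of c n]
      by (simp only: fr_const_def zero_nh_word_def)
  next
    case (Cons g w)
    have "single (Word (g # w)) c = fr_word [g] * single (Word w) c"
      by (simp add: fr_word_def mult_single plus_nh_word_def)
    then show ?case using Cons gen by (simp add: free_alg_mult free_alg_word)
  qed
  have "keys \<phi> \<subseteq> {w. set (letters w) \<subseteq> nh_gens n}"
    using \<phi> by (auto simp: free_alg_carrier_iff)
  then have "?R \<phi>"
  proof (induction \<phi> rule: poly_mapping_add_induct)
    case (single w c)
    then show ?case using word[of "letters w" c] by simp
  next
    case zero
    show ?case using const[of 0] by simp
  qed (auto intro: add free_alg_add)
  then show ?thesis by simp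
qed

lemma free_act_poly_ring:
  assumes "\<phi> \<in> carrier (free_alg n)" "p \<in> poly_ring n"
  shows "free_act \<phi> p \<in> poly_ring n"
  using assms(1)
proof (induction rule: free_alg_induct)
  case (gen g \<phi>)
  then have "gen_act g (free_act \<phi> p) \<in> poly_ring n"
    by (auto simp: nh_gens_def poly_ring_eq_mpolys_in intro!: mpolys_in_mult mpolys_in_var
        divided_difference_mpolys_in)
  then show ?case by (simp add: free_act_mult)
qed (use assms(2) in \<open>auto simp: free_act_add poly_ring_eq_mpolys_in mpolys_in_add mpolys_in_mult mpolys_in_const\<close>)

lemma free_act_sym_mult:
  assumes "\<phi> \<in> carrier (free_alg n)" "s \<in> sym_ring n"
  shows "free_act \<phi> (s * p) = s * free_act \<phi> p"
  using assms(1)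
proof (induction rule: free_alg_induct)
  case (gen g \<phi>)
  then show ?case using assms(2)
    by (auto simp: nh_gens_def free_act_mult divided_difference_sym_mult sym_ringD(2) mult.left_commute)
qed (auto simp: free_act_add algebra_simps)


section \<open>The nilHecke algebra as a quotient of the free algebra\<close>

lemma free_alg_ring: "ring (free_alg n :: 'k::field_char_0 free_nh ring)"
proof (intro ringI abelian_groupI monoidI)
  fix x :: "'k free_nh" assume "x \<in> carrier (free_alg n)"
  then show "\<exists>y\<in>carrier (free_alg n). y \<oplus>\<^bsub>free_alg n\<^esub> x = \<zero>\<^bsub>free_alg n\<^esub>"
    by (intro bexI[of _ "- x"]) (simp_all add: free_alg_uminus)
qed (simp_all add: free_alg_closed algebra_simps)

lemma free_alg_a_inv: "\<phi> \<in> carrier (free_alg n) \<Longrightarrow> a_inv (free_alg n) \<phi> = - \<phi>"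
  by (rule abelian_group.minus_equality[OF ring.is_abelian_group[OF free_alg_ring]])
    (simp_all add: free_alg_uminus)

lemma nh_relations_in_carrier: "nh_relations n \<subseteq> carrier (free_alg n)"
  unfolding nh_relations_def by (auto intro!: free_alg_closed)

lemma nh_ideal_ideal: "ideal (nh_ideal n) (free_alg n)"
  unfolding nh_ideal_def by (rule ring.genideal_ideal[OF free_alg_ring nh_relations_in_carrier])

lemma nh_relations_in_ideal: "r \<in> nh_relations n \<Longrightarrow> r \<in> nh_ideal n"
  unfolding nh_ideal_def using ring.genideal_self[OF free_alg_ring nh_relations_in_carrier] by blast

lemma nh_ideal_closed:
  fixes \<phi> \<psi> :: "'k::field_char_0 free_nh"
  shows "\<phi> \<in> nh_ideal n \<Longrightarrow> \<phi> \<in> carrier (free_alg n)"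
    and "(0 :: 'k free_nh) \<in> nh_ideal n"
    and "\<phi> \<in> nh_ideal n \<Longrightarrow> \<psi> \<in> nh_ideal n \<Longrightarrow> \<phi> + \<psi> \<in> nh_ideal n"
    and "\<phi> \<in> nh_ideal n \<Longrightarrow> - \<phi> \<in> nh_ideal n"
    and "\<phi> \<in> nh_ideal n \<Longrightarrow> \<psi> \<in> carrier (free_alg n) \<Longrightarrow> \<psi> * \<phi> \<in> nh_ideal n"
    and "\<phi> \<in> nh_ideal n \<Longrightarrow> \<psi> \<in> carrier (free_alg n) \<Longrightarrow> \<phi> * \<psi> \<in> nh_ideal n"
proof -
  interpret ideal "nh_ideal n :: 'k free_nh set" "free_alg n" by (rule nh_ideal_ideal)
  show sub: "\<phi> \<in> nh_ideal n \<Longrightarrow> \<phi> \<in> carrier (free_alg n)" for \<phi> :: "'k free_nh" by (rule a_Hcarr)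
  show "(0 :: 'k free_nh) \<in> nh_ideal n" using additive_subgroup.zero_closed[OF is_additive_subgroup] by simp
  show "\<phi> \<in> nh_ideal n \<Longrightarrow> \<psi> \<in> nh_ideal n \<Longrightarrow> \<phi> + \<psi> \<in> nh_ideal n"
    using additive_subgroup.a_closed[OF is_additive_subgroup, of \<phi> \<psi>] by simp
  show "\<phi> \<in> nh_ideal n \<Longrightarrow> - \<phi> \<in> nh_ideal n"
    using additive_subgroup.a_inv_closed[OF is_additive_subgroup, of \<phi>] free_alg_a_inv[OF sub] by simp
  show "\<phi> \<in> nh_ideal n \<Longrightarrow> \<psi> \<in> carrier (free_alg n) \<Longrightarrow> \<psi> * \<phi> \<in> nh_ideal n"
    using I_l_closed by simp
  show "\<phi> \<in> nh_ideal n \<Longrightarrow> \<psi> \<in> carrier (free_alg n) \<Longrightarrow> \<phi> * \<psi> \<in> nh_ideal n"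
    using I_r_closed by simp
qed

lemma free_act_relation:
  assumes "r \<in> nh_relations n"
  shows "free_act r p = 0"
proof -
  note act = free_act_diff free_act_mult free_act_word foldr.simps o_apply id_apply gen_act.simps
  note dd = divided_difference_square divided_difference_braid divided_difference_var_mult
  have comm: "divided_difference i (divided_difference j p) = divided_difference j (divided_difference i p)"
    if "1 < \<bar>int i - int j\<bar>" for i j
  proof -
    have "Suc i < j \<or> Suc j < i" using that by auto
    then show ?thesis using divided_difference_commute by metis
  qed
  show ?thesis
    using assms unfolding nh_relations_def
    by (elim UnE CollectE exE conjE)
      (simp_all add: act dd comm mult.left_commute)
qed

text \<open>The elements that act by zero form a two-sided ideal, and it contains the relations.\<close>

lemma free_act_ideal:
  assumes "\<phi> \<in> nh_ideal n"
  shows "free_act \<phi> p = 0"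
proof -
  let ?K = "{\<phi> \<in> carrier (free_alg n). \<forall>p. free_act \<phi> p = 0}"
  have "ideal ?K (free_alg n)"
  proof (rule idealI[OF free_alg_ring])
    show "subgroup ?K (add_monoid (free_alg n))"
    proof
      fix x assume "x \<in> ?K"
      then show "inv\<^bsub>add_monoid (free_alg n)\<^esub> x \<in> ?K"
        using free_alg_a_inv[of x n] by (simp add: a_inv_def free_alg_uminus free_act_uminus)
    qed (auto simp: free_alg_add free_act_add)
  qed (auto simp: free_alg_mult free_act_mult)
  then have "nh_ideal n \<subseteq> ?K"
    unfolding nh_ideal_def
    by (rule ring.genideal_minimal[OF free_alg_ring])
      (use nh_relations_in_carrier[of n] in \<open>auto simp: free_act_relation\<close>)
  then show ?thesis using assms by blast
qed

text \<open>Calculations in the nilHecke algebra are done with representatives in the free algebra. Only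
  members of the carrier are compared, since the ideal absorbs no other factors.\<close>

definition nh_cong :: "nat \<Rightarrow> 'k::field_char_0 free_nh \<Rightarrow> 'k free_nh \<Rightarrow> bool" where
  "nh_cong n \<phi> \<psi> \<longleftrightarrow>
     \<phi> \<in> carrier (free_alg n) \<and> \<psi> \<in> carrier (free_alg n) \<and> \<phi> - \<psi> \<in> nh_ideal n"

lemma nh_cong_refl [intro]: "\<phi> \<in> carrier (free_alg n) \<Longrightarrow> nh_cong n \<phi> \<phi>"
  by (simp add: nh_cong_def nh_ideal_closed)

lemma nh_cong_sym: "nh_cong n \<phi> \<psi> \<Longrightarrow> nh_cong n \<psi> \<phi>"
  using nh_ideal_closed(4)[of "\<phi> - \<psi>" n] by (simp add: nh_cong_def)

lemma nh_cong_trans [trans]: "nh_cong n \<phi> \<psi> \<Longrightarrow> nh_cong n \<psi> \<chi> \<Longrightarrow> nh_cong n \<phi> \<chi>"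
  using nh_ideal_closed(3)[of "\<phi> - \<psi>" n "\<psi> - \<chi>"] by (simp add: nh_cong_def)

lemma nh_cong_carrier:
  "nh_cong n \<phi> \<psi> \<Longrightarrow> \<phi> \<in> carrier (free_alg n)"
  "nh_cong n \<phi> \<psi> \<Longrightarrow> \<psi> \<in> carrier (free_alg n)"
  by (simp_all add: nh_cong_def)

lemma nh_cong_add: "nh_cong n \<phi> \<psi> \<Longrightarrow> nh_cong n \<phi>' \<psi>' \<Longrightarrow> nh_cong n (\<phi> + \<phi>') (\<psi> + \<psi>')"
  using nh_ideal_closed(3)[of "\<phi> - \<psi>" n "\<phi>' - \<psi>'"] by (simp add: nh_cong_def free_alg_add algebra_simps)

lemma nh_cong_diff: "nh_cong n \<phi> \<psi> \<Longrightarrow> nh_cong n \<phi>' \<psi>' \<Longrightarrow> nh_cong n (\<phi> - \<phi>') (\<psi> - \<psi>')"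
  using nh_ideal_closed(3)[of "\<phi> - \<psi>" n "- (\<phi>' - \<psi>')"] nh_ideal_closed(4)[of "\<phi>' - \<psi>'" n]
  by (simp add: nh_cong_def free_alg_diff algebra_simps)

lemma nh_cong_mult_left: "nh_cong n \<phi> \<psi> \<Longrightarrow> \<chi> \<in> carrier (free_alg n) \<Longrightarrow> nh_cong n (\<chi> * \<phi>) (\<chi> * \<psi>)"
  using nh_ideal_closed(5)[of "\<phi> - \<psi>" n \<chi>] by (simp add: nh_cong_def free_alg_mult algebra_simps)

lemma nh_cong_mult_right: "nh_cong n \<phi> \<psi> \<Longrightarrow> \<chi> \<in> carrier (free_alg n) \<Longrightarrow> nh_cong n (\<phi> * \<chi>) (\<psi> * \<chi>)"
  using nh_ideal_closed(6)[of "\<phi> - \<psi>" n \<chi>] by (simp add: nh_cong_def free_alg_mult algebra_simps)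

lemma nh_cong_0_iff: "nh_cong n \<phi> 0 \<longleftrightarrow> \<phi> \<in> nh_ideal n"
  by (auto simp: nh_cong_def nh_ideal_closed(1))

lemma nh_cong_free_act: "nh_cong n \<phi> \<psi> \<Longrightarrow> free_act \<phi> p = free_act \<psi> p"
  using free_act_ideal[of "\<phi> - \<psi>" n p] by (simp add: nh_cong_def free_act_diff)

lemma nh_cong_relations:
  fixes n :: nat
  defines "cong \<equiv> nh_cong n :: 'k::field_char_0 free_nh \<Rightarrow> _"
  shows "i \<in> {1..n} \<Longrightarrow> j \<in> {1..n} \<Longrightarrow> cong (fr_x i * fr_x j) (fr_x j * fr_x i)"
    and "i \<in> {1..<n} \<Longrightarrow> cong (fr_d i * fr_d i) 0"
    and "i \<in> {1..<n} \<Longrightarrow> Suc i \<in> {1..<n} \<Longrightarrow>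
      cong (fr_d i * fr_d (Suc i) * fr_d i) (fr_d (Suc i) * fr_d i * fr_d (Suc i))"
    and "i \<in> {1..<n} \<Longrightarrow> j \<in> {1..<n} \<Longrightarrow> Suc i < j \<or> Suc j < i \<Longrightarrow>
      cong (fr_d i * fr_d j) (fr_d j * fr_d i)"
    and "i \<in> {1..<n} \<Longrightarrow> j \<in> {1..n} \<Longrightarrow> j \<noteq> i \<Longrightarrow> j \<noteq> Suc i \<Longrightarrow>
      cong (fr_x j * fr_d i) (fr_d i * fr_x j)"
    and "i \<in> {1..<n} \<Longrightarrow> cong (fr_x i * fr_d i) (fr_d i * fr_x (Suc i) + 1)"
    and "i \<in> {1..<n} \<Longrightarrow> cong (fr_d i * fr_x i) (fr_x (Suc i) * fr_d i + 1)"
proof -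
  have *: "cong \<phi> \<psi>" if "\<phi> - \<psi> \<in> nh_relations n" "\<phi> \<in> carrier (free_alg n)" "\<psi> \<in> carrier (free_alg n)"
    for \<phi> \<psi>
    using that by (simp add: cong_def nh_cong_def nh_relations_in_ideal)
  show "cong (fr_x i * fr_x j) (fr_x j * fr_x i)" if ij: "i \<in> {1..n}" "j \<in> {1..n}"
  proof (rule *)
    show "fr_x i * fr_x j - fr_x j * fr_x i \<in> nh_relations n"
      using ij unfolding nh_relations_def by blast
  qed (use ij in \<open>simp_all add: free_alg_closed\<close>)
  show "cong (fr_d i * fr_d i) 0" if i: "i \<in> {1..<n}"
  proof (rule *)
    show "fr_d i * fr_d i - 0 \<in> nh_relations n"
      using i unfolding nh_relations_def diff_zero by blast
  qed (use i in \<open>simp_all add: free_alg_closed\<close>)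
  show "cong (fr_d i * fr_d (Suc i) * fr_d i) (fr_d (Suc i) * fr_d i * fr_d (Suc i))"
    if i: "i \<in> {1..<n}" "Suc i \<in> {1..<n}"
  proof (rule *)
    show "fr_d i * fr_d (Suc i) * fr_d i - fr_d (Suc i) * fr_d i * fr_d (Suc i) \<in> nh_relations n"
      using i unfolding nh_relations_def Suc_eq_plus1 by blast
  qed (use i in \<open>simp_all add: free_alg_closed\<close>)
  show "cong (fr_d i * fr_d j) (fr_d j * fr_d i)"
    if ij: "i \<in> {1..<n}" "j \<in> {1..<n}" "Suc i < j \<or> Suc j < i"
  proof (rule *)
    have "\<bar>int i - int j\<bar> > 1" using ij by auto
    then show "fr_d i * fr_d j - fr_d j * fr_d i \<in> nh_relations n"
      using ij unfolding nh_relations_def by blast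
  qed (use ij in \<open>simp_all add: free_alg_closed\<close>)
  show "cong (fr_x j * fr_d i) (fr_d i * fr_x j)"
    if ij: "i \<in> {1..<n}" "j \<in> {1..n}" "j \<noteq> i" "j \<noteq> Suc i"
  proof (rule *)
    show "fr_x j * fr_d i - fr_d i * fr_x j \<in> nh_relations n"
      using ij unfolding nh_relations_def Suc_eq_plus1 by blast
  qed (use ij in \<open>simp_all add: free_alg_closed\<close>)
  show "cong (fr_x i * fr_d i) (fr_d i * fr_x (Suc i) + 1)" if i: "i \<in> {1..<n}"
  proof (rule *)
    show "fr_x i * fr_d i - (fr_d i * fr_x (Suc i) + 1) \<in> nh_relations n"
      using i unfolding nh_relations_def Suc_eq_plus1 diff_diff_eq[symmetric] by blast
  qed (use i in \<open>simp_all add: free_alg_closed\<close>)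
  show "cong (fr_d i * fr_x i) (fr_x (Suc i) * fr_d i + 1)" if i: "i \<in> {1..<n}"
  proof (rule *)
    show "fr_d i * fr_x i - (fr_x (Suc i) * fr_d i + 1) \<in> nh_relations n"
      using i unfolding nh_relations_def Suc_eq_plus1 diff_diff_eq[symmetric] by blast
  qed (use i in \<open>simp_all add: free_alg_closed\<close>)
qed

lemma NH_ring: "ring (NH n)"
  unfolding NH_def by (rule ideal.quotient_is_ring[OF nh_ideal_ideal])

lemma nh_class_hom: "nh_class n \<in> Ring.ring_hom (free_alg n) (NH n)"
  using ideal.rcos_ring_hom[OF nh_ideal_ideal[of n]] by (simp add: NH_def nh_class_def[abs_def])

lemma nh_class_carrier: "\<phi> \<in> carrier (free_alg n) \<Longrightarrow> nh_class n \<phi> \<in> carrier (NH n)"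
  by (rule ring_hom_closed[OF nh_class_hom])

lemma nh_class_mult: "\<phi> \<in> carrier (free_alg n) \<Longrightarrow> \<psi> \<in> carrier (free_alg n) \<Longrightarrow>
    nh_class n \<phi> \<otimes>\<^bsub>NH n\<^esub> nh_class n \<psi> = nh_class n (\<phi> * \<psi>)"
  using ring_hom_mult[OF nh_class_hom, of \<phi> n \<psi>] by simp

lemma nh_class_add: "\<phi> \<in> carrier (free_alg n) \<Longrightarrow> \<psi> \<in> carrier (free_alg n) \<Longrightarrow>
    nh_class n \<phi> \<oplus>\<^bsub>NH n\<^esub> nh_class n \<psi> = nh_class n (\<phi> + \<psi>)"
  using ring_hom_add[OF nh_class_hom, of \<phi> n \<psi>] by simp

lemma nh_class_one: "\<one>\<^bsub>NH n\<^esub> = nh_class n 1"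
  by (subst ring_hom_one[OF nh_class_hom, symmetric]) simp

lemma nh_class_zero: "\<zero>\<^bsub>NH n\<^esub> = nh_class n 0"
  by (subst ring_hom_zero[OF nh_class_hom free_alg_ring NH_ring, symmetric]) simp

lemma in_nh_class_iff:
  "\<psi> \<in> carrier (free_alg n) \<Longrightarrow> \<phi> \<in> nh_class n \<psi> \<longleftrightarrow> nh_cong n \<phi> \<psi>"
proof
  assume \<psi>: "\<psi> \<in> carrier (free_alg n)"
  show "nh_cong n \<phi> \<psi>" if "\<phi> \<in> nh_class n \<psi>"
    using that \<psi>
    by (auto simp: nh_class_def a_r_coset_def' nh_cong_def intro: free_alg_add nh_ideal_closed(1))
  show "\<phi> \<in> nh_class n \<psi>" if "nh_cong n \<phi> \<psi>"
    using that unfolding nh_class_def a_r_coset_def' nh_cong_def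
    by (auto intro!: bexI[of _ "\<phi> - \<psi>"])
qed

lemma nh_class_eq_iff:
  assumes "\<phi> \<in> carrier (free_alg n)" "\<psi> \<in> carrier (free_alg n)"
  shows "nh_class n \<phi> = nh_class n \<psi> \<longleftrightarrow> nh_cong n \<phi> \<psi>"
proof -
  have "nh_class n \<phi> = {\<chi>. nh_cong n \<chi> \<phi>}" "nh_class n \<psi> = {\<chi>. nh_cong n \<chi> \<psi>}"
    using assms by (auto simp: in_nh_class_iff)
  then show ?thesis using assms nh_cong_refl nh_cong_sym nh_cong_trans by blast
qed

lemma NH_carrierE:
  assumes "a \<in> carrier (NH n)"
  obtains \<phi> where "\<phi> \<in> carrier (free_alg n)" "a = nh_class n \<phi>"
  using assms unfolding NH_def FactRing_def A_RCOSETS_def' nh_class_def by auto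

lemma nh_act_class: "\<phi> \<in> carrier (free_alg n) \<Longrightarrow> nh_act (nh_class n \<phi>) p = free_act \<phi> p"
  unfolding nh_act_def
  by (rule the_equality) (auto simp: in_nh_class_iff nh_cong_free_act)

text \<open>A map of the free algebra that respects the congruence can be computed on any representative.\<close>

lemma nh_induced_class:
  assumes "\<phi> \<in> carrier (free_alg n)"
    and "\<And>\<phi>. \<phi> \<in> carrier (free_alg n) \<Longrightarrow> F \<phi> \<in> carrier (free_alg n)"
    and "\<And>\<psi>. nh_cong n \<psi> \<phi> \<Longrightarrow> nh_cong n (F \<psi>) (F \<phi>)"
  shows "nh_induced n F (nh_class n \<phi>) = nh_class n (F \<phi>)"
proof -
  have "nh_class n (F \<psi>) = nh_class n (F \<phi>)" if "\<psi> \<in> nh_class n \<phi>" for \<psi>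
    using that assms(1) assms(3)[of \<psi>] nh_cong_carrier[of n "F \<psi>" "F \<phi>"]
    by (simp add: in_nh_class_iff nh_class_eq_iff)
  moreover have "\<phi> \<in> nh_class n \<phi>"
    using assms by (simp add: in_nh_class_iff nh_cong_refl)
  ultimately show ?thesis unfolding nh_induced_def by blast
qed


section \<open>The longest element and a decomposition of the identity\<close>

(* Words are taken apart at chosen letters below, not at their last one. *)
declare upt_Suc [simp del]

lemma nh_cong_word_commute:
  assumes "a \<in> carrier (free_alg n)" "set w \<subseteq> nh_gens n"
    and "\<And>g. g \<in> set w \<Longrightarrow> nh_cong n (a * fr_word [g]) (fr_word [g] * a)"
  shows "nh_cong n (a * fr_word w) (fr_word w * a)"
  using assms(2,3)
proof (induction w)
  case Nil
  then show ?case using assms(1) by (simp add: nh_cong_refl)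
next
  case (Cons g w)
  have g: "fr_word [g] \<in> carrier (free_alg n)" and w: "fr_word w \<in> carrier (free_alg n)"
    using Cons.prems by (auto intro!: free_alg_word)
  have "nh_cong n (a * fr_word [g] * fr_word w) (fr_word [g] * a * fr_word w)"
    using Cons.prems g w by (intro nh_cong_mult_right) auto
  also have "fr_word [g] * a * fr_word w = fr_word [g] * (a * fr_word w)" by (simp add: mult.assoc)
  also have "nh_cong n \<dots> (fr_word [g] * (fr_word w * a))"
    using Cons g w by (intro nh_cong_mult_left) auto
  finally show ?case by (subst (1 2) fr_word_Cons) (simp add: mult.assoc)
qed

text \<open>A reduced word of the longest permutation of \<open>m\<close> letters: each step multiplies from the left
  by the Coxeter word \<open>\<partial>\<^sub>1 \<dots> \<partial>\<^sub>m\<close>.\<close>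

fun long_word :: "nat \<Rightarrow> nh_gen list" where
  "long_word 0 = []"
| "long_word (Suc m) = map DGen [1..<Suc m] @ long_word m"

abbreviation longest :: "nat \<Rightarrow> 'k::field_char_0 free_nh" where
  "longest m \<equiv> fr_word (long_word m)"

lemma set_long_word: "set (long_word m) = DGen ` {1..<m}"
  by (induction m) (auto simp: less_Suc_eq)

lemma d_word_carrier: "1 \<le> k \<Longrightarrow> m < n \<Longrightarrow> fr_word (map DGen [k..<Suc m]) \<in> carrier (free_alg n)"
  by (intro free_alg_word) (auto simp: nh_gens_def)

lemma longest_carrier: "m \<le> n \<Longrightarrow> longest m \<in> carrier (free_alg n)"
  by (intro free_alg_word) (auto simp: nh_gens_def set_long_word)

lemma d_word_commute:
  assumes "i \<in> {1..<n}" "1 \<le> a" "b \<le> n" "b < i \<or> Suc i < a"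
  shows "nh_cong n (fr_d i * fr_word (map DGen [a..<b])) (fr_word (map DGen [a..<b]) * fr_d i)"
proof (rule nh_cong_word_commute)
  show "nh_cong n (fr_d i * fr_word [g]) (fr_word [g] * fr_d i)" if "g \<in> set (map DGen [a..<b])" for g
    using that assms by (auto intro!: nh_cong_relations(4))
qed (use assms in \<open>auto simp: nh_gens_def\<close>)

text \<open>One braid move carries a simple divided difference through the Coxeter word and lowers its
  index by one; all other letters of the word commute with it.\<close>

lemma d_coxeter_shift:
  assumes "1 \<le> j" "j < m" "m < n"
  shows "nh_cong n (fr_d (Suc j) * fr_word (map DGen [1..<Suc m]))
    (fr_word (map DGen [1..<Suc m]) * fr_d j)"
proof -
  let ?A = "fr_word (map DGen [1..<j]) :: 'a free_nh" and ?B = "fr_word (map DGen [Suc (Suc j)..<Suc m]) :: 'a free_nh"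
  let ?u = "fr_d j :: 'a free_nh" and ?v = "fr_d (Suc j) :: 'a free_nh"
  have AB: "?A \<in> carrier (free_alg n)" "?B \<in> carrier (free_alg n)"
    using assms by (auto intro!: free_alg_word simp: nh_gens_def)
  have uv: "?u \<in> carrier (free_alg n)" "?v \<in> carrier (free_alg n)" using assms by auto
  have "[1..<Suc m] = [1..<j] @ j # Suc j # [Suc (Suc j)..<Suc m]"
    using assms upt_add_eq_append[of 1 j "Suc m - j"]
    by (simp add: upt_conv_Cons[of j] upt_conv_Cons[of "Suc j"] del: upt_Suc)
  then have split: "fr_word (map DGen [1..<Suc m]) = ?A * (?u * (?v * ?B))"
    by (simp only: map_append list.map fr_word_append fr_word_Cons[of _ "_ # _"]
        fr_word_Cons[of "DGen (Suc j)" "map DGen [Suc (Suc j)..<Suc m]"])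
  have "fr_d (Suc j) * fr_word (map DGen [1..<Suc m]) = (?v * ?A) * (?u * (?v * ?B))"
    by (simp only: split mult.assoc)
  also have "nh_cong n \<dots> ((?A * ?v) * (?u * (?v * ?B)))"
    using assms AB uv by (intro nh_cong_mult_right d_word_commute free_alg_mult) simp_all
  also have "\<dots> = ?A * ((?v * ?u * ?v) * ?B)" by (simp only: mult.assoc)
  also have "nh_cong n \<dots> (?A * ((?u * ?v * ?u) * ?B))"
    using assms AB uv by (intro nh_cong_mult_left nh_cong_mult_right nh_cong_sym[OF nh_cong_relations(3)]) simp_all
  also have "\<dots> = (?A * ?u * ?v) * (?u * ?B)" by (simp only: mult.assoc)
  also have "nh_cong n \<dots> ((?A * ?u * ?v) * (?B * ?u))"
    using assms AB uv by (intro nh_cong_mult_left d_word_commute free_alg_mult) simp_all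
  also have "\<dots> = fr_word (map DGen [1..<Suc m]) * fr_d j" by (simp only: split mult.assoc)
  finally show ?thesis .
qed

text \<open>By the index shift, \<open>\<partial>\<^sub>i\<close> with \<open>i > 1\<close> passes the Coxeter word and meets the shorter longest element as
  \<open>\<partial>\<^bsub>i-1\<^esub>\<close>, which kills it by induction. For \<open>i = 1\<close> the word starts with \<open>\<partial>\<^sub>1\<close>, and \<open>\<partial>\<^sub>1\<^sup>2 = 0\<close>.\<close>

lemma longest_annihilated:
  "m \<le> n \<Longrightarrow> i \<in> {1..<m} \<Longrightarrow> nh_cong n (fr_d i * longest m :: 'k::field_char_0 free_nh) 0"
proof (induction m arbitrary: i)
  case (Suc m)
  let ?W = "fr_word (map DGen [1..<Suc m]) :: 'k free_nh"
  have W: "?W \<in> carrier (free_alg n)" using Suc.prems by (intro d_word_carrier) auto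
  have L: "longest m \<in> carrier (free_alg n)" using Suc.prems by (simp add: longest_carrier)
  have eq: "fr_d i * longest (Suc m) = (fr_d i * ?W) * longest m"
    by (simp only: long_word.simps fr_word_append mult.assoc)
  show ?case
  proof (cases "i = 1")
    case True
    let ?V = "fr_word (map DGen [2..<Suc m]) :: 'k free_nh"
    have "[1..<Suc m] = 1 # [2..<Suc m]" using Suc.prems by (simp add: upt_conv_Cons numeral_2_eq_2 del: upt_Suc)
    then have "?W = fr_d 1 * ?V"
      by (simp only: list.map fr_word_Cons[of "DGen 1" "map DGen [2..<Suc m]"])
    then have "fr_d i * longest (Suc m) = (fr_d 1 * fr_d 1) * (?V * longest m)"
      by (subst eq) (simp only: True mult.assoc)
    also have "nh_cong n \<dots> (0 * (?V * longest m))"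
      using Suc.prems L True
      by (intro nh_cong_mult_right nh_cong_relations(2) free_alg_mult d_word_carrier) auto
    finally show ?thesis by simp
  next
    case False
    then obtain j where j: "i = Suc j" "1 \<le> j" "j < m"
      using Suc.prems by (cases i) auto
    have "nh_cong n ((fr_d i * ?W) * longest m) ((?W * fr_d j) * longest m)"
      using j Suc.prems L unfolding j(1) by (intro nh_cong_mult_right d_coxeter_shift) auto
    also have "(?W * fr_d j) * longest m = ?W * (fr_d j * longest m)" by (simp only: mult.assoc)
    also have "nh_cong n \<dots> (?W * 0)"
      using j Suc W by (intro nh_cong_mult_left) auto
    finally show ?thesis by (simp only: eq mult_zero_right)
  qed
qed simp

text \<open>The words that interpolate between \<^term>\<open>longest (Suc m)\<close>, at \<open>k = 1\<close>, and
  \<^term>\<open>longest m\<close>, at \<open>k = Suc m\<close>.\<close>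

definition tail_elt :: "nat \<Rightarrow> nat \<Rightarrow> 'k::field_char_0 free_nh" where
  "tail_elt m k = fr_word (map DGen [k..<Suc m]) * longest m"

lemma tail_elt_carrier: "1 \<le> k \<Longrightarrow> m < n \<Longrightarrow> tail_elt m k \<in> carrier (free_alg n)"
  unfolding tail_elt_def by (intro free_alg_mult d_word_carrier longest_carrier) auto

lemma tail_elt_step: "k \<le> m \<Longrightarrow> tail_elt m k = fr_d k * tail_elt m (Suc k)"
proof -
  assume "k \<le> m"
  then have "[k..<Suc m] = k # [Suc k..<Suc m]" by (simp add: upt_conv_Cons del: upt_Suc)
  then show ?thesis
    by (simp only: tail_elt_def list.map fr_word_Cons[of "DGen k" "map DGen [Suc k..<Suc m]"] mult.assoc)
qed

lemma tail_elt_last: "tail_elt m (Suc m) = longest m"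
  by (simp add: tail_elt_def)

lemma tail_elt_first: "tail_elt m 1 = longest (Suc m)"
  by (simp only: tail_elt_def long_word.simps fr_word_append)

text \<open>When \<open>x\<^sub>k\<close> moves to the right through \<open>\<partial>\<^sub>k \<dots> \<partial>\<^sub>m\<close>, each letter that it passes leaves a word with this
  letter omitted. If a letter other than the first is omitted, the letters before the gap commute
  past those after it and kill the longest element of the first \<open>m\<close> strands. So one correction
  term survives, and it is the next interpolating word.\<close>

lemma tail_elt_x_commutator:
  assumes "1 \<le> k" "k \<le> m" "m < n"
  shows "nh_cong n (fr_x k * tail_elt m k) (tail_elt m (Suc k) + tail_elt m k * fr_x (Suc m) :: 'k::field_char_0 free_nh)"
  using \<open>k \<le> m\<close> \<open>1 \<le> k\<close>
proof (induction k rule: inc_induct)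
  case base
  let ?d = "fr_d m :: 'k free_nh" and ?y = "fr_x (Suc m) :: 'k free_nh" and ?L = "longest m :: 'k free_nh"
  have car: "?d \<in> carrier (free_alg n)" "?y \<in> carrier (free_alg n)" "?L \<in> carrier (free_alg n)"
    using base assms by (auto simp: longest_carrier)
  have "fr_x m * tail_elt m m = (fr_x m * ?d) * ?L"
    by (simp add: tail_elt_step tail_elt_last mult.assoc)
  also have "nh_cong n \<dots> ((?d * ?y + 1) * ?L)"
    using base assms car by (intro nh_cong_mult_right nh_cong_relations(6)) auto
  also have "\<dots> = ?L + ?d * (?y * ?L)" by (simp add: algebra_simps)
  also have "nh_cong n \<dots> (?L + ?d * (?L * ?y))"
  proof (rule nh_cong_add[OF nh_cong_refl nh_cong_mult_left[OF nh_cong_word_commute]]; (rule car)?)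
    show "set (long_word m) \<subseteq> nh_gens n" using assms by (auto simp: set_long_word nh_gens_def)
    show "nh_cong n (?y * fr_word [g]) (fr_word [g] * ?y)" if "g \<in> set (long_word m)" for g
      using that assms by (auto simp: set_long_word intro!: nh_cong_relations(5))
  qed
  finally show ?case by (simp add: tail_elt_step tail_elt_last mult.assoc)
next
  case (step k)
  let ?d = "fr_d k :: 'k free_nh" and ?y = "fr_x (Suc m) :: 'k free_nh"
    and ?E = "tail_elt m (Suc k) :: 'k free_nh" and ?F = "tail_elt m (Suc (Suc k)) :: 'k free_nh"
    and ?W = "fr_word (map DGen [Suc (Suc k)..<Suc m]) :: 'k free_nh"
  have car: "?d \<in> carrier (free_alg n)" "?y \<in> carrier (free_alg n)"
      "?E \<in> carrier (free_alg n)" "?F \<in> carrier (free_alg n)"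
      "?W \<in> carrier (free_alg n)" "longest m \<in> carrier (free_alg n)"
    using step assms by (auto simp del: upt_Suc intro!: tail_elt_carrier d_word_carrier longest_carrier)
  \<comment> \<open>The correction term that the induction hypothesis leaves behind: here a letter other than the first is omitted.\<close>
  have dF: "nh_cong n (?d * ?F) 0"
  proof -
    have "?d * ?F = (?d * ?W) * longest m" by (simp only: tail_elt_def mult.assoc)
    also have "nh_cong n \<dots> ((?W * ?d) * longest m)"
      using step assms car by (intro nh_cong_mult_right d_word_commute) auto
    also have "\<dots> = ?W * (?d * longest m)" by (simp only: mult.assoc)
    also have "nh_cong n \<dots> (?W * 0)"
      using step assms car by (intro nh_cong_mult_left longest_annihilated) auto
    finally show ?thesis by simp
  qed
  have "fr_x k * tail_elt m k = (fr_x k * ?d) * ?E"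
    using step by (simp add: tail_elt_step[of k] mult.assoc)
  also have "nh_cong n \<dots> ((?d * fr_x (Suc k) + 1) * ?E)"
    using step assms car by (intro nh_cong_mult_right nh_cong_relations(6)) auto
  also have "\<dots> = ?E + ?d * (fr_x (Suc k) * ?E)" by (simp add: algebra_simps)
  also have "nh_cong n \<dots> (?E + ?d * (?F + ?E * ?y))"
    using step car by (intro nh_cong_add nh_cong_refl nh_cong_mult_left) auto
  also have "\<dots> = ?E + (?d * ?F + (?d * ?E) * ?y)" by (simp add: algebra_simps)
  also have "nh_cong n \<dots> (?E + (0 + (?d * ?E) * ?y))"
    using car dF by (intro nh_cong_add nh_cong_refl free_alg_mult) auto
  finally show ?case using step by (simp add: tail_elt_step[of k])
qed

text \<open>Finite sums of terms \<open>u D v\<close> up to congruence, where \<open>u\<close> is a monomial from \<open>B\<close>. Its induction rule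
  replaces bookkeeping with explicit sums in the three applications of the decomposition of \<open>1\<close>.\<close>

inductive_set longest_span :: "nat \<Rightarrow> nat \<Rightarrow> nat list set \<Rightarrow> 'k::field_char_0 free_nh set"
  for n m :: nat and B :: "nat list set" where
  zero: "0 \<in> longest_span n m B"
| add: "s \<in> longest_span n m B \<Longrightarrow> t \<in> longest_span n m B \<Longrightarrow> s + t \<in> longest_span n m B"
| gen: "us \<in> B \<Longrightarrow> set us \<subseteq> {1..n} \<Longrightarrow> v \<in> carrier (free_alg n) \<Longrightarrow>
    fr_word (map XGen us) * longest m * v \<in> longest_span n m B"
| cong: "s \<in> longest_span n m B \<Longrightarrow> nh_cong n s t \<Longrightarrow> t \<in> longest_span n m B"

lemma x_word_carrier: "set us \<subseteq> {1..n} \<Longrightarrow> fr_word (map XGen us) \<in> carrier (free_alg n)"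
  by (intro free_alg_word) (auto simp: nh_gens_def)

lemma longest_span_mult:
  assumes "t \<in> longest_span n m B" "set us \<subseteq> {1..n}" "w \<in> carrier (free_alg n)"
    and "\<And>us'. us' \<in> B \<Longrightarrow> us @ us' \<in> B'"
  shows "fr_word (map XGen us) * t * w \<in> longest_span n m B'"
  using assms(1)
proof (induction rule: longest_span.induct)
  case zero
  show ?case by (simp add: longest_span.zero)
next
  case (add s t)
  then show ?case by (simp add: distrib_left distrib_right longest_span.add)
next
  case (gen us' v)
  have "fr_word (map XGen (us @ us')) * longest m * (v * w) \<in> longest_span n m B'"
    using gen assms by (intro longest_span.gen free_alg_mult) auto
  then show ?case by (simp add: fr_word_append mult.assoc)
next
  case (cong s t)
  then show ?case
    using assms x_word_carrier[of us n]
    by (auto intro!: longest_span.cong[where t="fr_word (map XGen us) * t * w"] nh_cong_mult_left nh_cong_mult_right)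
qed

lemma tail_elt_in_longest_span:
  assumes "m < n" "1 \<le> k" "k \<le> Suc m"
  shows "(tail_elt m k :: 'k::field_char_0 free_nh)
    \<in> longest_span n (Suc m) {us. distinct us \<and> set us \<subseteq> {1..<k}}"
  using assms(2,3)
proof (induction k rule: nat_induct_at_least)
  case base
  have "fr_word (map XGen []) * longest (Suc m) * 1
      \<in> longest_span n (Suc m) {us. distinct us \<and> set us \<subseteq> {1..<1::nat}}"
    by (intro longest_span.gen) auto
  then show ?case by (simp add: tail_elt_first[unfolded One_nat_def])
next
  case (Suc k)
  let ?B = "\<lambda>k. {us :: nat list. distinct us \<and> set us \<subseteq> {1..<k}}"
  have E: "(tail_elt m k :: 'k free_nh) \<in> longest_span n (Suc m) (?B k)" using Suc by simp
  have 1: "fr_word (map XGen [k]) * tail_elt m k * (1 :: 'k free_nh) \<in> longest_span n (Suc m) (?B (Suc k))"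
    using Suc assms(1) by (intro longest_span_mult[OF E]) auto
  have 2: "fr_word (map XGen []) * tail_elt m k * (- fr_x (Suc m) :: 'k free_nh) \<in> longest_span n (Suc m) (?B (Suc k))"
    using Suc assms(1) by (intro longest_span_mult[OF E]) (auto intro!: free_alg_uminus)
  have "fr_x k * tail_elt m k - tail_elt m k * fr_x (Suc m :: nat)
      \<in> (longest_span :: _ \<Rightarrow> _ \<Rightarrow> _ \<Rightarrow> 'k free_nh set) n (Suc m) (?B (Suc k))"
    using longest_span.add[OF 1 2] by simp
  moreover have "nh_cong n (fr_x k * tail_elt m k - tail_elt m k * fr_x (Suc m))
     ((tail_elt m (Suc k) + tail_elt m k * fr_x (Suc m)) - tail_elt m k * fr_x (Suc m) :: 'k free_nh)"
    using Suc assms(1)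
    by (intro nh_cong_diff tail_elt_x_commutator nh_cong_refl free_alg_mult tail_elt_carrier) auto
  ultimately show ?case by (simp add: longest_span.cong)
qed

text \<open>The monomials of \<open>H\<close> for \<open>m\<close> strands, as words in the variables.\<close>

definition stair_lists :: "nat \<Rightarrow> nat list set" where
  "stair_lists m = {us. set us \<subseteq> {1..m} \<and> (\<forall>i. count_list us i \<le> m - i)}"

text \<open>Each step from \<^term>\<open>longest m\<close> to \<^term>\<open>longest (Suc m)\<close> contributes a squarefree left
  factor in the first \<open>m\<close> variables. Hence \<open>x\<^sub>i\<close> occurs at most once for each \<open>m\<close> with
  \<open>i \<le> m < n\<close>, which is the staircase bound.\<close>

lemma one_in_longest_span:
  "m \<le> n \<Longrightarrow> (1 :: 'k::field_char_0 free_nh) \<in> longest_span n m (stair_lists m)"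
proof (induction m)
  case 0
  have "fr_word (map XGen []) * longest 0 * 1 \<in> longest_span n 0 (stair_lists 0)"
    by (intro longest_span.gen) (auto simp: stair_lists_def)
  then show ?case by simp
next
  case (Suc m)
  \<comment> \<open>The word with \<open>k = m + 1\<close> is the shorter longest element, so it can be expanded in terms of the longer one.\<close>
  have L: "longest m \<in> longest_span n (Suc m) {us. distinct us \<and> set us \<subseteq> {1..<Suc m}}"
    using tail_elt_in_longest_span[of m n "Suc m"] Suc.prems by (simp add: tail_elt_last)
  have "t \<in> longest_span n (Suc m) (stair_lists (Suc m))"
    if "t \<in> longest_span n m (stair_lists m)" for t :: "'k free_nh"
    using that
  proof (induction rule: longest_span.induct)
    case (gen us v)
    show ?case
    proof (rule longest_span_mult[OF L])
      fix us' :: "nat list" assume us': "us' \<in> {us. distinct us \<and> set us \<subseteq> {1..<Suc m}}"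
      have "count_list (us @ us') i \<le> Suc m - i" for i
      proof -
        have 1: "count_list us i \<le> m - i" using gen by (simp add: stair_lists_def)
        have 2: "count_list us' i \<le> 1" using us' by (simp add: distinct_count_atmost_1 flip: count_mset)
        have 3: "count_list us' i = 0" if "m < i" using us' that by (auto simp: count_list_0_iff)
        show ?thesis using 1 2 3 by (cases "m < i") auto
      qed
      then show "us @ us' \<in> stair_lists (Suc m)"
        using us' gen by (fastforce simp: stair_lists_def)
    qed (use gen in auto)
  qed (auto intro: longest_span.intros)
  then show ?case using Suc by simp
qed

section \<open>Normal forms and faithfulness\<close>

lemma x_word_cong:
  "mset u = mset v \<Longrightarrow> set u \<subseteq> {1..n} \<Longrightarrow>
    nh_cong n (fr_word (map XGen u)) (fr_word (map XGen v) :: 'k::field_char_0 free_nh)"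
proof (induction u arbitrary: v)
  case Nil
  then show ?case by (simp add: nh_cong_refl)
next
  case (Cons a u)
  then have "a \<in> set v" by (metis list.set_intros(1) set_mset_mset)
  then obtain p q where v: "v = p @ a # q" by (meson split_list)
  have set_v: "set v \<subseteq> {1..n}" using Cons.prems by (metis set_mset_mset)
  let ?P = "fr_word (map XGen p) :: 'k free_nh" and ?Q = "fr_word (map XGen q) :: 'k free_nh"
  have car: "?P \<in> carrier (free_alg n)" "?Q \<in> carrier (free_alg n)" "fr_x a \<in> carrier (free_alg n)"
    using set_v v by (auto intro!: x_word_carrier)
  have "mset u = mset (p @ q)" using Cons.prems v by simp
  then have IH: "nh_cong n (fr_word (map XGen u)) (fr_word (map XGen (p @ q)) :: 'k free_nh)"
    using Cons.prems by (intro Cons.IH) auto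
  have "fr_word (map XGen (a # u)) = fr_x a * (fr_word (map XGen u) :: 'k free_nh)"
    by (simp add: fr_word_Cons[of _ "map XGen u"])
  also have "nh_cong n \<dots> (fr_x a * fr_word (map XGen (p @ q)))"
    using IH car by (intro nh_cong_mult_left) auto
  also have "\<dots> = (fr_x a * ?P) * ?Q" by (simp add: fr_word_append mult.assoc)
  also have "nh_cong n \<dots> ((?P * fr_x a) * ?Q)"
    using car set_v v
    by (intro nh_cong_mult_right, rule_tac nh_cong_word_commute) (auto simp: nh_gens_def intro!: nh_cong_relations(1))
  also have "\<dots> = fr_word (map XGen v)"
    by (simp add: v fr_word_append fr_word_Cons[of _ "map XGen q"] mult.assoc)
  finally show ?case .
qed

definition mono_list :: "(nat \<Rightarrow>\<^sub>0 nat) \<Rightarrow> nat list" where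
  "mono_list m = concat (map (\<lambda>i. replicate (lookup m i) i) (sorted_list_of_set (keys m)))"

lemma set_mono_list: "set (mono_list m) = keys m"
  by (auto simp: mono_list_def in_keys_iff)

lemma count_mset_mono_list: "count (mset (mono_list m)) j = lookup m j"
proof -
  have "count (mset (concat (map (\<lambda>i. replicate (f i) i) xs))) j = (if j \<in> set xs then f j else 0)"
    if "distinct xs" for f :: "nat \<Rightarrow> nat" and xs
    using that by (induction xs) auto
  then show ?thesis by (simp add: mono_list_def in_keys_iff)
qed

text \<open>The embedding of the polynomial ring into the nilHecke algebra. Its values in the free algebra
  depend on a chosen order of the variables, so it is multiplicative only up to congruence.\<close>

definition poly_elt :: "'k::field_char_0 mpoly \<Rightarrow> 'k free_nh" where
  "poly_elt f = (\<Sum>m\<in>keys f. fr_const (lookup f m) * fr_word (map XGen (mono_list m)))"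

lemma poly_elt_0 [simp]: "poly_elt 0 = 0"
  by (simp add: poly_elt_def)

lemma poly_elt_add: "poly_elt (f + g) = poly_elt f + poly_elt g"
  unfolding poly_elt_def
  by (rule setsum_keys_plus_distrib) (simp_all add: distrib_right)

lemma poly_elt_single: "poly_elt (single m c) = fr_const c * fr_word (map XGen (mono_list m))"
  by (simp add: poly_elt_def)

lemma poly_elt_const [simp]: "poly_elt (mp_const c) = fr_const c"
  by (simp add: mp_const_def poly_elt_single mono_list_def)

lemma poly_elt_1 [simp]: "poly_elt 1 = 1"
  using poly_elt_const[of 1] by simp

lemma poly_elt_const_mult: "poly_elt (mp_const c * f) = fr_const c * poly_elt f"
  using subset_UNIV[of "keys f"]
  by (induction f rule: poly_mapping_add_induct)
    (simp_all add: mp_const_def mult_single poly_elt_single poly_elt_add distrib_left mult.assoc)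

lemma poly_elt_uminus: "poly_elt (- f) = - poly_elt f"
  using poly_elt_add[of "- f" f] by (simp add: eq_neg_iff_add_eq_0)

lemma poly_ring_keys: "f \<in> poly_ring n \<longleftrightarrow> keys f \<subseteq> {m. keys m \<subseteq> {1..n}}"
  by (auto simp: poly_ring_def)

lemma poly_elt_carrier: "f \<in> poly_ring n \<Longrightarrow> poly_elt f \<in> carrier (free_alg n)"
  unfolding poly_ring_keys
  by (induction f rule: poly_mapping_add_induct)
    (auto simp: poly_elt_single poly_elt_add set_mono_list intro!: free_alg_add free_alg_mult x_word_carrier)

lemma poly_elt_var_mult:
  assumes "f \<in> poly_ring n" "j \<in> {1..n}"
  shows "nh_cong n (fr_x j * poly_elt f) (poly_elt (mp_var j * f) :: 'k::field_char_0 free_nh)"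
  using assms(1) unfolding poly_ring_keys
proof (induction f rule: poly_mapping_add_induct)
  case (single m c)
  let ?w = "fr_word (map XGen (j # mono_list m)) :: 'k free_nh"
    and ?w' = "fr_word (map XGen (mono_list (single j 1 + m))) :: 'k free_nh"
  have "mset (j # mono_list m) = mset (mono_list (single j 1 + m))"
    by (rule multiset_eqI) (simp add: count_mset_mono_list lookup_add lookup_single when_def)
  then have "nh_cong n ?w ?w'"
    using single assms(2) by (intro x_word_cong) (auto simp: set_mono_list)
  then have "nh_cong n (fr_const c * ?w) (fr_const c * ?w')"
    by (intro nh_cong_mult_left) auto
  moreover have "fr_x j * poly_elt (single m c) = fr_const c * ?w"
    using fr_const_commute[of "fr_x j" c]
    by (simp add: poly_elt_single fr_word_Cons[of _ "map XGen (mono_list m)"] flip: mult.assoc)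
  ultimately show ?case by (simp add: mp_var_def mult_single poly_elt_single)
qed (auto simp: distrib_left poly_elt_add nh_cong_add nh_cong_refl)

text \<open>In the nilHecke algebra \<open>\<partial>\<^sub>i f = \<partial>\<^sub>i(f) + s\<^sub>i(f) \<partial>\<^sub>i\<close>, and the last term kills the longest element.\<close>

lemma d_poly_elt_longest:
  assumes "f \<in> poly_ring n" "i \<in> {1..<n}"
  shows "nh_cong n (fr_d i * (poly_elt f * longest n)) (poly_elt (divided_difference i f) * longest n :: 'k::field_char_0 free_nh)"
  using assms(1) unfolding poly_ring_eq_mpolys_in
proof (induction f rule: mpolys_in_induct)
  case (const c)
  have "fr_d i * (fr_const c * longest n) = fr_const c * (fr_d i * longest n)"
    using fr_const_commute[of "fr_d i" c] by (simp flip: mult.assoc)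
  moreover have "nh_cong n (fr_const c * (fr_d i * longest n)) (fr_const c * 0)"
    using assms by (intro nh_cong_mult_left longest_annihilated) auto
  ultimately show ?case by simp
next
  case (var j p)
  let ?L = "longest n :: 'k free_nh" and ?D = "divided_difference i p"
  have p: "p \<in> poly_ring n" and Dp: "?D \<in> poly_ring n"
    using var assms by (auto simp: poly_ring_eq_mpolys_in divided_difference_mpolys_in)
  have L: "?L \<in> carrier (free_alg n)" by (simp add: longest_carrier)
  have car: "poly_elt p * ?L \<in> carrier (free_alg n)" "poly_elt ?D * ?L \<in> carrier (free_alg n)"
    using p Dp L by (auto intro!: free_alg_mult poly_elt_carrier)
  have x: "nh_cong n (fr_x k * (poly_elt q * ?L)) (poly_elt (mp_var k * q) * ?L)"
    if "q \<in> poly_ring n" "k \<in> {1..n}" for q k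
    using nh_cong_mult_right[OF poly_elt_var_mult[OF that] L] by (simp add: mult.assoc)
  have xd: "nh_cong n (fr_x k * (fr_d i * (poly_elt p * ?L))) (poly_elt (mp_var k * ?D) * ?L)"
    if "k \<in> {1..n}" for k
    using nh_cong_trans[OF nh_cong_mult_left[OF var.IH] x[OF Dp that]] that by simp
  have "nh_cong n (fr_d i * (poly_elt (mp_var j * p) * ?L)) (fr_d i * (fr_x j * (poly_elt p * ?L)))"
    using x[OF p, of j] var assms by (intro nh_cong_mult_left nh_cong_sym[OF x]) (auto simp: p)
  also have "\<dots> = (fr_d i * fr_x j) * (poly_elt p * ?L)" by (simp only: mult.assoc)
  also have "nh_cong n \<dots> (poly_elt (divided_difference i (mp_var j * p)) * ?L)"
  proof -
    consider "j = i" | "j = Suc i" | "j \<noteq> i" "j \<noteq> Suc i" by blast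
    then show ?thesis
    proof cases
      case 1
      have "nh_cong n ((fr_d i * fr_x j) * (poly_elt p * ?L)) ((fr_x (Suc i) * fr_d i + 1) * (poly_elt p * ?L))"
        using assms car 1 by (intro nh_cong_mult_right) (auto intro!: nh_cong_relations(7))
      also have "\<dots> = poly_elt p * ?L + fr_x (Suc i) * (fr_d i * (poly_elt p * ?L))"
        by (simp add: algebra_simps)
      also have "nh_cong n \<dots> (poly_elt p * ?L + poly_elt (mp_var (Suc i) * ?D) * ?L)"
        using assms car by (intro nh_cong_add nh_cong_refl xd) auto
      finally show ?thesis using 1 by (simp add: divided_difference_var_mult poly_elt_add distrib_right)
    next
      case 2
      have "nh_cong n (fr_x i * fr_d i - 1) (fr_d i * fr_x (Suc i) + 1 - 1 :: 'k free_nh)"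
        using assms by (intro nh_cong_diff nh_cong_relations(6) nh_cong_refl) auto
      then have "nh_cong n ((fr_d i * fr_x j) * (poly_elt p * ?L)) ((fr_x i * fr_d i - 1) * (poly_elt p * ?L))"
        using assms car 2 by (intro nh_cong_mult_right) (auto intro: nh_cong_sym)
      also have "\<dots> = fr_x i * (fr_d i * (poly_elt p * ?L)) - poly_elt p * ?L"
        by (simp add: algebra_simps)
      also have "nh_cong n \<dots> (poly_elt (mp_var i * ?D) * ?L - poly_elt p * ?L)"
        using assms car by (intro nh_cong_diff nh_cong_refl xd) auto
      finally show ?thesis
        using 2 poly_elt_add[of "mp_var i * ?D" "- p"]
        by (simp add: divided_difference_var_mult poly_elt_uminus left_diff_distrib)
    next
      case 3
      have "nh_cong n ((fr_d i * fr_x j) * (poly_elt p * ?L)) ((fr_x j * fr_d i) * (poly_elt p * ?L))"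
        using assms car 3 var by (intro nh_cong_mult_right nh_cong_sym[OF nh_cong_relations(5)]) auto
      also have "\<dots> = fr_x j * (fr_d i * (poly_elt p * ?L))" by (simp only: mult.assoc)
      also have "nh_cong n \<dots> (poly_elt (mp_var j * ?D) * ?L)"
        using var by (intro xd) auto
      finally show ?thesis using 3 by (simp add: divided_difference_var_mult)
    qed
  qed
  finally show ?case .
next
  case (add p q)
  then show ?case by (simp add: poly_elt_add divided_difference_add distrib_left distrib_right nh_cong_add)
qed

text \<open>The left ideal generated by the longest element is the polynomial representation.\<close>

lemma mult_poly_elt_longest:
  assumes "\<phi> \<in> carrier (free_alg n)" "f \<in> poly_ring n"
  shows "nh_cong n (\<phi> * (poly_elt f * longest n)) (poly_elt (free_act \<phi> f) * longest n)"
  using assms(1)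
proof (induction rule: free_alg_induct)
  case (const c)
  then show ?case using assms(2)
    by (auto simp: poly_elt_const_mult mult.assoc intro!: nh_cong_refl free_alg_mult poly_elt_carrier longest_carrier)
next
  case (gen g \<phi>)
  have p: "free_act \<phi> f \<in> poly_ring n" using gen assms free_act_poly_ring by blast
  have g: "nh_cong n (fr_word [g] * (poly_elt (free_act \<phi> f) * longest n))
      (poly_elt (gen_act g (free_act \<phi> f)) * longest n)"
    using gen(1) unfolding nh_gens_def
  proof (elim UnE imageE)
    fix j assume "g = XGen j" "j \<in> {1..n}"
    then show ?thesis
      using nh_cong_mult_right[OF poly_elt_var_mult[OF p, of j] longest_carrier[of n n]] by (simp add: mult.assoc)
  qed (use d_poly_elt_longest[OF p] in auto)
  have "fr_word [g] * \<phi> * (poly_elt f * longest n) = fr_word [g] * (\<phi> * (poly_elt f * longest n))"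
    by (simp only: mult.assoc)
  also have "nh_cong n \<dots> (fr_word [g] * (poly_elt (free_act \<phi> f) * longest n))"
    using gen by (intro nh_cong_mult_left free_alg_word) auto
  also note g
  finally show ?case by (simp add: free_act_mult)
next
  case (add \<phi> \<psi>)
  then show ?case by (simp add: free_act_add poly_elt_add distrib_right nh_cong_add)
qed

text \<open>The action is faithful: multiply \<open>1 = \<Sum> u D v\<close> by \<open>\<phi>\<close> and use \<open>\<phi> u D = \<phi>(u) D\<close>.\<close>

lemma nh_ideal_iff_acts_zero:
  assumes "\<phi> \<in> carrier (free_alg n)"
  shows "\<phi> \<in> nh_ideal n \<longleftrightarrow> (\<forall>p\<in>poly_ring n. free_act \<phi> p = 0)"
proof
  assume zero: "\<forall>p\<in>poly_ring n. free_act \<phi> p = 0"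
  have "nh_cong n (\<phi> * t) 0" if "t \<in> longest_span n n (stair_lists n)" for t
    using that
  proof (induction rule: longest_span.induct)
    case (add s t)
    then show ?case using nh_cong_add[of n "\<phi> * s" 0 "\<phi> * t" 0] by (simp add: distrib_left)
  next
    case (gen us v)
    let ?u = "fr_word (map XGen us)"
    have u: "?u \<in> carrier (free_alg n)" using gen by (simp add: x_word_carrier)
    have 1: "(1 :: 'a mpoly) \<in> poly_ring n" by (simp add: poly_ring_eq_mpolys_in)
    have "free_act (\<phi> * ?u) 1 = 0"
      using zero free_act_poly_ring[OF u 1] by (simp only: free_act_mult)
    then have "nh_cong n (\<phi> * ?u * longest n) 0"
      using mult_poly_elt_longest[OF free_alg_mult[OF assms u] 1] by (simp add: mult.assoc)
    then show ?case using nh_cong_mult_right[OF _ gen(3)] by (fastforce simp: mult.assoc)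
  next
    case (cong s t)
    then show ?case using nh_cong_trans nh_cong_sym nh_cong_mult_left[OF cong(2) assms] by blast
  qed (simp add: nh_cong_refl)
  from this[OF one_in_longest_span[OF order_refl]] show "\<phi> \<in> nh_ideal n"
    by (simp add: nh_cong_0_iff)
qed (simp add: free_act_ideal)

lemma lookup_sum_list_single:
  "lookup (\<Sum>i\<leftarrow>us. single i (Suc 0)) k = count_list us k"
  by (induction us) (auto simp: lookup_add lookup_single when_def)

lemma word_act_x_word:
  fixes p :: "'k::field_char_0 mpoly"
  shows "word_act (map XGen us) p = single (\<Sum>i\<leftarrow>us. single i 1) 1 * p"
  by (induction us) (simp_all add: mp_var_def mult_single flip: mult.assoc)

lemma free_act_poly_elt: "free_act (poly_elt f) p = f * p"
  using subset_UNIV[of "keys f"]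
proof (induction f rule: poly_mapping_add_induct)
  case (single m c)
  have "(\<Sum>i\<leftarrow>mono_list m. single i 1) = m"
    by (rule poly_mapping_eqI) (simp add: lookup_sum_list_single count_mset_mono_list flip: count_mset)
  then show ?case
    by (subst poly_elt_single)
      (simp add: free_act_mult word_act_x_word mp_const_def mult_single flip: mult.assoc)
qed (simp_all add: poly_elt_add free_act_add distrib_right)

lemma longest_act_sym:
  assumes "p \<in> poly_ring n"
  shows "free_act (longest n) p \<in> sym_ring n"
proof (rule sym_ringI)
  show "free_act (longest n) p \<in> poly_ring n" using assms by (intro free_act_poly_ring longest_carrier) auto
  show "swap_poly i (free_act (longest n) p) = free_act (longest n) p" if "i \<in> {1..<n}" for i
    using nh_cong_free_act[OF longest_annihilated[OF order_refl that], of p]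
    by (simp add: free_act_mult divided_difference_eq_0_iff del: free_act_word[of "long_word n"])
qed

text \<open>Every operator that is linear over the symmetric polynomials comes from the nilHecke algebra:
  apply it to the identity \<open>p = \<Sum> u \<cdot> D(v p)\<close>, in which \<open>D(v p)\<close> is symmetric.\<close>

lemma sym_linear_is_free_act:
  assumes add: "\<And>p q. p \<in> poly_ring n \<Longrightarrow> q \<in> poly_ring n \<Longrightarrow> \<Phi> (p + q) = \<Phi> p + \<Phi> q"
    and sym: "\<And>s p. s \<in> sym_ring n \<Longrightarrow> p \<in> poly_ring n \<Longrightarrow> \<Phi> (s * p) = s * \<Phi> p"
    and poly: "\<And>p. p \<in> poly_ring n \<Longrightarrow> \<Phi> p \<in> poly_ring n"
  shows "\<exists>\<psi>\<in>carrier (free_alg n). \<forall>p\<in>poly_ring n. free_act \<psi> p = \<Phi> p"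
proof -
  note closed = free_alg_add free_act_poly_ring
  have "t \<in> carrier (free_alg n) \<and> (\<exists>\<psi>\<in>carrier (free_alg n). \<forall>p\<in>poly_ring n. free_act \<psi> p = \<Phi> (free_act t p))"
    if "t \<in> longest_span n n (stair_lists n)" for t
    using that
  proof (induction rule: longest_span.induct)
    case zero
    have "\<Phi> (0 * 0) = 0 * \<Phi> 0" by (rule sym) (simp_all add: sym_ring_0 poly_ring_eq_mpolys_in)
    then show ?case by (auto intro!: bexI[of _ 0])
  next
    case (add s t)
    then obtain \<psi> \<chi> where "\<psi> \<in> carrier (free_alg n)" "\<chi> \<in> carrier (free_alg n)"
      "\<forall>p\<in>poly_ring n. free_act \<psi> p = \<Phi> (free_act s p)" "\<forall>p\<in>poly_ring n. free_act \<chi> p = \<Phi> (free_act t p)"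
      by blast
    then show ?case using add
      by (intro conjI bexI[of _ "\<psi> + \<chi>"]) (auto simp: free_alg_add free_act_add assms(1) free_act_poly_ring)
  next
    case (gen us v)
    let ?u = "fr_word (map XGen us)"
    have u: "?u \<in> carrier (free_alg n)" using gen by (simp add: x_word_carrier)
    have L: "longest n \<in> carrier (free_alg n)" by (simp add: longest_carrier)
    have 1: "(1 :: 'a mpoly) \<in> poly_ring n" by (simp add: poly_ring_eq_mpolys_in)
    define f where "f = \<Phi> (free_act ?u 1)"
    have f: "f \<in> poly_ring n" unfolding f_def by (intro poly free_act_poly_ring u 1)
    have "free_act (poly_elt f * longest n * v) p = \<Phi> (free_act (?u * longest n * v) p)"
      if p: "p \<in> poly_ring n" for p
    proof -
      let ?s = "free_act (longest n) (free_act v p)"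
      have s: "?s \<in> sym_ring n" using p gen by (intro longest_act_sym free_act_poly_ring)
      have "free_act (?u * longest n * v) p = free_act ?u (?s * 1)" by (simp only: free_act_mult mult_1_right)
      also have "\<dots> = ?s * free_act ?u 1" by (rule free_act_sym_mult[OF u s])
      finally have "\<Phi> (free_act (?u * longest n * v) p) = ?s * f"
        using sym[OF s free_act_poly_ring[OF u 1]] by (simp only: f_def)
      then show ?thesis by (simp only: free_act_mult free_act_poly_elt mult.commute)
    qed
    then show ?case using u L gen f
      by (intro conjI bexI[of _ "poly_elt f * longest n * v"] ballI free_alg_mult poly_elt_carrier)
  next
    case (cong s t)
    then show ?case using nh_cong_free_act[OF cong(2)] nh_cong_carrier[OF cong(2)] by simp
  qed
  from this[OF one_in_longest_span[OF order_refl]] show ?thesis by simp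
qed


section \<open>The staircase basis over the symmetric polynomials\<close>

abbreviation xmon :: "(nat \<Rightarrow>\<^sub>0 nat) \<Rightarrow> 'k::field_char_0 mpoly" where
  "xmon m \<equiv> single m 1"

text \<open>The exponents of the monomials of \<open>H\<close> in the first \<open>k\<close> variables; the second parameter allows induction.\<close>

definition stair :: "nat \<Rightarrow> nat \<Rightarrow> (nat \<Rightarrow>\<^sub>0 nat) set" where
  "stair n k = {m. keys m \<subseteq> {1..k} \<and> (\<forall>i. lookup m i \<le> n - i)}"

lemma finite_stair: "finite (stair n k)"
proof (rule finite_imageD)
  let ?F = "{f :: nat \<Rightarrow> nat. \<forall>i. (i \<in> {1..k} \<longrightarrow> f i \<in> {..n}) \<and> (i \<notin> {1..k} \<longrightarrow> f i = 0)}"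
  have "lookup m i \<in> {..n} \<and> (i \<notin> {1..k} \<longrightarrow> lookup m i = 0)"
    if "m \<in> stair n k" for m i
  proof -
    have le: "lookup m i \<le> n - i" and sub: "keys m \<subseteq> {1..k}"
      using that by (simp_all add: stair_def)
    have "lookup m i = 0" if "i \<notin> {1..k}"
    proof -
      have "i \<notin> keys m" using sub that by (rule contra_subsetD)
      then show ?thesis by (simp add: in_keys_iff)
    qed
    then show ?thesis using le by simp
  qed
  then have "lookup ` stair n k \<subseteq> ?F" by (intro image_subsetI) simp
  then show "finite (lookup ` stair n k)"
    by (rule finite_subset[OF _ finite_set_of_finite_funs]) simp_all
  show "inj_on lookup (stair n k)"
    by (rule inj_onI, rule poly_mapping_eqI, rule fun_cong)
qed

lemma perm_poly_fixed:
  fixes f :: "'k::field_char_0 mpoly"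
  assumes "bij \<sigma>" "f \<in> mpolys_in A" "\<And>i. i \<in> A \<Longrightarrow> \<sigma> i = i"
  shows "perm_poly \<sigma> f = f"
  using assms(2)
proof (induction rule: mpolys_in_induct)
  case (var i p)
  then show ?case using assms(1) assms(3)[OF var(1)] by (simp add: perm_poly_mult)
qed (simp_all add: assms(1) perm_poly_add)

lemma mono_mpolys_in: "keys m \<subseteq> A \<Longrightarrow> xmon m \<in> mpolys_in A"
  by (simp add: mpolys_in_def)

lemma stair_Suc:
  assumes "Suc k \<le> n"
  shows "bij_betw (\<lambda>(j, m). m + single (Suc k) j) ({..n - Suc k} \<times> stair n k) (stair n (Suc k))"
proof (rule bij_betw_byWitness[where f' = "\<lambda>m. (lookup m (Suc k),
    m - single (Suc k) (lookup m (Suc k)))"])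
  have 0: "lookup m (Suc k) = 0" if "m \<in> stair n k" for m
  proof -
    have "Suc k \<notin> keys m" using that by (auto simp: stair_def)
    then show ?thesis by (simp add: in_keys_iff)
  qed
  show "\<forall>a\<in>{..n - Suc k} \<times> stair n k.
      (\<lambda>m. (lookup m (Suc k), m - single (Suc k) (lookup m (Suc k))))
        ((\<lambda>(j, m). m + single (Suc k) j) a) = a"
    by (simp add: lookup_add 0 split_beta)
  show "\<forall>m\<in>stair n (Suc k). (\<lambda>(j, m). m + single (Suc k) j)
        (lookup m (Suc k), m - single (Suc k) (lookup m (Suc k))) = m"
    by (intro ballI, rule poly_mapping_eqI) (simp add: lookup_add lookup_minus lookup_single when_def)
  show "(\<lambda>(j, m). m + single (Suc k) j) ` ({..n - Suc k} \<times> stair n k) \<subseteq> stair n (Suc k)"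
  proof clarify
    fix j m assume j: "j \<le> n - Suc k" and m: "m \<in> stair n k"
    have "lookup (m + single (Suc k) j) i \<le> n - i" for i
      using 0[OF m] j m by (cases "i = Suc k") (auto simp: lookup_add lookup_single stair_def)
    moreover have "keys (m + single (Suc k) j) \<subseteq> {1..Suc k}"
    proof -
      have "keys (m + single (Suc k) j) \<subseteq> keys m \<union> {Suc k}"
        using Poly_Mapping.keys_add[of m "single (Suc k) j"] by (auto split: if_splits)
      moreover have "keys m \<subseteq> {1..k}" using m by (simp add: stair_def)
      ultimately show ?thesis by force
    qed
    ultimately show "m + single (Suc k) j \<in> stair n (Suc k)"
      by (simp add: stair_def)
  qed
  show "(\<lambda>m. (lookup m (Suc k), m - single (Suc k) (lookup m (Suc k))))
      ` stair n (Suc k) \<subseteq> {..n - Suc k} \<times> stair n k"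
  proof clarify
    fix m assume m: "m \<in> stair n (Suc k)"
    let ?m = "m - single (Suc k) (lookup m (Suc k))"
    have l: "lookup ?m i = (if i = Suc k then 0 else lookup m i)" for i
      by (simp add: lookup_minus lookup_single when_def)
    have "keys ?m \<subseteq> {1..k}"
    proof
      fix i assume "i \<in> keys ?m"
      then have "i \<noteq> Suc k" "i \<in> keys m" by (auto simp: in_keys_iff l split: if_splits)
      moreover have "keys m \<subseteq> {1..Suc k}" using m by (simp add: stair_def)
      ultimately show "i \<in> {1..k}" by (auto simp: subset_iff le_Suc_eq)
    qed
    then have "?m \<in> stair n k" using m by (auto simp: stair_def l)
    then show "lookup m (Suc k) \<in> {..n - Suc k} \<and> ?m \<in> stair n k"
      using m by (auto simp: stair_def)
  qed
qed

text \<open>Group the sum by the exponent of the last variable. The coefficients of the resulting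
  polynomial in \<open>x\<^bsub>k+1\<^esub>\<close> do not change when that variable is exchanged with a later one, so all
  \<open>n - k\<close> variables from \<open>x\<^bsub>k+1\<^esub>\<close> on are roots; its degree is less than \<open>n - k\<close>.\<close>

lemma stair_independent:
  fixes S :: "(nat \<Rightarrow>\<^sub>0 nat) \<Rightarrow> 'k::field_char_0 mpoly"
  assumes "k \<le> n" "\<And>m. m \<in> stair n k \<Longrightarrow> S m \<in> sym_ring n"
    and "(\<Sum>m\<in>stair n k. S m * xmon m) = 0" "m \<in> stair n k"
  shows "S m = 0"
  using assms
proof (induction k arbitrary: S m)
  case 0
  have "stair n 0 = {0}" by (auto simp: stair_def)
  with 0 show ?case by simp
next
  case (Suc k)
  let ?S = "\<lambda>j m. S (m + single (Suc k) j)"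
  define B where "B j = (\<Sum>m\<in>stair n k. ?S j m * xmon m)" for j
  have bij: "bij_betw (\<lambda>(j, m). m + single (Suc k) j) ({..n - Suc k} \<times> stair n k) (stair n (Suc k))"
    using Suc.prems by (intro stair_Suc) auto
  have sym: "?S j m \<in> sym_ring n" if "j \<le> n - Suc k" "m \<in> stair n k" for j m
    using Suc.prems(2) bij_betwE[OF bij] that by fastforce
  have pow: "xmon (m + single (Suc k) j) = xmon m * (mp_var (Suc k) ^ j :: 'k mpoly)"
    for m j
  proof -
    have "mp_var (Suc k) ^ j = (xmon (single (Suc k) j) :: 'k mpoly)"
      by (induction j) (simp_all add: mon_Suc)
    then show ?thesis by (simp add: mult_single)
  qed
  have "0 = (\<Sum>(j, m)\<in>{..n - Suc k} \<times> stair n k. ?S j m * xmon (m + single (Suc k) j))"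
    using Suc.prems(3) sum.reindex_bij_betw[OF bij, of "\<lambda>m. S m * xmon m"]
    by (simp add: case_prod_unfold)
  also have "\<dots> = (\<Sum>j\<le>n - Suc k. \<Sum>m\<in>stair n k. ?S j m * xmon (m + single (Suc k) j))"
    by (simp add: sum.cartesian_product)
  also have "\<dots> = (\<Sum>j\<le>n - Suc k. B j * mp_var (Suc k) ^ j)"
    by (simp add: B_def pow sum_distrib_right mult.assoc)
  finally have zero: "(\<Sum>j\<le>n - Suc k. B j * mp_var (Suc k) ^ j) = 0" by simp
  \<comment> \<open>The roots are counted over the domain of all polynomials; distinct variables are distinct roots.\<close>
  define P where "P = (\<Sum>j\<le>n - Suc k. Polynomial.monom (B j) j)"
  have coeff: "Polynomial.coeff P j = B j" if "j \<le> n - Suc k" for j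
    using that by (simp add: P_def coeff_sum sum.delta)
  have deg: "Polynomial.degree P \<le> n - Suc k"
    unfolding P_def by (intro degree_sum_le) (auto intro: order_trans[OF degree_monom_le])
  have root: "poly P (mp_var l) = 0" if l: "l \<in> {Suc k..n}" for l
  proof -
    let ?t = "transpose (Suc k) l"
    have "perm_poly ?t (B j) = B j" if "j \<le> n - Suc k" for j
    proof -
      have "perm_poly ?t (xmon m) = (xmon m :: 'k mpoly)" if "m \<in> stair n k" for m
        by (rule perm_poly_fixed[where A = "{1..k}"])
          (use that l in \<open>auto simp: stair_def transpose_def intro!: mono_mpolys_in\<close>)
      moreover have "perm_poly ?t (?S j m) = ?S j m" if "m \<in> stair n k" for m
        using sym[OF \<open>j \<le> n - Suc k\<close> that] l Suc.prems(1) by (auto intro!: sym_ringD(2))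
      ultimately show ?thesis unfolding B_def by (simp add: perm_poly_sum perm_poly_mult)
    qed
    moreover have "perm_poly ?t (mp_var (Suc k) ^ j) = (mp_var l ^ j :: 'k mpoly)" for j
      by (induction j) (simp_all add: perm_poly_mult)
    ultimately have "(\<Sum>j\<le>n - Suc k. B j * mp_var l ^ j) = 0"
      using arg_cong[OF zero, of "perm_poly ?t"] by (simp add: perm_poly_sum perm_poly_mult)
    then show ?thesis by (simp add: P_def poly_sum poly_monom)
  qed
  have "P = 0"
  proof (rule ccontr)
    assume "P \<noteq> 0"
    then have "card {x. poly P x = 0} \<le> Polynomial.degree P" by (rule card_poly_roots_bound)
    moreover have "card (mp_var ` {Suc k..n} :: 'k mpoly set) \<le> card {x. poly P x = 0}"
      using root \<open>P \<noteq> 0\<close> by (intro card_mono poly_roots_finite) auto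
    moreover have "card (mp_var ` {Suc k..n} :: 'k mpoly set) = n - k"
      by (subst card_image) (auto intro: inj_onI)
    ultimately show False using deg Suc.prems(1) by linarith
  qed
  then have B0: "B j = 0" if "j \<le> n - Suc k" for j using coeff[OF that] by simp
  obtain j m' where m: "m = m' + single (Suc k) j" "j \<le> n - Suc k" "m' \<in> stair n k"
    using Suc.prems(4) bij_betw_imp_surj_on[OF bij] by fastforce
  show ?case
    using Suc.IH[of "?S j" m'] sym[OF m(2)] B0[OF m(2)] Suc.prems(1) m by (simp add: B_def)
qed

abbreviation stairs :: "nat \<Rightarrow> (nat \<Rightarrow>\<^sub>0 nat) set" where
  "stairs n \<equiv> stair n n"

text \<open>Apply \<open>1 = \<Sum> u D v\<close> to \<open>p\<close>: the monomials \<open>u\<close> lie in \<open>H\<close> and the values \<open>D(v p)\<close> are symmetric.\<close>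

lemma stairs_span:
  fixes p :: "'k::field_char_0 mpoly"
  assumes "p \<in> poly_ring n"
  shows "\<exists>S. (\<forall>m\<in>stairs n. S m \<in> sym_ring n) \<and> p = (\<Sum>m\<in>stairs n. S m * xmon m)"
proof -
  have "\<exists>S. (\<forall>m\<in>stairs n. S m \<in> sym_ring n) \<and> free_act t p = (\<Sum>m\<in>stairs n. S m * xmon m)"
    if "t \<in> longest_span n n (stair_lists n)" for t
    using that
  proof (induction rule: longest_span.induct)
    case zero
    show ?case by (rule exI[of _ "\<lambda>_. 0"]) (simp add: sym_ring_0)
  next
    case (add s t)
    then obtain S T where "\<forall>m\<in>stairs n. S m \<in> sym_ring n" "\<forall>m\<in>stairs n. T m \<in> sym_ring n"
      "free_act s p = (\<Sum>m\<in>stairs n. S m * xmon m)" "free_act t p = (\<Sum>m\<in>stairs n. T m * xmon m)"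
      by blast
    then show ?case
      by (intro exI[of _ "\<lambda>m. S m + T m"]) (simp add: sym_ring_add free_act_add distrib_right sum.distrib)
  next
    case (gen us v)
    define m where "m = (\<Sum>i\<leftarrow>us. single i (1::nat))"
    define s where "s = free_act (longest n) (free_act v p)"
    have "keys m \<subseteq> {1..n}"
      using gen by (auto simp: m_def in_keys_iff lookup_sum_list_single count_list_0_iff)
    then have m: "m \<in> stairs n"
      using gen by (auto simp: stair_def stair_lists_def m_def lookup_sum_list_single)
    have s: "s \<in> sym_ring n"
      unfolding s_def using assms gen by (intro longest_act_sym free_act_poly_ring)
    have "free_act (fr_word (map XGen us) * longest n * v) p = xmon m * s"
      by (simp only: free_act_mult s_def free_act_word[of "map XGen us"] word_act_x_word m_def)
    also have "\<dots> = (\<Sum>m'\<in>stairs n. if m' = m then s * xmon m' else 0)"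
      using m by (simp add: finite_stair mult.commute)
    also have "\<dots> = (\<Sum>m'\<in>stairs n. (if m' = m then s else 0) * xmon m')"
      by (intro sum.cong) auto
    finally show ?case using s
      by (intro exI[of _ "\<lambda>m'. if m' = m then s else 0"]) (auto intro: sym_ring_0)
  next
    case (cong s t)
    then show ?case using nh_cong_free_act[OF cong(2)] by simp
  qed
  from this[OF one_in_longest_span[OF order_refl]] show ?thesis by simp
qed

definition coord :: "nat \<Rightarrow> 'k::field_char_0 mpoly \<Rightarrow> (nat \<Rightarrow>\<^sub>0 nat) \<Rightarrow> 'k mpoly" where
  "coord n p = (SOME S. (\<forall>m\<in>stairs n. S m \<in> sym_ring n) \<and> p = (\<Sum>m\<in>stairs n. S m * xmon m))"

lemma
  assumes "p \<in> poly_ring n"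
  shows coord_sym: "m \<in> stairs n \<Longrightarrow> coord n p m \<in> sym_ring n"
    and coord_expand: "p = (\<Sum>m\<in>stairs n. coord n p m * xmon m)"
  using someI_ex[OF stairs_span[OF assms]] unfolding coord_def by blast+

lemma coord_eqI:
  assumes "\<And>m. m \<in> stairs n \<Longrightarrow> S m \<in> sym_ring n" "p = (\<Sum>m\<in>stairs n. S m * xmon m)" "m \<in> stairs n"
  shows "coord n p m = S m"
proof -
  have p: "p \<in> poly_ring n"
    unfolding assms(2) poly_ring_eq_mpolys_in
    using sym_ringD(1)[OF assms(1)]
    by (intro mpolys_in_sum mpolys_in_mult mono_mpolys_in) (auto simp: stair_def poly_ring_eq_mpolys_in)
  have "coord n p m - S m = 0"
  proof (rule stair_independent[where S = "\<lambda>m. coord n p m - S m", OF order_refl _ _ assms(3)])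
    have "(\<Sum>m\<in>stairs n. (coord n p m - S m) * xmon m)
        = (\<Sum>m\<in>stairs n. coord n p m * xmon m) - (\<Sum>m\<in>stairs n. S m * xmon m)"
      by (simp add: left_diff_distrib sum_subtractf)
    then show "(\<Sum>m\<in>stairs n. (coord n p m - S m) * xmon m) = 0"
      using coord_expand[OF p] assms(2) by simp
  qed (use assms(1) coord_sym[OF p] in \<open>auto intro: sym_ring_diff\<close>)
  then show ?thesis by simp
qed

lemma coord_add:
  assumes "p \<in> poly_ring n" "q \<in> poly_ring n" "m \<in> stairs n"
  shows "coord n (p + q) m = coord n p m + coord n q m"
proof (rule coord_eqI[OF _ _ assms(3)])
  show "p + q = (\<Sum>m\<in>stairs n. (coord n p m + coord n q m) * xmon m)"
    using coord_expand[OF assms(1)] coord_expand[OF assms(2)] by (simp add: distrib_right sum.distrib)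
qed (use assms in \<open>auto intro: sym_ring_add coord_sym\<close>)

lemma coord_sym_mult:
  assumes "p \<in> poly_ring n" "s \<in> sym_ring n" "m \<in> stairs n"
  shows "coord n (s * p) m = s * coord n p m"
proof (rule coord_eqI[OF _ _ assms(3)])
  show "s * p = (\<Sum>m\<in>stairs n. (s * coord n p m) * xmon m)"
    using arg_cong[OF coord_expand[OF assms(1)], of "(*) s"] by (simp add: sum_distrib_left mult.assoc)
qed (use assms in \<open>auto intro: sym_ring_mult coord_sym\<close>)

lemma H_span_iff: "f \<in> H_span n \<longleftrightarrow> keys f \<subseteq> stairs n"
proof -
  have "m \<in> stairs n \<longleftrightarrow> keys m \<subseteq> {1..n} \<and> (\<forall>i\<in>{1..n}. lookup m i \<le> n - i)" for m
  proof -
    have "lookup m i \<le> n - i" if "keys m \<subseteq> {1..n}" "i \<notin> {1..n}" for i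
      using that by (metis in_keys_iff subsetD zero_le)
    then show ?thesis by (auto simp: stair_def)
  qed
  then show ?thesis unfolding H_span_def poly_ring_def by blast
qed

lemma H_span_poly_ring: "f \<in> H_span n \<Longrightarrow> f \<in> poly_ring n"
  by (simp add: H_span_def)

lemma mono_H_span: "m \<in> stairs n \<Longrightarrow> xmon m \<in> H_span n"
  by (simp add: H_span_iff)

lemma stair_mono_poly_ring: "m \<in> stairs n \<Longrightarrow> xmon m \<in> poly_ring n"
  by (intro H_span_poly_ring mono_H_span)

lemma H_span_expand:
  fixes f :: "'k::field_char_0 mpoly"
  assumes "f \<in> H_span n"
  shows "f = (\<Sum>m\<in>stairs n. mp_const (lookup f m) * xmon m)"
proof -
  have "f = (\<Sum>m\<in>keys f. mp_const (lookup f m) * xmon m)"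
    by (subst poly_mapping_sum_single[of f, symmetric]) (simp add: mp_const_def mult_single)
  also have "\<dots> = (\<Sum>m\<in>stairs n. mp_const (lookup f m) * xmon m)"
    using assms finite_stair by (intro sum.mono_neutral_left) (auto simp: H_span_iff in_keys_iff)
  finally show ?thesis .
qed

lemma coord_H_span:
  assumes "f \<in> H_span n" "m \<in> stairs n"
  shows "coord n f m = mp_const (lookup f m)"
  by (rule coord_eqI[OF sym_ring_const H_span_expand[OF assms(1)] assms(2)])

lemma H_span_add: "f \<in> H_span n \<Longrightarrow> g \<in> H_span n \<Longrightarrow> f + g \<in> H_span n"
  unfolding H_span_iff using Poly_Mapping.keys_add[of f g] by blast

lemma H_span_const_mult: "f \<in> H_span n \<Longrightarrow> mp_const c * f \<in> H_span n"
  for f :: "'k::field_char_0 mpoly"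
  by (auto simp: H_span_iff in_keys_iff)

lemma H_span_0: "0 \<in> H_span n"
  by (simp add: H_span_iff)

lemma H_span_uminus: "f \<in> H_span n \<Longrightarrow> - f \<in> H_span n" for f :: "'k::field_char_0 mpoly"
  by (auto simp: H_span_iff in_keys_iff)

lemma H_span_sum:
  fixes f :: "'a \<Rightarrow> 'k::field_char_0 mpoly"
  shows "(\<And>i. i \<in> I \<Longrightarrow> f i \<in> H_span n) \<Longrightarrow> (\<Sum>i\<in>I. f i) \<in> H_span n"
  by (induction I rule: infinite_finite_induct) (auto intro: H_span_add H_span_0)

section \<open>The nilHecke algebra as an endomorphism algebra\<close>

lemma nh_act_poly_ring: "a \<in> carrier (NH n) \<Longrightarrow> p \<in> poly_ring n \<Longrightarrow> nh_act a p \<in> poly_ring n"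
  by (erule NH_carrierE) (simp add: nh_act_class free_act_poly_ring)

lemma nh_act_mult: "a \<in> carrier (NH n) \<Longrightarrow> b \<in> carrier (NH n) \<Longrightarrow>
    nh_act (a \<otimes>\<^bsub>NH n\<^esub> b) p = nh_act a (nh_act b p)"
  by (elim NH_carrierE) (simp add: nh_class_mult nh_act_class free_alg_mult free_act_mult)

lemma nh_act_add: "a \<in> carrier (NH n) \<Longrightarrow> b \<in> carrier (NH n) \<Longrightarrow>
    nh_act (a \<oplus>\<^bsub>NH n\<^esub> b) p = nh_act a p + nh_act b p"
  by (elim NH_carrierE) (simp add: nh_class_add nh_act_class free_alg_add free_act_add)

lemma nh_act_one: "nh_act \<one>\<^bsub>NH n\<^esub> p = p"
  by (simp add: nh_class_one nh_act_class)

lemma nh_act_zero: "nh_act \<zero>\<^bsub>NH n\<^esub> p = 0"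
  by (simp add: nh_class_zero nh_act_class)

lemma nh_act_scalar: "nh_act (nh_class n (fr_const c)) p = mp_const c * p"
  by (simp add: nh_act_class)

lemma nh_act_a_inv: "a \<in> carrier (NH n) \<Longrightarrow> nh_act (a_inv (NH n) a) p = - nh_act a p"
proof -
  interpret ring "NH n :: 'a nh ring" by (rule NH_ring)
  assume a: "a \<in> carrier (NH n)"
  then have "nh_act (a_inv (NH n) a) p + nh_act a p = nh_act (a_inv (NH n) a \<oplus>\<^bsub>NH n\<^esub> a) p"
    by (simp add: nh_act_add)
  then show ?thesis using a by (simp add: l_neg nh_act_zero eq_neg_iff_add_eq_0)
qed

lemma nh_act_add_right: "a \<in> carrier (NH n) \<Longrightarrow> nh_act a (p + q) = nh_act a p + nh_act a q"
  by (erule NH_carrierE) (simp add: nh_act_class free_act_add_right)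

lemma nh_act_0_right: "a \<in> carrier (NH n) \<Longrightarrow> nh_act a 0 = 0"
  by (erule NH_carrierE) (simp add: nh_act_class)

lemma nh_act_sum_right: "a \<in> carrier (NH n) \<Longrightarrow> nh_act a (\<Sum>i\<in>I. f i) = (\<Sum>i\<in>I. nh_act a (f i))"
  by (induction I rule: infinite_finite_induct) (simp_all add: nh_act_add_right nh_act_0_right)

lemma nh_act_sym_mult: "a \<in> carrier (NH n) \<Longrightarrow> s \<in> sym_ring n \<Longrightarrow> nh_act a (s * p) = s * nh_act a p"
  by (erule NH_carrierE) (simp add: nh_act_class free_act_sym_mult)

lemma nh_act_const_mult: "a \<in> carrier (NH n) \<Longrightarrow> nh_act a (mp_const c * p) = mp_const c * nh_act a p"
  by (intro nh_act_sym_mult sym_ring_const)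

lemma nh_act_coords:
  assumes "a \<in> carrier (NH n)" "p \<in> poly_ring n"
  shows "nh_act a p = (\<Sum>m\<in>stairs n. coord n p m * nh_act a (xmon m))"
proof -
  have "nh_act a p = (\<Sum>m\<in>stairs n. nh_act a (coord n p m * xmon m))"
    by (subst coord_expand[OF assms(2)]) (rule nh_act_sum_right[OF assms(1)])
  also have "\<dots> = (\<Sum>m\<in>stairs n. coord n p m * nh_act a (xmon m))"
    by (intro sum.cong refl nh_act_sym_mult[OF assms(1)] coord_sym[OF assms(2)])
  finally show ?thesis .
qed

text \<open>Faithfulness together with linearity over the symmetric polynomials.\<close>

lemma NH_eqI:
  assumes "a \<in> carrier (NH n)" "b \<in> carrier (NH n)"
    and "\<And>m. m \<in> stairs n \<Longrightarrow> nh_act a (xmon m) = nh_act b (xmon m)"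
  shows "a = b"
proof -
  obtain \<phi> \<psi> where \<phi>: "\<phi> \<in> carrier (free_alg n)" "a = nh_class n \<phi>"
    and \<psi>: "\<psi> \<in> carrier (free_alg n)" "b = nh_class n \<psi>"
    using assms(1,2) by (elim NH_carrierE)
  have "free_act (\<phi> - \<psi>) p = 0" if "p \<in> poly_ring n" for p
  proof -
    have "nh_act a p = nh_act b p"
      using nh_act_coords[OF assms(1) that] nh_act_coords[OF assms(2) that] assms(3) by simp
    then show ?thesis by (simp add: free_act_diff \<phi> \<psi> nh_act_class)
  qed
  then have "\<phi> - \<psi> \<in> nh_ideal n"
    using \<phi> \<psi> by (subst nh_ideal_iff_acts_zero) (auto simp: free_alg_diff)
  then show ?thesis using \<phi> \<psi> by (simp add: nh_class_eq_iff nh_cong_def)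
qed

lemma NH_elt_exists:
  fixes F :: "(nat \<Rightarrow>\<^sub>0 nat) \<Rightarrow> 'k::field_char_0 mpoly"
  assumes F: "\<And>m. m \<in> stairs n \<Longrightarrow> F m \<in> poly_ring n"
  obtains a where "a \<in> carrier (NH n)" "\<And>p. p \<in> poly_ring n \<Longrightarrow> nh_act a p = (\<Sum>m\<in>stairs n. coord n p m * F m)"
proof -
  let ?\<Phi> = "\<lambda>p. \<Sum>m\<in>stairs n. coord n p m * F m"
  have "\<exists>\<psi>\<in>carrier (free_alg n). \<forall>p\<in>poly_ring n. free_act \<psi> p = ?\<Phi> p"
  proof (rule sym_linear_is_free_act)
    show "?\<Phi> (p + q) = ?\<Phi> p + ?\<Phi> q" if "p \<in> poly_ring n" "q \<in> poly_ring n" for p q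
      using that by (simp add: coord_add distrib_right sum.distrib)
    show "?\<Phi> (s * p) = s * ?\<Phi> p" if "s \<in> sym_ring n" "p \<in> poly_ring n" for s p
      using that by (simp add: coord_sym_mult sum_distrib_left mult.assoc)
    show "?\<Phi> p \<in> poly_ring n" if "p \<in> poly_ring n" for p
      using that coord_sym[OF that] sym_ringD(1) F unfolding poly_ring_eq_mpolys_in
      by (intro mpolys_in_sum mpolys_in_mult) blast+
  qed
  then obtain \<psi> where "\<psi> \<in> carrier (free_alg n)" "\<forall>p\<in>poly_ring n. free_act \<psi> p = ?\<Phi> p" by blast
  then show ?thesis by (intro that[of "nh_class n \<psi>"]) (auto simp: nh_class_carrier nh_act_class)
qed

lemma coord_mono:
  "m \<in> stairs n \<Longrightarrow> m' \<in> stairs n \<Longrightarrow> coord n (xmon m) m' = (if m' = m then 1 else 0)"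
  by (subst coord_H_span) (auto simp: mono_H_span lookup_single)

text \<open>Since the staircase monomials are a basis, operators can be prescribed freely on them.\<close>

lemma NH_elt_exists_mono:
  fixes F :: "(nat \<Rightarrow>\<^sub>0 nat) \<Rightarrow> 'k::field_char_0 mpoly"
  assumes F: "\<And>m. m \<in> stairs n \<Longrightarrow> F m \<in> poly_ring n"
  obtains a where "a \<in> carrier (NH n)" "\<And>m. m \<in> stairs n \<Longrightarrow> nh_act a (xmon m) = F m"
proof -
  obtain a where a: "a \<in> carrier (NH n)"
    "\<And>p. p \<in> poly_ring n \<Longrightarrow> nh_act a p = (\<Sum>m\<in>stairs n. coord n p m * F m)"
    using NH_elt_exists[of n F] F by blast
  have "nh_act a (xmon m) = F m" if m: "m \<in> stairs n" for m
  proof -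
    have "nh_act a (xmon m) = (\<Sum>m'\<in>stairs n. if m' = m then F m' else 0)"
      using a(2)[OF stair_mono_poly_ring[OF m]] m
      by (auto simp: coord_mono intro!: sum.cong)
    then show ?thesis using m by (simp add: finite_stair)
  qed
  with a(1) show ?thesis by (rule that)
qed


section \<open>Derivations of the polynomial ring\<close>

text \<open>The derivation with \<open>x\<^sub>i \<mapsto> v\<^sub>i\<close>.\<close>

definition poly_deriv :: "(nat \<Rightarrow> 'k::field_char_0 mpoly) \<Rightarrow> 'k mpoly \<Rightarrow> 'k mpoly" where
  "poly_deriv v f = (\<Sum>m\<in>keys f. mp_const (lookup f m) *
     (\<Sum>i\<in>keys m. mp_const (of_nat (lookup m i)) * xmon (m - single i 1) * v i))"

lemma poly_deriv_add: "poly_deriv v (f + g) = poly_deriv v f + poly_deriv v g"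
  unfolding poly_deriv_def
  by (rule setsum_keys_plus_distrib) (simp_all add: distrib_right)

lemma poly_deriv_0 [simp]: "poly_deriv v 0 = 0"
  by (simp add: poly_deriv_def)

lemma poly_deriv_uminus: "poly_deriv v (- f) = - poly_deriv v f"
  using poly_deriv_add[of v "- f" f] by (simp add: eq_neg_iff_add_eq_0)

lemma poly_deriv_diff: "poly_deriv v (f - g) = poly_deriv v f - poly_deriv v g"
  using poly_deriv_add[of v f "- g"] by (simp add: poly_deriv_uminus)

lemma poly_deriv_single:
  assumes "finite A" "keys m \<subseteq> A"
  shows "poly_deriv v (single m c)
    = mp_const c * (\<Sum>i\<in>A. mp_const (of_nat (lookup m i)) * xmon (m - single i 1) * v i)"
proof -
  have "(\<Sum>i\<in>keys m. mp_const (of_nat (lookup m i)) * xmon (m - single i 1) * v i)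
    = (\<Sum>i\<in>A. mp_const (of_nat (lookup m i)) * xmon (m - single i 1) * v i)"
    using assms by (intro sum.mono_neutral_left) (simp_all add: in_keys_iff)
  then show ?thesis by (simp add: poly_deriv_def)
qed

lemma poly_deriv_const [simp]: "poly_deriv v (mp_const c) = 0"
  unfolding mp_const_def by (subst poly_deriv_single[of "{}"]) simp_all

lemma poly_deriv_var_mult: "poly_deriv v (mp_var j * f) = v j * f + mp_var j * poly_deriv v f"
  using subset_UNIV[of "keys f"]
proof (induction f rule: poly_mapping_add_induct)
  case (single m c)
  define A where "A = insert j (keys m)"
  let ?m = "single j 1 + m"
  let ?t = "\<lambda>m i. mp_const (of_nat (lookup m i)) * xmon (m - single i 1) * v i"
  have A: "finite A" "keys m \<subseteq> A" by (auto simp: A_def)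
  have A': "keys ?m \<subseteq> A"
    using Poly_Mapping.keys_add[of "single j 1" m] unfolding A_def
    by (rule order_trans) simp
  have t: "?t ?m i = mp_var j * ?t m i + (if i = j then xmon m * v j else 0)" for i
  proof -
    have shift: "mp_const (of_nat (lookup m i)) * xmon (?m - single i 1)
        = mp_var j * (mp_const (of_nat (lookup m i)) * xmon (m - single i 1) :: 'a mpoly)"
    proof (cases "lookup m i = 0")
      case False
      then have "?m - single i 1 = single j 1 + (m - single i 1)"
        by (intro poly_mapping_eqI) (auto simp: lookup_add lookup_minus lookup_single when_def)
      then show ?thesis by (simp add: mp_var_def mult_single mult.left_commute)
    qed simp
    show ?thesis
    proof (cases "i = j")
      case True
      have "?t ?m i = mp_const (of_nat (lookup m i)) * xmon (?m - single i 1) * v i + xmon m * v j"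
        using True by (simp add: lookup_add lookup_single distrib_right add.commute)
      then have "?t ?m i = mp_var j * ?t m i + xmon m * v j" by (simp only: shift mult.assoc)
      then show ?thesis using True by (simp only: if_P)
    next
      case False
      then have "?t ?m i = mp_const (of_nat (lookup m i)) * xmon (?m - single i 1) * v i"
        by (simp add: lookup_add lookup_single when_def)
      then have "?t ?m i = mp_var j * ?t m i" by (simp only: shift mult.assoc)
      then show ?thesis using False by (simp only: if_False add_0_right)
    qed
  qed
  have "mp_var j * single m c = single ?m c"
    by (simp add: mp_var_def mult_single)
  then have "poly_deriv v (mp_var j * single m c) = mp_const c * (\<Sum>i\<in>A. ?t ?m i)"
    by (simp only: poly_deriv_single[OF A(1) A'])
  also have "(\<Sum>i\<in>A. ?t ?m i) = mp_var j * (\<Sum>i\<in>A. ?t m i) + xmon m * v j"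
    by (simp only: t sum.distrib sum_distrib_left) (simp add: A_def)
  finally have "poly_deriv v (mp_var j * single m c)
      = v j * (mp_const c * xmon m) + mp_var j * (mp_const c * (\<Sum>i\<in>A. ?t m i))"
    by (simp add: algebra_simps)
  then show ?case
    by (simp only: poly_deriv_single[OF A] mp_const_def mult_single add_0_left mult_1_right)
qed (simp_all add: distrib_left poly_deriv_add algebra_simps)

lemma poly_deriv_const_mult: "poly_deriv v (mp_const c * f) = mp_const c * poly_deriv v f"
  by (induction f rule: mpoly_induct)
    (simp_all add: poly_deriv_var_mult poly_deriv_add distrib_left mult.left_commute[of "mp_const c"]
      flip: mp_const_simps)

lemma poly_deriv_mult: "poly_deriv v (f * g) = poly_deriv v f * g + f * poly_deriv v g"
proof (induction f rule: mpoly_induct)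
  case (const c)
  show ?case by (simp add: poly_deriv_const_mult)
next
  case (var i p)
  have "poly_deriv v (mp_var i * p * g) = v i * (p * g) + mp_var i * poly_deriv v (p * g)"
    by (simp only: mult.assoc poly_deriv_var_mult)
  then show ?case by (simp only: var poly_deriv_var_mult) (simp add: algebra_simps)
next
  case (add p q)
  then show ?case by (simp only: distrib_right poly_deriv_add) (simp add: algebra_simps)
qed

lemma poly_deriv_mpolys_in:
  assumes "\<And>i. i \<in> A \<Longrightarrow> v i \<in> mpolys_in A" "f \<in> mpolys_in A"
  shows "poly_deriv v f \<in> mpolys_in A"
  using assms(2)
  by (induction rule: mpolys_in_induct)
    (simp_all add: poly_deriv_var_mult poly_deriv_add assms(1) mpolys_in_add mpolys_in_mult mpolys_in_var)

lemma poly_deriv_perm: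
  assumes "bij \<sigma>" "\<And>i. perm_poly \<sigma> (v i) = v (\<sigma> i)"
  shows "perm_poly \<sigma> (poly_deriv v f) = poly_deriv v (perm_poly \<sigma> f)"
  by (induction f rule: mpoly_induct)
    (simp_all add: poly_deriv_var_mult poly_deriv_add perm_poly_add perm_poly_mult assms)

lemma poly_deriv_sym:
  assumes "\<And>\<sigma> i. bij \<sigma> \<Longrightarrow> perm_poly \<sigma> (v i) = v (\<sigma> i)"
    and "\<And>i. i \<in> {1..n} \<Longrightarrow> v i \<in> poly_ring n" "f \<in> sym_ring n"
  shows "poly_deriv v f \<in> sym_ring n"
proof (rule sym_ringI)
  show "poly_deriv v f \<in> poly_ring n"
    using assms(2) sym_ringD(1)[OF assms(3)] unfolding poly_ring_eq_mpolys_in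
    by (intro poly_deriv_mpolys_in) auto
  show "swap_poly i (poly_deriv v f) = poly_deriv v f" if "i \<in> {1..<n}" for i
    using that sym_ringD(2)[OF assms(3), of i "Suc i"] by (simp add: poly_deriv_perm assms(1))
qed

text \<open>Apply the derivation to \<open>(x\<^sub>i - x\<^bsub>i+1\<^esub>) \<partial>\<^sub>i f = f - s\<^sub>i f\<close>; it commutes with \<open>s\<^sub>i\<close> by equivariance of \<open>v\<close>.\<close>

lemma divided_difference_poly_deriv:
  assumes v: "\<And>j. swap_poly i (v j) = v (transpose i (Suc i) j)"
    and w: "v i - v (Suc i) = (mp_var i - mp_var (Suc i)) * w"
  shows "divided_difference i (poly_deriv v f)
    = poly_deriv v (divided_difference i f) + w * divided_difference i f"
proof (rule divided_difference_eqI)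
  let ?D = "divided_difference i f"
  have "poly_deriv v f - swap_poly i (poly_deriv v f) = poly_deriv v (f - swap_poly i f)"
    by (simp add: poly_deriv_perm[where \<sigma> = "transpose i (Suc i)" and v = v, OF bij_transpose v] poly_deriv_diff)
  also have "\<dots> = poly_deriv v ((mp_var i - mp_var (Suc i)) * ?D)"
    by (simp only: divided_difference_spec)
  also have "\<dots> = (v i - v (Suc i)) * ?D + (mp_var i - mp_var (Suc i)) * poly_deriv v ?D"
    by (simp add: left_diff_distrib poly_deriv_diff poly_deriv_var_mult)
  finally show "(mp_var i - mp_var (Suc i)) * (poly_deriv v ?D + w * ?D)
      = poly_deriv v f - swap_poly i (poly_deriv v f)"
    by (simp only: w) (simp add: algebra_simps)
qed

text \<open>A bound instead of the degree itself, so that \<open>0\<close> is no exception.\<close>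

definition deg_le :: "nat \<Rightarrow> nat \<Rightarrow> 'k::field_char_0 mpoly \<Rightarrow> bool" where
  "deg_le i k f \<longleftrightarrow> (\<forall>m\<in>keys f. lookup m i \<le> k)"

lemma deg_le_0 [simp]: "deg_le i k 0"
  by (simp add: deg_le_def)

lemma deg_le_add: "deg_le i k f \<Longrightarrow> deg_le i k g \<Longrightarrow> deg_le i k (f + g)"
  unfolding deg_le_def using Poly_Mapping.keys_add[of f g] by blast

lemma deg_le_const_mult: "deg_le i k f \<Longrightarrow> deg_le i k (mp_const c * f)"
  by (simp add: deg_le_def in_keys_iff)

lemma deg_le_mono: "deg_le i k f \<Longrightarrow> k \<le> l \<Longrightarrow> deg_le i l f"
  unfolding deg_le_def by (meson order_trans)

lemma ex_deg_le: "\<exists>k. deg_le i k f"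
proof -
  have "finite ((\<lambda>m. lookup m i) ` keys f)" by simp
  then obtain k where "\<forall>l\<in>(\<lambda>m. lookup m i) ` keys f. l \<le> k"
    using finite_nat_set_iff_bounded_le by blast
  then have "deg_le i k f" by (simp add: deg_le_def)
  then show ?thesis by blast
qed

abbreviation sq_deriv :: "'k::field_char_0 mpoly \<Rightarrow> 'k mpoly" where
  "sq_deriv \<equiv> poly_deriv (\<lambda>i. mp_var i * mp_var i)"

lemma sq_deriv_single:
  assumes "finite A" "keys m \<subseteq> A"
  shows "sq_deriv (single m c)
    = (\<Sum>i\<in>A. single (m + single i 1) (c * of_nat (lookup m i)))"
proof -
  have "mp_const c * (mp_const (of_nat (lookup m i)) * xmon (m - single i 1) * (mp_var i * mp_var i))
      = single (m + single i 1) (c * of_nat (lookup m i))" for i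
  proof (cases "lookup m i = 0")
    case False
    then have "m - single i 1 + (single i 1 + single i 1) = m + single i 1"
      by (intro poly_mapping_eqI) (auto simp: lookup_add lookup_minus lookup_single when_def)
    then show ?thesis
      by (simp only: mp_const_def mp_var_def mult_single add_0_left mult_1_right)
  qed simp
  then show ?thesis by (simp add: poly_deriv_single[OF assms] sum_distrib_left)
qed

text \<open>The derivation with \<open>x\<^sub>i \<mapsto> x\<^sub>i\<^sup>2\<close> raises the degree in every variable that occurs:
  a term of top degree \<open>k > 0\<close> in \<open>x\<^sub>i\<close> is multiplied by \<open>k x\<^sub>i\<close>, and no other term can cancel
  the result.\<close>

lemma deg_le_sq_derivD:
  fixes f :: "'k::field_char_0 mpoly"
  assumes f: "deg_le i (Suc k) f" and Df: "deg_le i (Suc k) (sq_deriv f)"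
  shows "deg_le i k f"
proof (rule ccontr)
  assume "\<not> deg_le i k f"
  then obtain m where m: "m \<in> keys f" "lookup m i = Suc k"
    using f unfolding deg_le_def by (auto simp: le_Suc_eq)
  define A where "A = insert i (\<Union>(keys ` keys f))"
  let ?m = "m + single i 1"
  have A: "finite A" "i \<in> A" by (simp_all add: A_def)
  \<comment> \<open>The coefficient of \<open>x\<^sub>i x\<^sup>m\<close> in the derivative is \<open>k + 1\<close> times the coefficient of \<open>x\<^sup>m\<close>, which is not zero in characteristic zero.\<close>
  have "sq_deriv f = (\<Sum>m'\<in>keys f. sq_deriv (single m' (lookup f m')))"
  proof -
    have "sq_deriv (\<Sum>m'\<in>B. g m') = (\<Sum>m'\<in>B. sq_deriv (g m'))" for B and g :: "_ \<Rightarrow> 'k mpoly"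
      by (induction B rule: infinite_finite_induct) (simp_all add: poly_deriv_add)
    from this[of "\<lambda>m'. single m' (lookup f m')" "keys f"]
    show ?thesis by (simp only: poly_mapping_sum_single)
  qed
  also have "\<dots> = (\<Sum>m'\<in>keys f. \<Sum>j\<in>A. single (m' + single j 1)
      (lookup f m' * of_nat (lookup m' j)))"
    by (intro sum.cong refl sq_deriv_single A) (unfold A_def, blast)
  finally have "lookup (sq_deriv f) ?m = (\<Sum>m'\<in>keys f. \<Sum>j\<in>A.
      (lookup f m' * of_nat (lookup m' j) when m' + single j 1 = ?m))"
    by (simp add: lookup_sum lookup_single)
  also have "\<dots> = (\<Sum>m'\<in>keys f. \<Sum>j\<in>A.
      if m' = m then if j = i then lookup f m * of_nat (Suc k) else 0 else 0)"
  proof (intro sum.cong refl)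
    fix m' j assume m': "m' \<in> keys f" and "j \<in> A"
    have le: "lookup m' i \<le> Suc k" using f m' by (simp add: deg_le_def)
    have eqD: "j = i \<and> m' = m" if eq: "m' + single j 1 = ?m"
    proof -
      have "lookup m' i + (1 when j = i) = Suc (Suc k)"
        using arg_cong[OF eq, of "\<lambda>x. lookup x i"] m(2) by (simp add: lookup_add lookup_single)
      then have "j = i" using le by (cases "j = i") auto
      then show ?thesis using eq by simp
    qed
    show "(lookup f m' * of_nat (lookup m' j) when m' + single j 1 = ?m)
      = (if m' = m then if j = i then lookup f m * of_nat (Suc k) else 0 else 0)"
    proof (cases "m' + single j 1 = ?m")
      case True
      then have "j = i" "m' = m" using eqD by simp_all
      then show ?thesis using m(2) by simp
    next
      case False
      then have "m' = m \<Longrightarrow> j \<noteq> i" by (rule contrapos_nn) simp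
      then show ?thesis using False by simp
    qed
  qed
  also have "\<dots> = (\<Sum>m'\<in>keys f. if m' = m then lookup f m * of_nat (Suc k) else 0)"
    using A by (intro sum.cong refl) simp
  also have "\<dots> = lookup f m * of_nat (Suc k)"
    using m(1) by simp
  finally have "lookup (sq_deriv f) ?m \<noteq> 0"
    using m(1) by (simp add: in_keys_iff del: of_nat_Suc)
  then have "?m \<in> keys (sq_deriv f)" by (simp add: in_keys_iff)
  then have "lookup ?m i \<le> Suc k" using Df by (simp add: deg_le_def)
  then show False using m(2) by (simp add: lookup_add)
qed


section \<open>The Lie algebra acts by commutators\<close>

lemma free_derivation_add: "free_derivation v (\<phi> + \<psi>) = free_derivation v \<phi> + free_derivation v \<psi>"
  unfolding free_derivation_def
  by (rule setsum_keys_plus_distrib) (simp_all add: distrib_right)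

lemma free_derivation_single:
  "free_derivation v (single w c) = fr_const c * word_derivation v (letters w)"
  by (simp add: free_derivation_def)

lemma free_derivation_const: "free_derivation v (fr_const c) = 0"
  unfolding fr_const_def by (subst free_derivation_single) simp

lemma free_derivation_gen_mult:
  "free_derivation v (fr_word [g] * \<phi>) = v g * \<phi> + fr_word [g] * free_derivation v \<phi>"
  using subset_UNIV[of "keys \<phi>"]
proof (induction \<phi> rule: poly_mapping_add_induct)
  case zero
  show ?case by (simp add: free_derivation_def)
next
  case (single w c)
  have w: "single w c = fr_const c * fr_word (letters w)"
    by (simp add: fr_const_def fr_word_def mult_single)
  have "fr_word [g] * single w c = single (Word (g # letters w)) c"
    by (simp add: fr_word_def mult_single plus_nh_word_def)
  then have "free_derivation v (fr_word [g] * single w c)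
      = fr_const c * (v g * fr_word (letters w) + fr_word [g] * word_derivation v (letters w))"
    by (simp add: free_derivation_single)
  also have "\<dots> = v g * (fr_const c * fr_word (letters w)) + fr_word [g] * (fr_const c * word_derivation v (letters w))"
    using fr_const_commute[of "v g" c] fr_const_commute[of "fr_word [g]" c]
    by (simp add: distrib_left flip: mult.assoc)
  finally show ?case by (simp only: free_derivation_single w[symmetric])
next
  case (add \<phi> \<psi>)
  then show ?case by (simp add: distrib_left free_derivation_add algebra_simps)
qed

lemma free_h_add: "free_h (\<phi> + \<psi>) = free_h \<phi> + free_h \<psi>"
  unfolding free_h_def
  by (rule setsum_keys_plus_distrib) (simp_all add: distrib_left single_add)

lemma free_h_single: "free_h (single w c) = single w (of_int (word_deg w) * c)"
  by (simp add: free_h_def)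

lemma free_h_const: "free_h (fr_const c) = 0"
  unfolding fr_const_def by (subst free_h_single) (simp add: word_deg_def)

lemma free_h_gen_mult:
  "free_h (fr_word [g] * \<phi>) = fr_const (of_int (gen_deg g)) * fr_word [g] * \<phi> + fr_word [g] * free_h \<phi>"
  using subset_UNIV[of "keys \<phi>"]
proof (induction \<phi> rule: poly_mapping_add_induct)
  case zero
  show ?case by (simp add: free_h_def)
next
  case (single w c)
  have "word_deg (Word [g] + w) = gen_deg g + word_deg w" by (simp add: word_deg_def)
  then show ?case
    by (simp only: fr_const_def fr_word_def mult_single free_h_single of_int_add distrib_right
        single_add add_0_left mult_1_left mult_1_right)
next
  case (add \<phi> \<psi>)
  then show ?case by (simp add: distrib_left free_h_add algebra_simps)
qed

text \<open>A derivation \<open>F\<close> of the free algebra that acts as the commutator with an operator \<open>T\<close> on polynomials.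
  The Leibniz rule extends the commutator condition from generators to all words. So \<open>F \<phi>\<close> acts by
  zero if \<open>\<phi>\<close> does, and by faithfulness \<open>F\<close> descends to the nilHecke algebra.\<close>

locale commutator_lift =
  fixes n :: nat
    and F :: "'k::field_char_0 free_nh \<Rightarrow> 'k free_nh" and u :: "nh_gen \<Rightarrow> 'k free_nh"
    and T :: "'k mpoly \<Rightarrow> 'k mpoly"
  assumes F_add: "F (\<phi> + \<psi>) = F \<phi> + F \<psi>"
    and F_const: "F (fr_const c) = 0"
    and F_gen: "F (fr_word [g] * \<phi>) = u g * \<phi> + fr_word [g] * F \<phi>"
    and u_carrier: "g \<in> nh_gens n \<Longrightarrow> u g \<in> carrier (free_alg n)"
    and T_add: "T (p + q) = T p + T q"
    and T_const: "T (mp_const c * p) = mp_const c * T p"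
    and u_act: "g \<in> nh_gens n \<Longrightarrow> free_act (u g) p = T (gen_act g p) - gen_act g (T p)"
begin

lemma F_carrier: "\<phi> \<in> carrier (free_alg n) \<Longrightarrow> F \<phi> \<in> carrier (free_alg n)"
  by (induction rule: free_alg_induct)
    (simp_all add: F_add F_const F_gen free_alg_add free_alg_mult u_carrier free_alg_word)

lemma F_act: "\<phi> \<in> carrier (free_alg n) \<Longrightarrow> free_act (F \<phi>) p = T (free_act \<phi> p) - free_act \<phi> (T p)"
proof (induction rule: free_alg_induct)
  case (gen g \<phi>)
  have "gen_act g (T (free_act \<phi> p) - free_act \<phi> (T p)) = gen_act g (T (free_act \<phi> p)) - gen_act g (free_act \<phi> (T p))"
    using free_act_diff_right[of "fr_word [g]"] by simp
  then show ?case using gen by (simp add: F_gen free_act_add free_act_mult u_act)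
qed (simp_all add: F_const F_add T_const T_add free_act_add)

lemma F_cong:
  assumes "nh_cong n \<psi> \<phi>"
  shows "nh_cong n (F \<psi>) (F \<phi>)"
proof -
  note car = nh_cong_carrier[OF assms]
  have "free_act (F \<psi> - F \<phi>) p = 0" for p
    using nh_cong_free_act[OF assms] by (simp add: free_act_diff F_act car)
  then show ?thesis
    using car F_carrier by (simp add: nh_cong_def nh_ideal_iff_acts_zero free_alg_diff)
qed

lemma induced_carrier: "a \<in> carrier (NH n) \<Longrightarrow> nh_induced n F a \<in> carrier (NH n)"
  by (erule NH_carrierE) (simp add: nh_induced_class F_carrier F_cong nh_class_carrier)

lemma induced_act:
  "a \<in> carrier (NH n) \<Longrightarrow> nh_act (nh_induced n F a) p = T (nh_act a p) - nh_act a (T p)"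
  by (erule NH_carrierE) (simp add: nh_induced_class F_carrier F_cong nh_act_class F_act)

end

text \<open>On polynomials, \<open>\<d>\<close> becomes the derivation with \<open>x\<^sub>i \<mapsto> x\<^sub>i\<^sup>2\<close>, twisted by a linear form. The twist
  is forced by the commutator with \<open>\<partial>\<^sub>i\<close>. It also makes the staircase span stable: the coefficient
  of \<open>x\<^sub>i x\<^sup>a\<close> in the image of \<open>x\<^sup>a\<close> is \<open>a\<^sub>i - (n - i)\<close>, which vanishes at the bound.\<close>

definition twist :: "nat \<Rightarrow> 'k::field_char_0 mpoly" where
  "twist n = (\<Sum>j\<in>{1..n}. mp_const (of_nat (n - j)) * mp_var j)"

definition act_d :: "nat \<Rightarrow> 'k::field_char_0 mpoly \<Rightarrow> 'k mpoly" where
  "act_d n p = sq_deriv p - twist n * p"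

definition act_h :: "'k::field_char_0 mpoly \<Rightarrow> 'k mpoly" where
  "act_h p = mp_const 2 * poly_deriv mp_var p"

definition act_z :: "'k::field_char_0 mpoly \<Rightarrow> 'k mpoly" where
  "act_z = poly_deriv (\<lambda>_. 1)"

lemma act_linear:
  shows "act_d n (p + q) = act_d n p + act_d n q" and "act_d n (mp_const c * p) = mp_const c * act_d n p"
    and "act_h (p + q) = act_h p + act_h q" and "act_h (mp_const c * p) = mp_const c * act_h p"
    and "act_z (p + q) = act_z p + act_z q" and "act_z (mp_const c * p) = mp_const c * act_z p"
  by (simp_all only: act_d_def act_h_def act_z_def poly_deriv_add poly_deriv_const_mult)
    (simp_all add: algebra_simps)

lemma divided_difference_twist:
  assumes "i \<in> {1..<n}"
  shows "divided_difference i (twist n :: 'k::field_char_0 mpoly) = 1"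
proof -
  have sum: "divided_difference i (\<Sum>j\<in>A. f j) = (\<Sum>j\<in>A. divided_difference i (f j))"
    for A and f :: "nat \<Rightarrow> 'k mpoly"
    by (induction A rule: infinite_finite_induct) (simp_all add: divided_difference_add)
  have var: "divided_difference i (mp_const c * mp_var j)
      = (if j = i then mp_const c else 0) - (if j = Suc i then mp_const c else (0 :: 'k mpoly))" for c j
    by (simp add: divided_difference_const_mult divided_difference_var)
  have "divided_difference i (twist n :: 'k mpoly)
      = (\<Sum>j\<in>{1..n}. (if j = i then mp_const (of_nat (n - j)) else 0) - (if j = Suc i then mp_const (of_nat (n - j)) else 0))"
    unfolding twist_def sum
    by (intro sum.cong refl var)
  also have "\<dots> = mp_const (of_nat (n - i)) - mp_const (of_nat (n - Suc i))"
    using assms by (simp add: sum_subtractf)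
  also have "\<dots> = mp_const (of_nat (n - i) - of_nat (n - Suc i))" by simp
  also have "n - i = Suc (n - Suc i)" using assms by (simp add: Suc_diff_Suc)
  finally show ?thesis by simp
qed

lemma commutator_lift_d: "commutator_lift n (free_derivation d_gen) d_gen (act_d n)"
proof
  fix g :: nh_gen and p :: "'a mpoly" assume "g \<in> nh_gens n"
  then consider i where "g = XGen i" "i \<in> {1..n}" | i where "g = DGen i" "i \<in> {1..<n}"
    unfolding nh_gens_def by blast
  then show "free_act (d_gen g) p = act_d n (gen_act g p) - gen_act g (act_d n p)"
  proof cases
    case 1
    have "act_d n (mp_var i * p) - mp_var i * act_d n p = mp_var i * (mp_var i * p)"
      by (simp only: act_d_def poly_deriv_var_mult) (simp add: algebra_simps)
    then show ?thesis using 1 by (simp add: free_act_mult)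
  next
    case 2
    let ?D = "divided_difference i p" and ?x = "mp_var i :: 'a mpoly" and ?y = "mp_var (Suc i) :: 'a mpoly"
    have sq: "divided_difference i (sq_deriv p) = sq_deriv ?D + (?x + ?y) * ?D"
      by (rule divided_difference_poly_deriv) (simp_all add: perm_poly_mult algebra_simps)
    have tw: "swap_poly i (twist n) = twist n - (?x - ?y)"
      using divided_difference_spec[of i "twist n :: 'a mpoly"]
      unfolding divided_difference_twist[OF 2(2)] by (simp add: algebra_simps)
    have "act_d n ?D - divided_difference i (act_d n p)
        = (sq_deriv ?D - twist n * ?D) - (divided_difference i (sq_deriv p) - divided_difference i (twist n * p))"
      using divided_difference_add[of i "sq_deriv p - twist n * p" "twist n * p"]
      by (simp add: act_d_def)
    also have "\<dots> = p - (?x + ?x) * ?D"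
      by (simp only: sq divided_difference_mult divided_difference_twist[OF 2(2)] tw)
        (simp add: algebra_simps)
    also have "\<dots> = free_act (d_gen g) p"
      by (simp add: 2 free_act_diff free_act_uminus free_act_mult divided_difference_var_mult left_diff_distrib distrib_right)
    finally show ?thesis using 2 by simp
  qed
next
  fix g assume "g \<in> nh_gens n"
  then show "d_gen g \<in> carrier (free_alg n)"
    unfolding nh_gens_def by (elim UnE imageE) (auto intro!: free_alg_closed)
qed (simp_all only: free_derivation_add free_derivation_const free_derivation_gen_mult act_linear)

lemma commutator_lift_h:
  "commutator_lift n free_h (\<lambda>g. fr_const (of_int (gen_deg g)) * fr_word [g]) act_h"
proof
  fix g :: nh_gen and p :: "'a mpoly" assume "g \<in> nh_gens n"
  then consider i where "g = XGen i" | i where "g = DGen i"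
    unfolding nh_gens_def by blast
  then show "free_act (fr_const (of_int (gen_deg g)) * fr_word [g]) p = act_h (gen_act g p) - gen_act g (act_h p)"
  proof cases
    case 1
    have "act_h (mp_var i * p) - mp_var i * act_h p = mp_const 2 * (mp_var i * p)"
      by (simp only: act_h_def poly_deriv_var_mult) (simp add: algebra_simps)
    then show ?thesis using 1 by (simp add: free_act_mult)
  next
    case 2
    have "divided_difference i (poly_deriv mp_var p)
        = poly_deriv mp_var (divided_difference i p) + 1 * divided_difference i p"
      by (rule divided_difference_poly_deriv) simp_all
    then have "act_h (divided_difference i p) - divided_difference i (act_h p) = mp_const (- 2) * divided_difference i p"
      by (simp only: act_h_def divided_difference_const_mult) (simp add: algebra_simps)
    then show ?thesis using 2 by (simp add: free_act_uminus free_act_mult)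
  qed
next
  fix g assume "g \<in> nh_gens n"
  then show "fr_const (of_int (gen_deg g)) * fr_word [g] \<in> carrier (free_alg n)"
    by (intro free_alg_mult free_alg_word) simp_all
qed (simp_all only: free_h_add free_h_const free_h_gen_mult act_linear)

lemma commutator_lift_z: "commutator_lift n (free_derivation z_gen) z_gen act_z"
proof
  fix g :: nh_gen and p :: "'a mpoly" assume "g \<in> nh_gens n"
  then consider i where "g = XGen i" | i where "g = DGen i"
    unfolding nh_gens_def by blast
  then show "free_act (z_gen g) p = act_z (gen_act g p) - gen_act g (act_z p)"
  proof cases
    case 1
    then show ?thesis by (simp add: act_z_def poly_deriv_var_mult)
  next
    case 2
    have "divided_difference i (poly_deriv (\<lambda>_. 1) p)
        = poly_deriv (\<lambda>_. 1) (divided_difference i p) + 0 * divided_difference i p"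
      by (rule divided_difference_poly_deriv) simp_all
    then show ?thesis using 2 by (simp add: act_z_def)
  qed
next
  fix g assume "g \<in> nh_gens n"
  then show "z_gen g \<in> carrier (free_alg n)" by (cases g) simp_all
qed (simp_all only: free_derivation_add free_derivation_const free_derivation_gen_mult act_linear)

lemma stairs_poly_deriv:
  assumes "m \<in> stairs n"
  shows "poly_deriv v (xmon m)
    = (\<Sum>i\<in>{1..n}. mp_const (of_nat (lookup m i)) * xmon (m - single i 1) * v i)"
  using assms by (subst poly_deriv_single[of "{1..n}"]) (simp_all add: stair_def)

lemma H_span_linear:
  assumes add: "\<And>p q. T (p + q) = T p + T q"
    and const: "\<And>c p. T (mp_const c * p) = mp_const c * T p"
    and mon: "\<And>m. m \<in> stairs n \<Longrightarrow> T (xmon m) \<in> H_span n"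
    and "p \<in> H_span n"
  shows "T p \<in> H_span n"
  using assms(4) unfolding H_span_iff[of p]
proof (induction p rule: poly_mapping_add_induct)
  case zero
  show ?case using const[of 0 0] by (simp add: H_span_0)
next
  case (single m c)
  have "single m c = mp_const c * xmon m" by (simp add: mp_const_def mult_single)
  then show ?case using mon[OF single] by (simp add: const H_span_const_mult)
qed (simp add: add H_span_add)

lemma act_d_H_span:
  assumes "p \<in> H_span n"
  shows "act_d n p \<in> H_span n"
proof (rule H_span_linear[OF _ _ _ assms])
  fix m assume m: "m \<in> stairs n"
  have "sq_deriv (xmon m :: 'a mpoly) = (\<Sum>i\<in>{1..n}. mp_const (of_nat (lookup m i)) * xmon (m + single i 1))"
    using m by (subst sq_deriv_single[of "{1..n}"])
      (simp_all only: stair_def mem_Collect_eq finite_atLeastAtMost mp_const_def mult_single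
        add_0_left mult_1_left mult_1_right)
  moreover have "twist n * (xmon m :: 'a mpoly) = (\<Sum>i\<in>{1..n}. mp_const (of_nat (n - i)) * xmon (m + single i 1))"
    by (simp only: twist_def sum_distrib_right mp_const_def mp_var_def mult_single add_0_left
        mult_1_left mult_1_right add.commute)
  ultimately have "act_d n (xmon m :: 'a mpoly)
      = (\<Sum>i\<in>{1..n}. mp_const (of_nat (lookup m i) - of_nat (n - i)) * xmon (m + single i 1))"
    by (simp only: act_d_def sum_subtractf left_diff_distrib mp_const_simps(5))
  also have "\<dots> \<in> H_span n"
  proof (rule H_span_sum)
    fix i assume i: "i \<in> {1..n}"
    show "mp_const (of_nat (lookup m i) - of_nat (n - i)) * xmon (m + single i 1) \<in> H_span n"
    proof (cases "lookup m i = n - i")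
      case True
      then show ?thesis by (simp add: H_span_0)
    next
      case False
      have "lookup (m + single i 1) j \<le> n - j" for j
      proof -
        have "lookup m j \<le> n - j" using m by (simp add: stair_def)
        then show ?thesis using False by (cases "j = i") (simp_all add: lookup_add lookup_single)
      qed
      moreover have "keys (m + single i 1) \<subseteq> {1..n}"
        by (rule order_trans[OF Poly_Mapping.keys_add]) (use m i in \<open>simp add: stair_def\<close>)
      ultimately show ?thesis
        by (intro H_span_const_mult mono_H_span) (simp add: stair_def)
    qed
  qed
  finally show "act_d n (xmon m :: 'a mpoly) \<in> H_span n" .
qed (simp_all only: act_linear)

lemma act_h_H_span:
  assumes "p \<in> H_span n"
  shows "act_h p \<in> H_span n"
proof (rule H_span_linear[OF _ _ _ assms])
  fix m assume m: "m \<in> stairs n"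
  have "mp_const (of_nat (lookup m i)) * xmon (m - single i 1) * mp_var i
      = mp_const (of_nat (lookup m i)) * (xmon m :: 'a mpoly)" for i
  proof (cases "lookup m i = 0")
    case False
    then have "m - single i 1 + single i 1 = m"
      by (intro poly_mapping_eqI) (auto simp: lookup_add lookup_minus lookup_single when_def)
    then show ?thesis by (simp add: mp_var_def mult_single mult.assoc)
  qed simp
  then have "act_h (xmon m :: 'a mpoly) = mp_const 2 * (\<Sum>i\<in>{1..n}. mp_const (of_nat (lookup m i)) * (xmon m :: 'a mpoly))"
    by (simp only: act_h_def stairs_poly_deriv[OF m])
  also have "\<dots> \<in> H_span n" by (intro H_span_const_mult H_span_sum mono_H_span m)
  finally show "act_h (xmon m :: 'a mpoly) \<in> H_span n" .
qed (simp_all only: act_linear)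

lemma act_z_H_span:
  assumes "p \<in> H_span n"
  shows "act_z p \<in> H_span n"
proof (rule H_span_linear[OF _ _ _ assms])
  fix m assume m: "m \<in> stairs n"
  have "m - single i 1 \<in> stairs n" for i
  proof -
    have "keys (m - single i 1) \<subseteq> keys m"
      by (simp add: subset_iff in_keys_iff lookup_minus)
    then have "keys (m - single i 1) \<subseteq> {1..n}"
      by (rule order_trans) (use m in \<open>simp add: stair_def\<close>)
    moreover have "lookup (m - single i 1) j \<le> n - j" for j
    proof -
      have "lookup m j \<le> n - j" using m by (simp add: stair_def)
      then show ?thesis by (simp add: lookup_minus)
    qed
    ultimately show ?thesis by (simp add: stair_def)
  qed
  then show "act_z (xmon m :: 'a mpoly) \<in> H_span n"
    by (simp add: act_z_def stairs_poly_deriv[OF m] H_span_sum H_span_const_mult mono_H_span)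
qed (simp_all only: act_linear)


section \<open>The maximal finite-dimensional subrepresentation\<close>

abbreviation nh_scalar :: "nat \<Rightarrow> 'k::field_char_0 \<Rightarrow> 'k nh" where
  "nh_scalar n c \<equiv> nh_class n (fr_const c)"

lemma nh_scalar_carrier: "nh_scalar n c \<in> carrier (NH n)"
  by (simp add: nh_class_carrier)

lemma nh_scalar_mult: "nh_scalar n a \<otimes>\<^bsub>NH n\<^esub> nh_scalar n b = nh_scalar n (a * b)"
  by (simp add: nh_class_mult)

lemma nh_scalar_inject: "nh_scalar n a = nh_scalar n b \<longleftrightarrow> a = b"
proof
  assume "nh_scalar n a = nh_scalar n b"
  then have "nh_act (nh_scalar n a) 1 = nh_act (nh_scalar n b) 1" by simp
  then show "a = b" by (simp add: nh_act_scalar)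
qed simp

lemma nh_act_smult: "a \<in> carrier (NH n) \<Longrightarrow> nh_act (nh_scalar n c \<otimes>\<^bsub>NH n\<^esub> a) p = mp_const c * nh_act a p"
  by (simp add: nh_act_mult nh_scalar_carrier nh_act_scalar)

lemma NH_eq_actI:
  assumes "a \<in> carrier (NH n)" "b \<in> carrier (NH n)" "\<And>p. nh_act a p = nh_act b p"
  shows "a = b"
  using assms by (intro NH_eqI) auto

lemma nh_subspaceI:
  fixes U :: "'k::field_char_0 nh set"
  assumes "U \<subseteq> carrier (NH n)" "\<zero>\<^bsub>NH n\<^esub> \<in> U"
    and "\<And>a b. a \<in> U \<Longrightarrow> b \<in> U \<Longrightarrow> a \<oplus>\<^bsub>NH n\<^esub> b \<in> U"
    and smult: "\<And>c a. a \<in> U \<Longrightarrow> nh_scalar n c \<otimes>\<^bsub>NH n\<^esub> a \<in> U"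
  shows "subalgebra (nh_scalars n) U (NH n)"
proof -
  interpret ring "NH n :: 'k nh ring" by (rule NH_ring)
  have "\<ominus>\<^bsub>NH n\<^esub> a \<in> U" if "a \<in> U" for a
  proof -
    have a: "a \<in> carrier (NH n)" using that assms(1) by blast
    have "\<ominus>\<^bsub>NH n\<^esub> a = nh_scalar n (- 1) \<otimes>\<^bsub>NH n\<^esub> a"
      by (rule NH_eq_actI[where n = n])
        (use a in \<open>simp_all add: nh_scalar_carrier nh_act_a_inv nh_act_smult del: fr_const_simps\<close>)
    then show ?thesis using smult[OF that, of "- 1"] by (simp only:)
  qed
  then have "subgroup U (add_monoid (NH n))"
    using assms by (intro add.subgroupI) auto
  then show ?thesis
    using smult by (intro subalgebra.intro subalgebra_axioms.intro) (auto simp: nh_scalars_def)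
qed

lemma nh_scalars_subfield: "subfield (nh_scalars n :: 'k::field_char_0 nh set) (NH n)"
proof -
  interpret ring "NH n :: 'k nh ring" by (rule NH_ring)
  let ?K = "nh_scalars n :: 'k nh set"
  have one: "\<one>\<^bsub>NH n\<^esub> = nh_scalar n (1 :: 'k)" and zero: "\<zero>\<^bsub>NH n\<^esub> = nh_scalar n (0 :: 'k)"
    by (simp_all add: nh_class_one nh_class_zero)
  have "subring ?K (NH n)"
  proof (rule subringI)
    show "\<ominus>\<^bsub>NH n\<^esub> h \<in> ?K" if h: "h \<in> ?K" for h
    proof -
      obtain c where c: "h = nh_scalar n c" using h by (auto simp: nh_scalars_def)
      have "\<ominus>\<^bsub>NH n\<^esub> h = nh_scalar n (- c)"
        by (rule NH_eq_actI[where n = n])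
          (simp_all add: c nh_scalar_carrier nh_act_a_inv nh_act_scalar del: fr_const_simps)
      then show ?thesis unfolding nh_scalars_def by blast
    qed
    show "?K \<subseteq> carrier (NH n)" by (auto simp: nh_scalars_def nh_scalar_carrier)
    show "\<one>\<^bsub>NH n\<^esub> \<in> ?K" unfolding one nh_scalars_def by blast
    show "h1 \<otimes>\<^bsub>NH n\<^esub> h2 \<in> ?K" if "h1 \<in> ?K" "h2 \<in> ?K" for h1 h2
      using that nh_scalar_mult by (force simp: nh_scalars_def simp del: fr_const_simps)
    show "h1 \<oplus>\<^bsub>NH n\<^esub> h2 \<in> ?K" if hh: "h1 \<in> ?K" "h2 \<in> ?K" for h1 h2
    proof -
      obtain a b where "h1 = nh_scalar n a" "h2 = nh_scalar n b" using hh by (auto simp: nh_scalars_def)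
      then have "h1 \<oplus>\<^bsub>NH n\<^esub> h2 = nh_scalar n (a + b)" by (simp add: nh_class_add)
      then show ?thesis unfolding nh_scalars_def by blast
    qed
  qed
  moreover have comm: "h1 \<otimes>\<^bsub>NH n\<^esub> h2 = h2 \<otimes>\<^bsub>NH n\<^esub> h1" if hh: "h1 \<in> ?K" "h2 \<in> ?K" for h1 h2
  proof -
    obtain a b where "h1 = nh_scalar n a" "h2 = nh_scalar n b" using hh by (auto simp: nh_scalars_def)
    then show ?thesis by (simp only: nh_scalar_mult mult.commute)
  qed
  ultimately have "subcring ?K (NH n)" by (rule subcringI)
  moreover have "Units (NH n\<lparr>carrier := ?K\<rparr>) = ?K - {\<zero>\<^bsub>NH n\<^esub>}"
  proof
    show "Units (NH n\<lparr>carrier := ?K\<rparr>) \<subseteq> ?K - {\<zero>\<^bsub>NH n\<^esub>}"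
    proof
      fix k assume "k \<in> Units (NH n\<lparr>carrier := ?K\<rparr>)"
      then obtain k' where k: "k \<in> ?K" "k' \<in> ?K" "k' \<otimes>\<^bsub>NH n\<^esub> k = \<one>\<^bsub>NH n\<^esub>"
        by (auto simp: Units_def)
      obtain a b where ab: "k = nh_scalar n a" "k' = nh_scalar n b" using k by (auto simp: nh_scalars_def)
      then have "b * a = 1" using k(3) by (simp only: one nh_scalar_mult nh_scalar_inject)
      then have "a \<noteq> 0" by auto
      then have "k \<noteq> \<zero>\<^bsub>NH n\<^esub>" by (simp only: ab zero nh_scalar_inject not_False_eq_True)
      then show "k \<in> ?K - {\<zero>\<^bsub>NH n\<^esub>}" using k by blast
    qed
    show "?K - {\<zero>\<^bsub>NH n\<^esub>} \<subseteq> Units (NH n\<lparr>carrier := ?K\<rparr>)"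
    proof
      fix k assume k: "k \<in> ?K - {\<zero>\<^bsub>NH n\<^esub>}"
      then obtain a where a: "k = nh_scalar n a" by (auto simp: nh_scalars_def)
      with k have "a \<noteq> 0" unfolding zero by blast
      then have "nh_scalar n (inverse a) \<otimes>\<^bsub>NH n\<^esub> k = \<one>\<^bsub>NH n\<^esub>" "k \<otimes>\<^bsub>NH n\<^esub> nh_scalar n (inverse a) = \<one>\<^bsub>NH n\<^esub>"
        by (simp_all only: a nh_scalar_mult one left_inverse[OF \<open>a \<noteq> 0\<close>] right_inverse[OF \<open>a \<noteq> 0\<close>])
      moreover have "nh_scalar n (inverse a) \<in> ?K" unfolding nh_scalars_def by blast
      ultimately show "k \<in> Units (NH n\<lparr>carrier := ?K\<rparr>)"
        using k unfolding Units_def by auto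
    qed
  qed
  ultimately show ?thesis by (rule subfieldI)
qed

lemma poly_ring_0: "0 \<in> poly_ring n"
  by (simp add: poly_ring_def)

text \<open>The matrix algebra over the ground field, described without the choice of a basis of \<open>H\<close>.\<close>

definition const_part :: "nat \<Rightarrow> 'k::field_char_0 nh set" where
  "const_part n = {a \<in> carrier (NH n). \<forall>p\<in>H_span n. nh_act a p \<in> H_span n}"

lemma const_partI:
  assumes "a \<in> carrier (NH n)" "\<And>m. m \<in> stairs n \<Longrightarrow> nh_act a (xmon m) \<in> H_span n"
  shows "a \<in> const_part n"
  using assms H_span_linear[where T = "nh_act a" and n = n]
  by (auto simp: const_part_def nh_act_add_right[OF assms(1)] nh_act_const_mult[OF assms(1)])

lemma const_part_subring: "subring (const_part n :: 'k::field_char_0 nh set) (NH n)"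
proof -
  interpret ring "NH n :: 'k nh ring" by (rule NH_ring)
  show ?thesis
    by (rule subringI)
      (auto simp: const_part_def nh_act_one nh_act_mult nh_act_add nh_act_a_inv H_span_uminus H_span_add)
qed

lemma const_part_subspace: "subalgebra (nh_scalars n) (const_part n :: 'k::field_char_0 nh set) (NH n)"
proof (rule nh_subspaceI)
  interpret ring "NH n :: 'k nh ring" by (rule NH_ring)
  show "const_part n \<subseteq> carrier (NH n)" by (auto simp: const_part_def)
  show "\<zero>\<^bsub>NH n\<^esub> \<in> const_part n" by (rule subringE(2)[OF const_part_subring])
  show "a \<oplus>\<^bsub>NH n\<^esub> b \<in> const_part n" if "a \<in> const_part n" "b \<in> const_part n" for a b
    using that by (rule subringE(7)[OF const_part_subring])
  show "nh_scalar n c \<otimes>\<^bsub>NH n\<^esub> a \<in> const_part n" if "a \<in> const_part n" for c and a :: "'k nh"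
    using that by (auto simp: const_part_def nh_scalar_carrier nh_act_smult H_span_const_mult)
qed

text \<open>The matrix units for the staircase monomials span.\<close>

lemma const_part_finite_dimension:
  "ring.finite_dimension (NH n) (nh_scalars n) (const_part n :: 'k::field_char_0 nh set)"
proof -
  interpret ring "NH n :: 'k nh ring" by (rule NH_ring)
  note K = nh_scalars_subfield[of n, where 'k = 'k]
  let ?P = "stairs n \<times> stairs n"
  let ?E = "\<lambda>mm a. a \<in> carrier (NH n) \<and> (\<forall>k\<in>stairs n. nh_act a (xmon k) = (if k = snd mm then xmon (fst mm) else (0 :: 'k mpoly)))"
  define E where "E mm = (SOME a. ?E mm a)" for mm
  have "?E mm (E mm)" if mm: "mm \<in> ?P" for mm
  proof -
    have "(if k = snd mm then xmon (fst mm) else (0 :: 'k mpoly)) \<in> poly_ring n" for k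
      using mm stair_mono_poly_ring[of "fst mm" n] by (auto simp: poly_ring_0)
    then obtain a where "a \<in> carrier (NH n)"
      "\<And>k. k \<in> stairs n \<Longrightarrow> nh_act a (xmon k) = (if k = snd mm then xmon (fst mm) else (0 :: 'k mpoly))"
      by (rule NH_elt_exists_mono[of n "\<lambda>k. if k = snd mm then xmon (fst mm) else 0"]) blast
    then have "\<exists>a. ?E mm a" by blast
    then show ?thesis unfolding E_def by (rule someI_ex)
  qed
  then have E: "\<And>mm. mm \<in> ?P \<Longrightarrow> E mm \<in> carrier (NH n)"
    "\<And>mm k. mm \<in> ?P \<Longrightarrow> k \<in> stairs n \<Longrightarrow> nh_act (E mm) (xmon k) = (if k = snd mm then xmon (fst mm) else (0 :: 'k mpoly))"
    by blast+
  have finP: "finite ?P" by (simp add: finite_stair)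
  then obtain ps where ps: "set ps = ?P" using finite_list by blast
  let ?Us = "map E ps"
  have Us: "set ?Us \<subseteq> carrier (NH n)" using E(1) ps by auto
  have "const_part n \<subseteq> Span (nh_scalars n) ?Us"
  proof
    fix a :: "'k nh" assume a: "a \<in> const_part n"
    then have ac: "a \<in> carrier (NH n)" by (simp add: const_part_def)
    define c where "c mm = lookup (nh_act a (xmon (snd mm))) (fst mm)" for mm
    have "\<exists>b\<in>Span (nh_scalars n) ?Us. \<forall>k\<in>stairs n. nh_act b (xmon k)
        = (\<Sum>mm\<in>Q. if k = snd mm then mp_const (c mm) * xmon (fst mm) else 0)"
      if "finite Q" "Q \<subseteq> ?P" for Q
      using that
    proof (induction Q rule: finite_induct)
      case empty
      show ?case using Span_subgroup_props(2)[OF K Us] by (intro bexI[of _ "\<zero>\<^bsub>NH n\<^esub>"]) (simp_all add: nh_act_zero)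
    next
      case (insert mm Q)
      then obtain b where b: "b \<in> Span (nh_scalars n) ?Us"
        "\<forall>k\<in>stairs n. nh_act b (xmon k) = (\<Sum>mm\<in>Q. if k = snd mm then mp_const (c mm) * xmon (fst mm) else 0)"
        by auto
      have bc: "b \<in> carrier (NH n)" using b(1) Span_subgroup_props(1)[OF K Us] by blast
      have mm: "mm \<in> ?P" using insert.prems by simp
      then have "E mm \<in> set ?Us" using ps by auto
      then have "E mm \<in> Span (nh_scalars n) ?Us" using Span_base_incl[OF K Us] by blast
      then have "nh_scalar n (c mm) \<otimes>\<^bsub>NH n\<^esub> E mm \<in> Span (nh_scalars n) ?Us"
        by (intro Span_smult_closed[OF K Us]) (auto simp: nh_scalars_def)
      then have "(nh_scalar n (c mm) \<otimes>\<^bsub>NH n\<^esub> E mm) \<oplus>\<^bsub>NH n\<^esub> b \<in> Span (nh_scalars n) ?Us"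
        using b(1) by (intro Span_subgroup_props(3)[OF K Us])
      moreover have "nh_act ((nh_scalar n (c mm) \<otimes>\<^bsub>NH n\<^esub> E mm) \<oplus>\<^bsub>NH n\<^esub> b) (xmon k)
          = (\<Sum>mm\<in>insert mm Q. if k = snd mm then mp_const (c mm) * xmon (fst mm) else 0)" if "k \<in> stairs n" for k
        using insert.hyps b(2) that E[OF mm] bc
        by (simp add: nh_act_add nh_act_smult nh_scalar_carrier)
      ultimately show ?case by blast
    qed
    from this[OF finP] obtain b where b: "b \<in> Span (nh_scalars n) ?Us"
      "\<And>k. k \<in> stairs n \<Longrightarrow> nh_act b (xmon k) = (\<Sum>mm\<in>?P. if k = snd mm then mp_const (c mm) * xmon (fst mm) else 0)"
      by blast
    have "a = b"
    proof (rule NH_eqI[OF ac])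
      show "b \<in> carrier (NH n)" using b(1) Span_subgroup_props(1)[OF K Us] by blast
      fix k assume k: "k \<in> stairs n"
      have "nh_act b (xmon k) = (\<Sum>m\<in>stairs n. \<Sum>m'\<in>stairs n. if k = m' then mp_const (c (m, m')) * xmon m else 0)"
        by (simp only: b(2)[OF k] sum.cartesian_product) (simp add: case_prod_unfold cong: if_cong)
      also have "\<dots> = (\<Sum>m\<in>stairs n. mp_const (c (m, k)) * xmon m)"
        using k by (simp add: finite_stair)
      also have "\<dots> = nh_act a (xmon k)"
        unfolding c_def fst_conv snd_conv
        by (rule H_span_expand[symmetric]) (use a in \<open>simp add: const_part_def mono_H_span[OF k]\<close>)
      finally show "nh_act a (xmon k) = nh_act b (xmon k)" by simp
    qed
    with b(1) show "a \<in> Span (nh_scalars n) ?Us" by simp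
  qed
  from subalbegra_incl_imp_finite_dimension[OF K Span_finite_dimension[OF K Us] const_part_subspace this]
  show ?thesis .
qed

text \<open>Commutators with operators that preserve \<open>H\<close> preserve \<open>H\<close>.\<close>

lemma const_part_stable:
  "nh_d n ` const_part n \<subseteq> (const_part n :: 'a::field_char_0 nh set)"
  "nh_h n ` const_part n \<subseteq> (const_part n :: 'a nh set)"
  "nh_z n ` const_part n \<subseteq> (const_part n :: 'a nh set)"
proof -
  have diff: "p - q \<in> H_span n" if "p \<in> H_span n" "q \<in> H_span n" for p q :: "'a mpoly"
    using H_span_add[OF that(1) H_span_uminus[OF that(2)]] by simp
  interpret d: commutator_lift n "free_derivation d_gen" d_gen "act_d n :: 'a mpoly \<Rightarrow> _"
    by (rule commutator_lift_d)
  interpret h: commutator_lift n free_h "\<lambda>g. fr_const (of_int (gen_deg g)) * fr_word [g]" "act_h :: 'a mpoly \<Rightarrow> _"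
    by (rule commutator_lift_h)
  interpret z: commutator_lift n "free_derivation z_gen" z_gen "act_z :: 'a mpoly \<Rightarrow> _"
    by (rule commutator_lift_z)
  show "nh_d n ` const_part n \<subseteq> (const_part n :: 'a nh set)"
    by (auto simp: nh_d_def const_part_def d.induced_carrier d.induced_act intro!: diff act_d_H_span)
  show "nh_h n ` const_part n \<subseteq> (const_part n :: 'a nh set)"
    by (auto simp: nh_h_def const_part_def h.induced_carrier h.induced_act intro!: diff act_h_H_span)
  show "nh_z n ` const_part n \<subseteq> (const_part n :: 'a nh set)"
    by (auto simp: nh_z_def const_part_def z.induced_carrier z.induced_act intro!: diff act_z_H_span)
qed

text \<open>The filtration of the polynomial ring along which a finite-dimensional subrepresentation
  descends. It bounds only the symmetric coefficients, not the staircase monomials.\<close>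

definition coord_deg_le :: "nat \<Rightarrow> nat \<Rightarrow> nat \<Rightarrow> 'k::field_char_0 mpoly set" where
  "coord_deg_le n i k = {p \<in> poly_ring n. \<forall>m\<in>stairs n. deg_le i k (coord n p m)}"

lemma coord_deg_le_mono: "k \<le> l \<Longrightarrow> coord_deg_le n i k \<subseteq> coord_deg_le n i l"
  unfolding coord_deg_le_def by (intro Collect_mono impI conjI ballI) (auto elim: deg_le_mono)

lemma coord_deg_le_add:
  "p \<in> coord_deg_le n i k \<Longrightarrow> q \<in> coord_deg_le n i k \<Longrightarrow> p + q \<in> coord_deg_le n i k"
  by (simp add: coord_deg_le_def poly_ring_eq_mpolys_in mpolys_in_add coord_add[unfolded poly_ring_eq_mpolys_in] deg_le_add)

lemma coord_deg_le_const_mult: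
  "p \<in> coord_deg_le n i k \<Longrightarrow> mp_const c * p \<in> coord_deg_le n i k"
  by (simp add: coord_deg_le_def poly_ring_eq_mpolys_in mpolys_in_mult mpolys_in_const
      coord_sym_mult[unfolded poly_ring_eq_mpolys_in] sym_ring_const deg_le_const_mult)

lemma coord_deg_le_0: "0 \<in> coord_deg_le n i k"
proof -
  have "coord n (0 :: 'a mpoly) m = 0" if "m \<in> stairs n" for m
    using that by (intro coord_eqI[where S = "\<lambda>_. 0"]) (simp_all add: sym_ring_0)
  then show ?thesis by (simp add: coord_deg_le_def poly_ring_eq_mpolys_in)
qed

lemma coord_deg_le_sum:
  "(\<And>j. j \<in> J \<Longrightarrow> f j \<in> coord_deg_le n i k) \<Longrightarrow> (\<Sum>j\<in>J. f j) \<in> coord_deg_le n i k"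
  by (induction J rule: infinite_finite_induct) (auto intro: coord_deg_le_add coord_deg_le_0)

lemma coord_deg_le_diff:
  "p \<in> coord_deg_le n i k \<Longrightarrow> q \<in> coord_deg_le n i k \<Longrightarrow> p - q \<in> coord_deg_le n i k"
  using coord_deg_le_add[of p n i k "mp_const (- 1) * q"] coord_deg_le_const_mult[of q n i k "- 1"] by simp

lemma coord_deg_le_sym_H_span:
  assumes "s \<in> sym_ring n" "deg_le i k s" "f \<in> H_span n"
  shows "s * f \<in> coord_deg_le n i k"
proof -
  have f: "f \<in> poly_ring n" using assms(3) by (rule H_span_poly_ring)
  have "s * f \<in> poly_ring n"
    using sym_ringD(1)[OF assms(1)] f unfolding poly_ring_eq_mpolys_in by (rule mpolys_in_mult)
  moreover have "deg_le i k (coord n (s * f) m)" if m: "m \<in> stairs n" for m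
  proof -
    have "coord n (s * f) m = s * mp_const (lookup f m)"
      by (simp only: coord_sym_mult[OF f assms(1) m] coord_H_span[OF assms(3) m])
    then show ?thesis
      using deg_le_const_mult[OF assms(2), of "lookup f m"] by (simp only: mult.commute[of s])
  qed
  ultimately show ?thesis by (simp add: coord_deg_le_def)
qed

lemma act_d_sym_mult: "act_d n (s * p) = sq_deriv s * p + s * act_d n p"
  by (simp add: act_d_def poly_deriv_mult algebra_simps)

text \<open>In coordinates, \<open>\<d>\<close> acts by the derivation on the symmetric coefficients up to terms that do
  not raise degrees, because \<open>H\<close> is stable. So if \<open>\<d>\<close> does not raise the degree in \<open>x\<^sub>i\<close>, this
  degree was not attained.\<close>

lemma coord_deg_le_descend:
  assumes p: "p \<in> coord_deg_le n i (Suc k)" and dp: "act_d n p \<in> coord_deg_le n i (Suc k)"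
  shows "p \<in> coord_deg_le n i k"
proof -
  define S where "S = coord n p"
  have pr: "p \<in> poly_ring n" using p by (simp add: coord_deg_le_def)
  have S: "S m \<in> sym_ring n" "deg_le i (Suc k) (S m)" if "m \<in> stairs n" for m
    using p that coord_sym[OF pr] by (auto simp: S_def coord_deg_le_def)
  have sum: "act_d n (\<Sum>m\<in>A. g m) = (\<Sum>m\<in>A. act_d n (g m))" for A and g :: "_ \<Rightarrow> 'a mpoly"
    using act_linear(2)[of n 0 0]
    by (induction A rule: infinite_finite_induct) (simp_all add: act_linear)
  define q where "q = (\<Sum>m\<in>stairs n. sq_deriv (S m) * xmon m)"
  define r where "r = (\<Sum>m\<in>stairs n. S m * act_d n (xmon m))"
  \<comment> \<open>By the Leibniz rule \<open>q\<close> collects the derivatives of the coefficients. As \<open>H\<close> is stable, \<open>r\<close> is a combination of the \<open>S m\<close> with constant coefficients.\<close>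
  have "act_d n p = act_d n (\<Sum>m\<in>stairs n. S m * xmon m)"
    using coord_expand[OF pr] by (simp add: S_def)
  then have "act_d n p = q + r" by (simp add: sum act_d_sym_mult q_def r_def sum.distrib)
  moreover have "r \<in> coord_deg_le n i (Suc k)"
    unfolding r_def using S by (intro coord_deg_le_sum coord_deg_le_sym_H_span act_d_H_span mono_H_span)
  ultimately have q: "q \<in> coord_deg_le n i (Suc k)"
    using coord_deg_le_diff[OF dp, of r] by simp
  have sym: "sq_deriv (S m) \<in> sym_ring n" if "m \<in> stairs n" for m
    using S(1)[OF that]
    by (intro poly_deriv_sym) (simp_all add: perm_poly_mult poly_ring_eq_mpolys_in mpolys_in_mult mpolys_in_var)
  have "deg_le i k (S m)" if m: "m \<in> stairs n" for m
  proof -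
    have "coord n q m = sq_deriv (S m)"
      using sym m by (intro coord_eqI) (simp_all add: q_def)
    moreover have "deg_le i (Suc k) (coord n q m)" using q m by (simp add: coord_deg_le_def)
    ultimately have "deg_le i (Suc k) (sq_deriv (S m))" by (simp only:)
    then show ?thesis by (rule deg_le_sq_derivD[OF S(2)[OF m]])
  qed
  then show ?thesis using pr by (simp add: coord_deg_le_def S_def)
qed

text \<open>A spanning list bounds the degree in \<open>x\<^sub>i\<close> of all coordinates of \<open>V\<close>. For \<open>a \<in> V\<close> and a staircase
  monomial \<open>x\<^sup>m\<close>, \<open>\<d> (a x\<^sup>m) = (\<d> a) x\<^sup>m + a (\<d> x\<^sup>m)\<close> satisfies the same bound, because \<open>\<d> a \<in> V\<close> and
  \<open>\<d> x\<^sup>m \<in> H\<close>. So a positive bound can be lowered.\<close>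

lemma fd_subrep_coord_deg_le_0:
  fixes V :: "'k::field_char_0 nh set"
  assumes "fd_sl2_subrep n V" "a \<in> V" "m \<in> stairs n"
  shows "nh_act a (xmon m) \<in> coord_deg_le n i 0"
proof -
  interpret ring "NH n :: 'k nh ring" by (rule NH_ring)
  interpret d: commutator_lift n "free_derivation d_gen" d_gen "act_d n :: 'k mpoly \<Rightarrow> _"
    by (rule commutator_lift_d)
  note K = nh_scalars_subfield[of n, where 'k = 'k]
  define B where "B k = {a \<in> carrier (NH n). \<forall>m\<in>stairs n. nh_act a (xmon m) \<in> (coord_deg_le n i k :: 'k mpoly set)}" for k
  have B_sub: "subalgebra (nh_scalars n) (B k) (NH n)" for k
    by (rule nh_subspaceI)
      (auto simp: B_def nh_act_zero nh_act_add nh_act_smult nh_scalar_carrier coord_deg_le_0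
        coord_deg_le_add coord_deg_le_const_mult)
  have mono: "B k \<subseteq> B l" if "k \<le> l" for k l
    using coord_deg_le_mono[OF that, of n i] unfolding B_def by blast
  have ex: "\<exists>k. a \<in> B k" if a: "a \<in> carrier (NH n)" for a
  proof -
    let ?c = "\<lambda>mm. coord n (nh_act a (xmon (fst mm))) (snd mm)"
    define k where "k mm = (SOME l. deg_le i l (?c mm))" for mm
    have k: "deg_le i (k mm) (?c mm)" for mm
      unfolding k_def by (rule someI_ex[OF ex_deg_le])
    have "finite (k ` (stairs n \<times> stairs n))" by (simp add: finite_stair)
    then obtain l where "\<forall>x\<in>k ` (stairs n \<times> stairs n). x \<le> l"
      using finite_nat_set_iff_bounded_le by blast
    then have "deg_le i l (?c mm)" if "mm \<in> stairs n \<times> stairs n" for mm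
      using that by (intro deg_le_mono[OF k]) blast
    then have "deg_le i l (coord n (nh_act a (xmon m)) m')" if "m \<in> stairs n" "m' \<in> stairs n" for m m'
      using that by (metis SigmaI fst_conv snd_conv)
    then have "a \<in> B l"
      using a nh_act_poly_ring[OF a stair_mono_poly_ring] by (simp add: B_def coord_deg_le_def)
    then show ?thesis ..
  qed
  have V: "subalgebra (nh_scalars n) V (NH n)" "finite_dimension (nh_scalars n) V" "nh_d n ` V \<subseteq> V"
    using assms(1) by (simp_all add: fd_sl2_subrep_def)
  \<comment> \<open>A bound exists for each operator; finitely many operators span \<open>V\<close>, so one bound serves all of \<open>V\<close>.\<close>
  obtain N Us where Us: "set Us \<subseteq> carrier (NH n)" "Span (nh_scalars n) Us = V"
    using exists_base[OF K] V(2) unfolding finite_dimension_def by blast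
  have "\<exists>k. set Us \<subseteq> B k"
    using Us(1)
  proof (induction Us)
    case (Cons u Us)
    then obtain k where k: "set Us \<subseteq> B k" by auto
    obtain l where l: "u \<in> B l" using ex[of u] Cons.prems by auto
    have "set (u # Us) \<subseteq> B (max k l)"
      using k l mono[of k "max k l"] mono[of l "max k l"] by auto
    then show ?case ..
  qed simp
  then obtain k where "set Us \<subseteq> B k" ..
  then have "V \<subseteq> B k" using subalgebra_Span_incl[OF K B_sub] Us(2) by blast
  then have "V \<subseteq> B 0"
  proof (induction k)
    case (Suc k)
    have "a \<in> B k" if a: "a \<in> V" for a
    proof -
      have aB: "a \<in> B (Suc k)" and dB: "nh_d n a \<in> B (Suc k)" using a Suc.prems V(3) by auto
      have ac: "a \<in> carrier (NH n)" using aB by (simp add: B_def)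
      have H: "nh_act a f \<in> coord_deg_le n i (Suc k)" if "f \<in> H_span n" for f
      proof -
        have "nh_act a f = (\<Sum>m\<in>stairs n. mp_const (lookup f m) * nh_act a (xmon m))"
          by (subst H_span_expand[OF that]) (simp add: nh_act_sum_right[OF ac] nh_act_const_mult[OF ac])
        then show ?thesis using aB by (simp add: B_def coord_deg_le_sum coord_deg_le_const_mult)
      qed
      have "nh_act a (xmon m) \<in> coord_deg_le n i k" if m: "m \<in> stairs n" for m
      proof (rule coord_deg_le_descend)
        show "nh_act a (xmon m) \<in> coord_deg_le n i (Suc k)" using aB m by (simp add: B_def)
        have "act_d n (nh_act a (xmon m)) = nh_act (nh_d n a) (xmon m) + nh_act a (act_d n (xmon m))"
          using d.induced_act[OF ac] by (simp add: nh_d_def)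
        also have "\<dots> \<in> coord_deg_le n i (Suc k)"
          using dB m by (intro coord_deg_le_add H act_d_H_span mono_H_span) (simp_all add: B_def)
        finally show "act_d n (nh_act a (xmon m)) \<in> coord_deg_le n i (Suc k)" .
      qed
      then show ?thesis using ac by (simp add: B_def)
    qed
    then show ?case using Suc.IH by blast
  qed
  then show ?thesis using assms(2,3) by (auto simp: B_def)
qed

lemma mpoly_const_if_deg_le_0:
  assumes "f \<in> poly_ring n" "\<And>i. i \<in> {1..n} \<Longrightarrow> deg_le i 0 f"
  shows "f = mp_const (lookup f 0)"
proof -
  have zero: "m = 0" if m: "m \<in> keys f" for m
  proof -
    have sub: "keys m \<subseteq> {1..n}" using assms(1) m by (simp add: poly_ring_def)
    have "i \<notin> keys m" if "i \<in> {1..n}" for i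
      using assms(2)[OF that] m by (simp add: deg_le_def in_keys_iff)
    then have "keys m \<inter> {1..n} = {}" by blast
    then have "keys m = {}" using sub by (simp only: Int_absorb2)
    then show ?thesis by (simp add: keys_eq_empty)
  qed
  have "lookup f m = lookup (mp_const (lookup f 0)) m" for m
  proof (cases "m = 0")
    case False
    then have "m \<notin> keys f" using zero by (rule contrapos_nn)
    then show ?thesis using False by (simp add: in_keys_iff mp_const_def lookup_single)
  qed (simp add: mp_const_def)
  then show ?thesis by (rule poly_mapping_eqI)
qed

lemma const_part_max: "is_max_fd_sl2_subrep n (const_part n)"
proof -
  have "V \<subseteq> const_part n" if V: "fd_sl2_subrep n V" for V :: "'a nh set"
  proof
    fix a assume a: "a \<in> V"
    have ac: "a \<in> carrier (NH n)"
    proof (rule subsetD[OF ring.subalgebra_in_carrier[OF NH_ring] a])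
      show "subalgebra (nh_scalars n) V (NH n)" using V by (simp add: fd_sl2_subrep_def)
    qed
    show "a \<in> const_part n"
    proof (rule const_partI[OF ac])
      fix m assume m: "m \<in> stairs n"
      let ?p = "nh_act a (xmon m)"
      have p: "?p \<in> poly_ring n" by (rule nh_act_poly_ring[OF ac stair_mono_poly_ring[OF m]])
      have c: "coord n ?p m' = mp_const (lookup (coord n ?p m') 0)" if m': "m' \<in> stairs n" for m'
      proof (rule mpoly_const_if_deg_le_0)
        show "coord n ?p m' \<in> poly_ring n" by (rule sym_ringD(1)[OF coord_sym[OF p m']])
        show "deg_le i 0 (coord n ?p m')" for i
          using fd_subrep_coord_deg_le_0[OF V a m, of i] m' by (simp add: coord_deg_le_def)
      qed
      have "?p = (\<Sum>m'\<in>stairs n. coord n ?p m' * xmon m')" by (rule coord_expand[OF p])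
      also have "\<dots> = (\<Sum>m'\<in>stairs n. mp_const (lookup (coord n ?p m') 0) * xmon m')"
        by (intro sum.cong refl arg_cong2[where f = "(*)"] c)
      also have "\<dots> \<in> H_span n" by (intro H_span_sum H_span_const_mult mono_H_span)
      finally show "?p \<in> H_span n" .
    qed
  qed
  moreover have "fd_sl2_subrep n (const_part n :: 'a nh set)"
    by (simp add: fd_sl2_subrep_def const_part_subspace const_part_finite_dimension const_part_stable)
  ultimately show ?thesis by (simp add: is_max_fd_sl2_subrep_def)
qed


section \<open>Homogeneous components\<close>

definition pm_restrict :: "('a \<Rightarrow> bool) \<Rightarrow> ('a \<Rightarrow>\<^sub>0 'b::comm_monoid_add) \<Rightarrow> 'a \<Rightarrow>\<^sub>0 'b" where
  "pm_restrict P f = (\<Sum>m\<in>keys f. if P m then single m (lookup f m) else 0)"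

lemma lookup_pm_restrict:
  fixes f :: "'a \<Rightarrow>\<^sub>0 'b::comm_monoid_add"
  shows "lookup (pm_restrict P f) m = (if P m then lookup f m else 0)"
proof -
  have "lookup (if P k then single k c else 0) m = (if k = m then if P m then c else 0 else 0)" for k and c :: 'b
    by (auto simp: lookup_single when_def)
  then have "lookup (pm_restrict P f) m
      = (\<Sum>k\<in>keys f. if k = m then if P m then lookup f k else 0 else 0)"
    by (simp only: pm_restrict_def lookup_sum)
  also have "\<dots> = (if m \<in> keys f then if P m then lookup f m else 0 else 0)"
    by (subst sum.delta) simp_all
  also have "\<dots> = (if P m then lookup f m else 0)" by (simp add: in_keys_iff)
  finally show ?thesis .
qed

lemma pm_restrict_add: "pm_restrict P (f + g) = pm_restrict P f + pm_restrict P g"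
  by (rule poly_mapping_eqI) (simp add: lookup_pm_restrict lookup_add)

lemma pm_restrict_0 [simp]: "pm_restrict P 0 = 0"
  by (rule poly_mapping_eqI) (simp add: lookup_pm_restrict)

lemma pm_restrict_uminus: "pm_restrict P (- f) = - pm_restrict P f"
  for f :: "'a \<Rightarrow>\<^sub>0 'b::ab_group_add"
  by (rule poly_mapping_eqI) (simp add: lookup_pm_restrict)

lemma pm_restrict_diff: "pm_restrict P (f - g) = pm_restrict P f - pm_restrict P g"
  for f :: "'a \<Rightarrow>\<^sub>0 'b::ab_group_add"
  using pm_restrict_add[of P f "- g"] by (simp add: pm_restrict_uminus)

lemma pm_restrict_single: "pm_restrict P (single m c) = (if P m then single m c else 0)"
  by (rule poly_mapping_eqI) (simp add: lookup_pm_restrict lookup_single when_def)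

lemma keys_pm_restrict: "keys (pm_restrict P f) = {m \<in> keys f. P m}"
  by (simp add: set_eq_iff in_keys_iff lookup_pm_restrict)

text \<open>The grading with variables in degree two.\<close>

definition mono_deg :: "(nat \<Rightarrow>\<^sub>0 nat) \<Rightarrow> int" where
  "mono_deg m = (\<Sum>i\<in>keys m. 2 * int (lookup m i))"

lemma mono_deg_add: "mono_deg (m + m') = mono_deg m + mono_deg m'"
  unfolding mono_deg_def by (rule setsum_keys_plus_distrib) simp_all

lemma mono_deg_single [simp]: "mono_deg (single i k) = 2 * int k"
  by (simp add: mono_deg_def)

lemma mono_deg_0 [simp]: "mono_deg 0 = 0"
  by (simp add: mono_deg_def)

lemma mono_deg_nonneg: "0 \<le> mono_deg m"
  unfolding mono_deg_def by (rule sum_nonneg) simp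

lemma mono_deg_pos: "m \<noteq> 0 \<Longrightarrow> 0 < mono_deg m"
proof -
  assume "m \<noteq> 0"
  then have "keys m \<noteq> {}" by (simp add: keys_eq_empty)
  then show ?thesis
    unfolding mono_deg_def by (intro sum_pos) (simp_all add: in_keys_iff)
qed

definition hom_part :: "int \<Rightarrow> 'k::field_char_0 mpoly \<Rightarrow> 'k mpoly" where
  "hom_part e = pm_restrict (\<lambda>m. mono_deg m = e)"

definition word_part :: "int \<Rightarrow> 'k::field_char_0 free_nh \<Rightarrow> 'k free_nh" where
  "word_part d = pm_restrict (\<lambda>w. word_deg w = d)"

lemma hom_part_add: "hom_part e (p + q) = hom_part e p + hom_part e q"
  by (simp add: hom_part_def pm_restrict_add)

lemma hom_part_diff: "hom_part e (p - q) = hom_part e p - hom_part e q"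
  by (simp add: hom_part_def pm_restrict_diff)

lemma hom_part_0 [simp]: "hom_part e 0 = 0"
  by (simp add: hom_part_def)

lemma hom_part_sum: "hom_part e (\<Sum>i\<in>I. f i) = (\<Sum>i\<in>I. hom_part e (f i))"
  by (induction I rule: infinite_finite_induct) (simp_all add: hom_part_add)

lemma hom_part_hom_part: "hom_part d (hom_part e p) = (if d = e then hom_part e p else 0)"
  by (rule poly_mapping_eqI) (simp add: hom_part_def lookup_pm_restrict)

lemma hom_part_mult_mono: "hom_part e (p * xmon m) = hom_part (e - mono_deg m) p * xmon m"
  using subset_UNIV[of "keys p"]
proof (induction p rule: poly_mapping_add_induct)
  case (single m' c)
  have "mono_deg (m' + m) = e \<longleftrightarrow> mono_deg m' = e - mono_deg m" by (auto simp: mono_deg_add)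
  then show ?case by (simp add: hom_part_def mult_single pm_restrict_single)
qed (simp_all add: hom_part_add distrib_right)

lemma hom_part_var_mult: "hom_part e (mp_var i * p) = mp_var i * hom_part (e - 2) p"
  using hom_part_mult_mono[of e p "single i 1"] by (simp add: mp_var_def mult.commute)

lemma hom_part_const: "hom_part e (mp_const c) = (if e = 0 then mp_const c else 0)"
  by (simp add: hom_part_def mp_const_def pm_restrict_single)

lemma hom_part_const_mult: "hom_part e (mp_const c * p) = mp_const c * hom_part e p"
  by (rule poly_mapping_eqI) (simp add: hom_part_def lookup_pm_restrict)

lemma hom_part_mono: "hom_part (mono_deg m) (xmon m) = xmon m"
  by (simp add: hom_part_def pm_restrict_single)

lemma hom_part_perm:
  assumes "bij \<sigma>"
  shows "perm_poly \<sigma> (hom_part e p) = hom_part e (perm_poly \<sigma> p)"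
  by (induction p arbitrary: e rule: mpoly_induct)
    (simp_all add: hom_part_const hom_part_var_mult hom_part_add perm_poly_add perm_poly_mult assms)

lemma hom_part_poly_ring: "p \<in> poly_ring n \<Longrightarrow> hom_part e p \<in> poly_ring n"
  by (simp add: poly_ring_def hom_part_def keys_pm_restrict)

lemma hom_part_sym: "s \<in> sym_ring n \<Longrightarrow> hom_part e s \<in> sym_ring n"
  by (simp add: sym_ring_def hom_part_poly_ring hom_part_perm permutes_bij)

lemma hom_part_divided_difference:
  "hom_part e (divided_difference i p) = divided_difference i (hom_part (e + 2) p)"
proof (rule divided_difference_eqI[symmetric])
  have "(mp_var i - mp_var (Suc i)) * hom_part e (divided_difference i p)
      = hom_part (e + 2) ((mp_var i - mp_var (Suc i)) * divided_difference i p)"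
    by (simp only: left_diff_distrib hom_part_diff hom_part_var_mult) simp
  also have "\<dots> = hom_part (e + 2) p - swap_poly i (hom_part (e + 2) p)"
    by (simp add: divided_difference_spec hom_part_diff hom_part_perm)
  finally show "(mp_var i - mp_var (Suc i)) * hom_part e (divided_difference i p)
      = hom_part (e + 2) p - swap_poly i (hom_part (e + 2) p)" .
qed

lemma gen_act_hom_part: "gen_act g (hom_part e p) = hom_part (e + gen_deg g) (gen_act g p)"
  by (cases g) (simp_all add: hom_part_var_mult hom_part_divided_difference)

lemma word_act_hom_part: "word_act (letters w) (hom_part e p) = hom_part (e + word_deg w) (word_act (letters w) p)"
proof (cases w)
  case (Word u)
  have "word_act u (hom_part e p) = hom_part (e + sum_list (map gen_deg u)) (word_act u p)"
    by (induction u) (simp_all add: gen_act_hom_part algebra_simps)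
  then show ?thesis by (simp add: Word word_deg_def)
qed

text \<open>The action is graded.\<close>

lemma free_act_word_part:
  "free_act (word_part d \<phi>) (hom_part e p) = hom_part (d + e) (free_act \<phi> (hom_part e p))"
  using subset_UNIV[of "keys \<phi>"]
proof (induction \<phi> rule: poly_mapping_add_induct)
  case (single w c)
  show ?case
    by (simp add: word_part_def pm_restrict_single free_act_single hom_part_const_mult
        word_act_hom_part hom_part_hom_part add.commute)
qed (simp_all add: word_part_def pm_restrict_add free_act_add hom_part_add)

lemma word_part_carrier: "\<phi> \<in> carrier (free_alg n) \<Longrightarrow> word_part d \<phi> \<in> carrier (free_alg n)"
  by (simp add: free_alg_carrier_iff word_part_def keys_pm_restrict)

lemma word_part_homogeneous:
  "\<phi> \<in> carrier (free_alg n) \<Longrightarrow> nh_class n (word_part d \<phi>) \<in> nh_homogeneous n d"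
  unfolding nh_homogeneous_def using word_part_carrier[of \<phi> n d]
  by (intro imageI) (simp add: word_part_def keys_pm_restrict)

lemma sum_word_part:
  "(\<Sum>d\<in>word_deg ` keys \<phi>. word_part d \<phi>) = \<phi>"
proof (rule poly_mapping_eqI)
  fix w
  have "lookup (\<Sum>d\<in>word_deg ` keys \<phi>. word_part d \<phi>) w
      = (\<Sum>d\<in>word_deg ` keys \<phi>. if word_deg w = d then lookup \<phi> w else 0)"
    by (simp add: lookup_sum word_part_def lookup_pm_restrict)
  also have "\<dots> = (if word_deg w \<in> word_deg ` keys \<phi> then lookup \<phi> w else 0)"
    by (subst sum.delta') simp_all
  also have "\<dots> = lookup \<phi> w"
    by (cases "w \<in> keys \<phi>") (simp_all add: in_keys_iff)
  finally show "lookup (\<Sum>d\<in>word_deg ` keys \<phi>. word_part d \<phi>) w = lookup \<phi> w" .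
qed

lemma nh_act_word_part_mono:
  assumes "\<phi> \<in> carrier (free_alg n)"
  shows "nh_act (nh_class n (word_part d \<phi>)) (xmon m) = hom_part (d + mono_deg m) (nh_act (nh_class n \<phi>) (xmon m))"
  using free_act_word_part[of d \<phi> "mono_deg m" "xmon m"]
  by (simp add: hom_part_mono nh_act_class assms word_part_carrier)

lemma coord_hom_part:
  assumes "p \<in> poly_ring n" "m \<in> stairs n"
  shows "coord n (hom_part e p) m = hom_part (e - mono_deg m) (coord n p m)"
proof (rule coord_eqI[OF _ _ assms(2)])
  have "hom_part e p = hom_part e (\<Sum>m\<in>stairs n. coord n p m * xmon m)"
    by (rule arg_cong[OF coord_expand[OF assms(1)]])
  then show "hom_part e p = (\<Sum>m\<in>stairs n. hom_part (e - mono_deg m) (coord n p m) * xmon m)"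
    by (simp only: hom_part_sum hom_part_mult_mono)
qed (use assms(1) in \<open>simp add: hom_part_sym coord_sym\<close>)


section \<open>The graded Jacobson radical\<close>

lemma lookup_mp_const_0: "lookup (mp_const c) 0 = c"
  by (simp add: mp_const_def)

lemma lookup_mult_0: "lookup (f * g) 0 = lookup f 0 * lookup g 0"
  for f g :: "'k::field_char_0 mpoly"
  using subset_UNIV[of "keys f"]
proof (induction f rule: poly_mapping_add_induct)
  case (single m c)
  show ?case
    using subset_UNIV[of "keys g"]
  proof (induction g rule: poly_mapping_add_induct)
    case (single m' c')
    have "m = 0 \<and> m' = 0" if "m + m' = 0"
    proof -
      have "lookup m i + lookup m' i = 0" for i
        using arg_cong[OF that, of "\<lambda>x. lookup x i"] by (simp add: lookup_add)
      then have "m = 0" "m' = 0" by (auto intro!: poly_mapping_eqI)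
      then show ?thesis by simp
    qed
    then show ?case by (auto simp: mult_single lookup_single when_def)
  qed (simp_all add: distrib_left lookup_add)
qed (simp_all add: distrib_right lookup_add)

text \<open>The submodule of polynomials all of whose coordinates have constant term zero, which is
  generated by the symmetric polynomials of positive degree.\<close>

definition sym_plus_span :: "nat \<Rightarrow> 'k::field_char_0 mpoly set" where
  "sym_plus_span n = {p \<in> poly_ring n. \<forall>m\<in>stairs n. lookup (coord n p m) 0 = 0}"

lemma sym_plus_span_0: "0 \<in> sym_plus_span n"
  by (simp add: sym_plus_span_def poly_ring_0 coord_H_span[OF H_span_0])

lemma sym_plus_span_add: "p \<in> sym_plus_span n \<Longrightarrow> q \<in> sym_plus_span n \<Longrightarrow> p + q \<in> sym_plus_span n"
  by (simp add: sym_plus_span_def coord_add lookup_add) (simp add: poly_ring_eq_mpolys_in mpolys_in_add)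

lemma poly_ring_sym_mult: "(s :: 'k::field_char_0 mpoly) \<in> sym_ring n \<Longrightarrow> p \<in> poly_ring n \<Longrightarrow> s * p \<in> poly_ring n"
  using sym_ringD(1)[of s n] by (simp add: poly_ring_eq_mpolys_in mpolys_in_mult)

lemma sym_plus_span_sym_mult: "s \<in> sym_ring n \<Longrightarrow> p \<in> sym_plus_span n \<Longrightarrow> s * p \<in> sym_plus_span n"
  by (simp add: sym_plus_span_def coord_sym_mult lookup_mult_0 poly_ring_sym_mult)

lemma sym_plus_mult_span:
  "s \<in> sym_ring n \<Longrightarrow> lookup s 0 = 0 \<Longrightarrow> p \<in> poly_ring n \<Longrightarrow> s * p \<in> sym_plus_span n"
  by (simp add: sym_plus_span_def coord_sym_mult lookup_mult_0 poly_ring_sym_mult)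

lemma sym_plus_span_uminus: "p \<in> sym_plus_span n \<Longrightarrow> - p \<in> sym_plus_span n"
  using sym_plus_span_sym_mult[OF sym_ring_const[of "- 1"], of p n] by simp

lemma sym_plus_span_sum:
  "(\<And>i. i \<in> I \<Longrightarrow> f i \<in> sym_plus_span n) \<Longrightarrow> (\<Sum>i\<in>I. f i) \<in> sym_plus_span n"
  by (induction I rule: infinite_finite_induct) (auto intro: sym_plus_span_add sym_plus_span_0)

lemma sym_plus_span_hom_part: "p \<in> sym_plus_span n \<Longrightarrow> hom_part e p \<in> sym_plus_span n"
  by (simp add: sym_plus_span_def hom_part_poly_ring coord_hom_part) (simp add: hom_part_def lookup_pm_restrict)

lemma sym_plus_span_nh_act:
  assumes "a \<in> carrier (NH n)" "p \<in> sym_plus_span n"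
  shows "nh_act a p \<in> sym_plus_span n"
proof -
  have p: "p \<in> poly_ring n" using assms(2) by (simp add: sym_plus_span_def)
  have "coord n p m * nh_act a (xmon m) \<in> sym_plus_span n" if m: "m \<in> stairs n" for m
    using assms m by (intro sym_plus_mult_span coord_sym[OF p] nh_act_poly_ring stair_mono_poly_ring)
      (simp_all add: sym_plus_span_def)
  then show ?thesis
    unfolding nh_act_coords[OF assms(1) p] by (rule sym_plus_span_sum)
qed

text \<open>The left annihilator of the class of \<open>x\<^sup>m\<close> modulo the positive symmetric polynomials.\<close>

definition stair_annihilator :: "nat \<Rightarrow> (nat \<Rightarrow>\<^sub>0 nat) \<Rightarrow> 'k::field_char_0 nh set" where
  "stair_annihilator n m = {a \<in> carrier (NH n). nh_act a (xmon m) \<in> sym_plus_span n}"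

definition radical_part :: "nat \<Rightarrow> 'k::field_char_0 nh set" where
  "radical_part n = {a \<in> carrier (NH n). \<forall>m\<in>stairs n. nh_act a (xmon m) \<in> sym_plus_span n}"

lemma nh_class_uminus:
  fixes \<phi> :: "'k::field_char_0 free_nh"
  assumes "\<phi> \<in> carrier (free_alg n)"
  shows "\<ominus>\<^bsub>NH n\<^esub> nh_class n \<phi> = nh_class n (- \<phi>)"
proof -
  interpret ring "NH n :: 'k nh ring" by (rule NH_ring)
  show ?thesis
    by (rule NH_eq_actI[where n = n])
      (use assms in \<open>simp_all add: nh_class_carrier free_alg_uminus nh_act_a_inv nh_act_class free_act_uminus\<close>)
qed

lemma nh_additive_subgroupI:
  fixes U :: "'k::field_char_0 nh set"
  assumes "U \<subseteq> carrier (NH n)" "\<zero>\<^bsub>NH n\<^esub> \<in> U"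
    and "\<And>a b. a \<in> U \<Longrightarrow> b \<in> U \<Longrightarrow> a \<oplus>\<^bsub>NH n\<^esub> b \<in> U" "\<And>a. a \<in> U \<Longrightarrow> \<ominus>\<^bsub>NH n\<^esub> a \<in> U"
  shows "additive_subgroup U (NH n)"
proof -
  interpret ring "NH n :: 'k nh ring" by (rule NH_ring)
  show ?thesis using assms by (intro additive_subgroupI add.subgroupI) auto
qed

lemma stair_annihilator_additive: "additive_subgroup (stair_annihilator n m :: 'k::field_char_0 nh set) (NH n)"
proof -
  interpret ring "NH n :: 'k nh ring" by (rule NH_ring)
  show ?thesis
    by (rule nh_additive_subgroupI)
      (auto simp: stair_annihilator_def nh_act_zero nh_act_add nh_act_a_inv
        intro: sym_plus_span_0 sym_plus_span_add sym_plus_span_uminus)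
qed

lemma radical_part_additive: "additive_subgroup (radical_part n :: 'k::field_char_0 nh set) (NH n)"
proof -
  interpret ring "NH n :: 'k nh ring" by (rule NH_ring)
  show ?thesis
    by (rule nh_additive_subgroupI)
      (auto simp: radical_part_def nh_act_zero nh_act_add nh_act_a_inv
        intro: sym_plus_span_0 sym_plus_span_add sym_plus_span_uminus)
qed

lemma radical_part_ideal: "ideal (radical_part n :: 'k::field_char_0 nh set) (NH n)"
proof (rule idealI[OF NH_ring])
  interpret ring "NH n :: 'k nh ring" by (rule NH_ring)
  show "subgroup (radical_part n :: 'k nh set) (add_monoid (NH n))"
    by (rule additive_subgroup.a_subgroup[OF radical_part_additive])
  fix a r :: "'k nh" assume a: "a \<in> radical_part n" and r: "r \<in> carrier (NH n)"
  then have ac: "a \<in> carrier (NH n)" by (simp add: radical_part_def)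
  show "r \<otimes>\<^bsub>NH n\<^esub> a \<in> radical_part n"
    using a r by (simp add: radical_part_def nh_act_mult sym_plus_span_nh_act)
  have "nh_act (a \<otimes>\<^bsub>NH n\<^esub> r) (xmon m) \<in> sym_plus_span n" if m: "m \<in> stairs n" for m
  proof -
    let ?p = "nh_act r (xmon m)"
    have p: "?p \<in> poly_ring n" by (rule nh_act_poly_ring[OF r stair_mono_poly_ring[OF m]])
    have "nh_act a ?p \<in> sym_plus_span n"
      unfolding nh_act_coords[OF ac p]
      using a by (intro sym_plus_span_sum sym_plus_span_sym_mult coord_sym[OF p]) (simp_all add: radical_part_def)
    then show ?thesis using ac r by (simp add: nh_act_mult)
  qed
  then show "a \<otimes>\<^bsub>NH n\<^esub> r \<in> radical_part n" using ac r by (simp add: radical_part_def)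
qed

text \<open>An additive subgroup that contains the homogeneous components of its elements is generated by
  homogeneous elements, because every element is the finite sum of its components.\<close>

lemma generate_homogeneous_eq:
  fixes U :: "'k::field_char_0 nh set"
  assumes U: "additive_subgroup U (NH n)"
    and part: "\<And>\<phi> d. \<phi> \<in> carrier (free_alg n) \<Longrightarrow> nh_class n \<phi> \<in> U \<Longrightarrow> nh_class n (word_part d \<phi>) \<in> U"
  shows "generate (add_monoid (NH n)) (U \<inter> (\<Union>d. nh_homogeneous n d)) = U"
proof
  interpret ring "NH n :: 'k nh ring" by (rule NH_ring)
  let ?G = "generate (add_monoid (NH n)) (U \<inter> (\<Union>d. nh_homogeneous n d))"
  show "?G \<subseteq> U"
    by (rule add.generate_subgroup_incl[OF _ additive_subgroup.a_subgroup[OF U]]) blast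
  show "U \<subseteq> ?G"
  proof
    fix a assume a: "a \<in> U"
    have "a \<in> carrier (NH n)" using additive_subgroup.a_subset[OF U] a by blast
    then obtain \<phi> where \<phi>: "\<phi> \<in> carrier (free_alg n)" "a = nh_class n \<phi>" by (rule NH_carrierE)
    have car: "(\<Sum>d\<in>D. word_part d \<phi>) \<in> carrier (free_alg n)" for D
      by (induction D rule: infinite_finite_induct) (simp_all add: free_alg_add word_part_carrier \<phi>)
    have "nh_class n (\<Sum>d\<in>D. word_part d \<phi>) \<in> ?G" for D
    proof (induction D rule: infinite_finite_induct)
      case (insert d D)
      have "nh_class n (word_part d \<phi>) \<in> ?G"
        using part[OF \<phi>(1)] word_part_homogeneous[OF \<phi>(1)] a \<phi>(2) by (intro generate.incl) blast
      from generate.eng[OF this insert.IH] show ?case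
        using insert.hyps by (simp add: nh_class_add car word_part_carrier \<phi>)
    qed (use generate.one[of "add_monoid (NH n :: 'k nh ring)"] in \<open>simp_all add: nh_class_zero\<close>)
    from this[of "word_deg ` keys \<phi>"] show "a \<in> ?G" by (simp only: sum_word_part \<phi>(2))
  qed
qed

lemma stair_annihilator_graded: "graded_left_ideal (NH n) (nh_homogeneous n) (stair_annihilator n m)"
  unfolding graded_left_ideal_def
proof (intro conjI ballI stair_annihilator_additive generate_homogeneous_eq)
  interpret ring "NH n :: 'a nh ring" by (rule NH_ring)
  show "r \<otimes>\<^bsub>NH n\<^esub> a \<in> stair_annihilator n m"
    if "r \<in> carrier (NH n)" "a \<in> stair_annihilator n m" for r a :: "'a nh"
    using that by (simp add: stair_annihilator_def nh_act_mult sym_plus_span_nh_act)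
  show "nh_class n (word_part d \<phi>) \<in> stair_annihilator n m"
    if "\<phi> \<in> carrier (free_alg n)" "nh_class n \<phi> \<in> stair_annihilator n m" for \<phi> :: "'a free_nh" and d
    using that
    by (simp add: stair_annihilator_def nh_act_word_part_mono sym_plus_span_hom_part nh_class_carrier word_part_carrier)
qed

text \<open>Modulo the positive symmetric polynomials, the nilHecke algebra acts on \<open>H\<close> by all matrices.
  So an element that does not kill \<open>x\<^sup>m\<close> there has a left multiple that fixes it.\<close>

lemma stair_annihilator_maximal:
  assumes m: "m \<in> stairs n"
  shows "maximal_graded_left_ideal (NH n) (nh_homogeneous n) (stair_annihilator n m :: 'k::field_char_0 nh set)"
  unfolding maximal_graded_left_ideal_def
proof (intro conjI allI impI stair_annihilator_graded)
  interpret ring "NH n :: 'k nh ring" by (rule NH_ring)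
  let ?L = "stair_annihilator n m :: 'k nh set"
  have "xmon m \<notin> (sym_plus_span n :: 'k mpoly set)"
    using m by (auto simp: sym_plus_span_def coord_mono)
  then have "\<one>\<^bsub>NH n\<^esub> \<notin> ?L" by (simp add: stair_annihilator_def nh_act_one)
  then show "?L \<noteq> carrier (NH n)" using one_closed by blast
  fix L assume L: "graded_left_ideal (NH n) (nh_homogeneous n) L \<and> ?L \<subseteq> L"
  have Lc: "L \<subseteq> carrier (NH n)" and Ladd: "additive_subgroup L (NH n)"
    and Lmult: "\<And>r a. r \<in> carrier (NH n) \<Longrightarrow> a \<in> L \<Longrightarrow> r \<otimes>\<^bsub>NH n\<^esub> a \<in> L"
    using L additive_subgroup.a_subset unfolding graded_left_ideal_def by blast+
  show "L = ?L \<or> L = carrier (NH n)"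
  proof (cases "L \<subseteq> ?L")
    case False
    then obtain a where a: "a \<in> L" "a \<notin> ?L" by blast
    then have ac: "a \<in> carrier (NH n)" using Lc by blast
    let ?p = "nh_act a (xmon m)"
    have p: "?p \<in> poly_ring n" by (rule nh_act_poly_ring[OF ac stair_mono_poly_ring[OF m]])
    have "?p \<notin> sym_plus_span n" using a(2) ac by (simp add: stair_annihilator_def)
    then obtain m' where m': "m' \<in> stairs n" "lookup (coord n ?p m') 0 \<noteq> 0"
      using p by (auto simp: sym_plus_span_def)
    define \<gamma> where "\<gamma> = lookup (coord n ?p m') 0"
    \<comment> \<open>A scaled matrix unit that carries \<open>x\<^bsup>m'\<^esup>\<close> back to \<open>x\<^sup>m\<close>.\<close>
    let ?F = "\<lambda>k. if k = m' then mp_const (inverse \<gamma>) * xmon m else (0 :: 'k mpoly)"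
    have "mp_const (inverse \<gamma>) * xmon m \<in> (poly_ring n :: 'k mpoly set)"
      by (intro H_span_poly_ring H_span_const_mult mono_H_span m)
    then have F: "?F k \<in> poly_ring n" for k by (simp add: poly_ring_0)
    obtain b where b: "b \<in> carrier (NH n)"
      "\<And>p. p \<in> poly_ring n \<Longrightarrow> nh_act b p = (\<Sum>k\<in>stairs n. coord n p k * ?F k)"
      using NH_elt_exists[of n ?F] F by blast
    let ?ba = "b \<otimes>\<^bsub>NH n\<^esub> a"
    define s where "s = 1 - coord n ?p m' * mp_const (inverse \<gamma>)"
    have s: "s \<in> sym_ring n" "lookup s 0 = 0"
      using m'(2) coord_sym[OF p m'(1)]
      by (simp_all add: s_def sym_ring_diff sym_ring_1 sym_ring_mult sym_ring_const lookup_minus lookup_mult_0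
          lookup_mp_const_0 \<gamma>_def)
    have "nh_act b ?p = (\<Sum>k\<in>stairs n. if k = m' then coord n ?p k * (mp_const (inverse \<gamma>) * xmon m) else 0)"
      unfolding b(2)[OF p] by (intro sum.cong refl) simp
    also have "\<dots> = coord n ?p m' * (mp_const (inverse \<gamma>) * xmon m)"
      using m'(1) by (simp add: finite_stair)
    finally have "nh_act (\<one>\<^bsub>NH n\<^esub> \<ominus>\<^bsub>NH n\<^esub> ?ba) (xmon m) = s * xmon m"
      using b(1) ac by (simp add: a_minus_def nh_act_add nh_act_one nh_act_a_inv nh_act_mult s_def algebra_simps)
    then have "\<one>\<^bsub>NH n\<^esub> \<ominus>\<^bsub>NH n\<^esub> ?ba \<in> ?L"
      using b(1) ac sym_plus_mult_span[OF s stair_mono_poly_ring[OF m]] by (simp add: stair_annihilator_def)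
    then have 1: "\<one>\<^bsub>NH n\<^esub> \<ominus>\<^bsub>NH n\<^esub> ?ba \<in> L" using L by blast
    have "(\<one>\<^bsub>NH n\<^esub> \<ominus>\<^bsub>NH n\<^esub> ?ba) \<oplus>\<^bsub>NH n\<^esub> ?ba \<in> L"
      by (rule additive_subgroup.a_closed[OF Ladd 1 Lmult[OF b(1) a(1)]])
    moreover have "(\<one>\<^bsub>NH n\<^esub> \<ominus>\<^bsub>NH n\<^esub> ?ba) \<oplus>\<^bsub>NH n\<^esub> ?ba = \<one>\<^bsub>NH n\<^esub>"
      using b(1) ac by (simp add: a_minus_def a_assoc l_neg)
    ultimately have "\<one>\<^bsub>NH n\<^esub> \<in> L" by simp
    then have "carrier (NH n) \<subseteq> L" using Lmult[of _ "\<one>\<^bsub>NH n\<^esub>"] by force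
    then show ?thesis using Lc by blast
  qed (use L in blast)
qed

lemma Jac_NH_subset: "Jac_NH n \<subseteq> radical_part n"
proof
  fix a :: "'a nh" assume "a \<in> Jac_NH n"
  then have ac: "a \<in> carrier (NH n)"
    and L: "\<And>L. maximal_graded_left_ideal (NH n) (nh_homogeneous n) L \<Longrightarrow> a \<in> L"
    by (auto simp: Jac_NH_def graded_jacobson_radical_def)
  have "a \<in> stair_annihilator n m" if "m \<in> stairs n" for m
    using that by (intro L stair_annihilator_maximal)
  then show "a \<in> radical_part n" using ac by (simp add: stair_annihilator_def radical_part_def)
qed

text \<open>The component of degree zero of an element is taken in a representative. Generation by
  homogeneous elements gives a representative for which it stays in \<open>L\<close>.\<close>

lemma graded_left_ideal_part_0:
  fixes L :: "'k::field_char_0 nh set"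
  assumes L: "graded_left_ideal (NH n) (nh_homogeneous n) L" and l: "l \<in> L"
  shows "\<exists>\<phi>\<in>carrier (free_alg n). l = nh_class n \<phi> \<and> nh_class n (word_part 0 \<phi>) \<in> L"
proof -
  interpret ring "NH n :: 'k nh ring" by (rule NH_ring)
  have Ladd: "additive_subgroup L (NH n)" using L by (simp add: graded_left_ideal_def)
  interpret L: additive_subgroup L "NH n" by (rule Ladd)
  have zero: "nh_class n 0 \<in> L" using L.zero_closed by (simp add: nh_class_zero)
  have part: "\<exists>\<phi>\<in>carrier (free_alg n). h = nh_class n \<phi> \<and> nh_class n (word_part 0 \<phi>) \<in> L"
    if h: "h \<in> L \<inter> (\<Union>d. nh_homogeneous n d)" for h
  proof -
    obtain d f where f: "f \<in> carrier (free_alg n)" "\<forall>w\<in>keys f. word_deg w = d" "h = nh_class n f"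
      using h by (auto simp: nh_homogeneous_def)
    have "word_part 0 f = (if d = 0 then f else 0)"
    proof (rule poly_mapping_eqI)
      fix w
      show "lookup (word_part 0 f) w = lookup (if d = 0 then f else 0) w"
        using f(2) by (cases "w \<in> keys f") (simp_all add: word_part_def lookup_pm_restrict in_keys_iff)
    qed
    then have "nh_class n (word_part 0 f) \<in> L" using h f(3) zero by simp
    then show ?thesis using f by blast
  qed
  have "l \<in> generate (add_monoid (NH n)) (L \<inter> (\<Union>d. nh_homogeneous n d))"
    using L l by (simp add: graded_left_ideal_def)
  then show ?thesis
  proof (induction rule: generate.induct)
    case one
    show ?case using zero by (intro bexI[of _ 0]) (simp_all add: nh_class_zero word_part_def)
  next
    case (incl h)
    then show ?case by (rule part)
  next
    case (inv h)
    from part[OF inv] obtain \<phi> where \<phi>: "\<phi> \<in> carrier (free_alg n)" "h = nh_class n \<phi>"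
      "nh_class n (word_part 0 \<phi>) \<in> L" by blast
    have "nh_class n (word_part 0 (- \<phi>)) \<in> L"
      using L.a_inv_closed[OF \<phi>(3)] \<phi>(1)
      by (simp add: nh_class_uminus word_part_carrier) (simp add: word_part_def pm_restrict_uminus)
    moreover have "inv\<^bsub>add_monoid (NH n)\<^esub> h = nh_class n (- \<phi>)"
      using nh_class_uminus[OF \<phi>(1)] by (simp only: \<phi>(2) a_inv_def)
    ultimately show ?case using free_alg_uminus[OF \<phi>(1)] by (intro bexI[of _ "- \<phi>"] conjI)
  next
    case (eng h1 h2)
    then obtain \<phi> \<psi> where "\<phi> \<in> carrier (free_alg n)" "h1 = nh_class n \<phi>" "nh_class n (word_part 0 \<phi>) \<in> L"
      "\<psi> \<in> carrier (free_alg n)" "h2 = nh_class n \<psi>" "nh_class n (word_part 0 \<psi>) \<in> L" by blast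
    then show ?case
      using L.a_closed[of "nh_class n (word_part 0 \<phi>)" "nh_class n (word_part 0 \<psi>)"]
      by (intro bexI[of _ "\<phi> + \<psi>"])
        (simp_all add: free_alg_add nh_class_add word_part_carrier, simp add: word_part_def pm_restrict_add)
  qed
qed

text \<open>A radical element of degree zero strictly lowers the degree of the monomials that occur, since
  its coefficients have positive degree. Hence it is nilpotent.\<close>

definition stair_deg_less :: "nat \<Rightarrow> nat \<Rightarrow> 'k::field_char_0 mpoly set" where
  "stair_deg_less n k = {p \<in> poly_ring n. \<forall>m\<in>stairs n. coord n p m \<noteq> 0 \<longrightarrow> mono_deg m < int k}"

lemma radical_part_degree_0_lowers:
  assumes j: "j \<in> radical_part n"
    and deg: "\<And>m. m \<in> stairs n \<Longrightarrow> hom_part (mono_deg m) (nh_act j (xmon m)) = nh_act j (xmon m)"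
    and p: "p \<in> stair_deg_less n (Suc k)"
  shows "nh_act j p \<in> stair_deg_less n k"
proof -
  have jc: "j \<in> carrier (NH n)" using j by (simp add: radical_part_def)
  have pr: "p \<in> poly_ring n" using p by (simp add: stair_deg_less_def)
  have q: "nh_act j (xmon m) \<in> poly_ring n" if "m \<in> stairs n" for m
    using that by (intro nh_act_poly_ring[OF jc] stair_mono_poly_ring)
  have low: "mono_deg m' < mono_deg m"
    if m: "m \<in> stairs n" "m' \<in> stairs n" and nz: "coord n (nh_act j (xmon m)) m' \<noteq> 0" for m m'
  proof -
    define c where "c = coord n (nh_act j (xmon m)) m'"
    have "c = hom_part (mono_deg m - mono_deg m') c"
      using coord_hom_part[OF q[OF m(1)] m(2), of "mono_deg m"] deg[OF m(1)] by (simp add: c_def)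
    moreover obtain k where k: "lookup c k \<noteq> 0"
    proof -
      have "c \<noteq> 0" using nz by (simp only: c_def not_False_eq_True)
      then have "keys c \<noteq> {}" by (simp add: keys_eq_empty)
      then show ?thesis using that by (auto simp only: in_keys_iff)
    qed
    ultimately have "lookup (hom_part (mono_deg m - mono_deg m') c) k \<noteq> 0" by simp
    then have "mono_deg k = mono_deg m - mono_deg m'"
      by (simp add: hom_part_def lookup_pm_restrict split: if_splits)
    moreover have "k \<noteq> 0"
    proof
      assume "k = 0"
      moreover have "lookup c 0 = 0"
        using j m by (simp add: c_def radical_part_def sym_plus_span_def)
      ultimately show False using k by simp
    qed
    ultimately show ?thesis using mono_deg_pos[of k] by simp
  qed
  have "coord n (nh_act j p) m' = (\<Sum>m\<in>stairs n. coord n p m * coord n (nh_act j (xmon m)) m')" if m': "m' \<in> stairs n" for m'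
  proof -
    have "coord n (\<Sum>m\<in>A. coord n p m * nh_act j (xmon m)) m' = (\<Sum>m\<in>A. coord n p m * coord n (nh_act j (xmon m)) m')
        \<and> (\<Sum>m\<in>A. coord n p m * nh_act j (xmon m)) \<in> poly_ring n" if "A \<subseteq> stairs n" for A
      using finite_subset[OF that finite_stair] that
    proof (induction A rule: finite_induct)
      case empty
      show ?case using coord_H_span[OF H_span_0 m'] by (simp add: poly_ring_0)
    next
      case (insert m A)
      then have m: "m \<in> stairs n" by simp
      have t: "coord n p m * nh_act j (xmon m) \<in> poly_ring n"
        by (rule poly_ring_sym_mult[OF coord_sym[OF pr m] q[OF m]])
      show ?case
        using insert t m'
        by (simp add: coord_add coord_sym_mult[OF q[OF m] coord_sym[OF pr m]] poly_ring_eq_mpolys_in mpolys_in_add)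
    qed
    then show ?thesis unfolding nh_act_coords[OF jc pr] by blast
  qed
  moreover have "mono_deg m' < int k" if m': "m' \<in> stairs n" and nz: "(\<Sum>m\<in>stairs n. coord n p m * coord n (nh_act j (xmon m)) m') \<noteq> 0" for m'
  proof -
    obtain m where m: "m \<in> stairs n" "coord n p m * coord n (nh_act j (xmon m)) m' \<noteq> 0"
      using nz by (rule sum.not_neutral_contains_not_neutral)
    then have "coord n p m \<noteq> 0" "coord n (nh_act j (xmon m)) m' \<noteq> 0" by simp_all
    then have "mono_deg m < int (Suc k)" "mono_deg m' < mono_deg m"
      using p m(1) m' by (simp_all add: stair_deg_less_def low)
    then show ?thesis by simp
  qed
  ultimately show ?thesis
    using nh_act_poly_ring[OF jc pr] by (simp add: stair_deg_less_def)
qed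

text \<open>Graded Nakayama argument. Passing to components of degree zero, \<open>1 = l + j\<close> with \<open>l \<in> L\<close> and \<open>j\<close> a
  nilpotent element of the radical. Multiplication by \<open>j\<^sup>i\<close> gives \<open>j\<^sup>i = j\<^sup>i l + j\<^bsup>i+1\<^esup>\<close>, hence \<open>1 \<in> L + j\<^sup>i\<close>
  for every \<open>i\<close>.\<close>

lemma one_in_graded_left_ideal:
  fixes L :: "'k::field_char_0 nh set"
  assumes L: "graded_left_ideal (NH n) (nh_homogeneous n) L"
    and l: "l \<in> L" and j: "j \<in> radical_part n" and one: "\<one>\<^bsub>NH n\<^esub> = l \<oplus>\<^bsub>NH n\<^esub> j"
  shows "\<one>\<^bsub>NH n\<^esub> \<in> L"
proof -
  interpret ring "NH n :: 'k nh ring" by (rule NH_ring)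
  have Ladd: "additive_subgroup L (NH n)" and Lmult: "\<And>r a. r \<in> carrier (NH n) \<Longrightarrow> a \<in> L \<Longrightarrow> r \<otimes>\<^bsub>NH n\<^esub> a \<in> L"
    using L by (simp_all add: graded_left_ideal_def)
  interpret L: additive_subgroup L "NH n" by (rule Ladd)
  obtain \<phi> where \<phi>: "\<phi> \<in> carrier (free_alg n)" "l = nh_class n \<phi>" "nh_class n (word_part 0 \<phi>) \<in> L"
    using graded_left_ideal_part_0[OF L l] by blast
  have "j \<in> carrier (NH n)" using j by (simp add: radical_part_def)
  then obtain \<psi> where \<psi>: "\<psi> \<in> carrier (free_alg n)" "j = nh_class n \<psi>" by (rule NH_carrierE)
  define l0 where "l0 = nh_class n (word_part 0 \<phi>)"
  define j0 where "j0 = nh_class n (word_part 0 \<psi>)"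
  have l0: "l0 \<in> L" "l0 \<in> carrier (NH n)" and j0c: "j0 \<in> carrier (NH n)"
    using \<phi> \<psi> by (simp_all add: l0_def j0_def nh_class_carrier word_part_carrier)
  have j0_act: "nh_act j0 (xmon m) = hom_part (mono_deg m) (nh_act j (xmon m))" for m
    using nh_act_word_part_mono[OF \<psi>(1), of 0 m] by (simp add: j0_def \<psi>(2))
  have j0: "j0 \<in> radical_part n"
    using j j0c by (simp add: radical_part_def j0_act sym_plus_span_hom_part)
  have one0: "\<one>\<^bsub>NH n\<^esub> = l0 \<oplus>\<^bsub>NH n\<^esub> j0"
  proof (rule NH_eqI)
    fix m assume m: "m \<in> stairs n"
    have "xmon m = nh_act l (xmon m) + nh_act j (xmon m)"
      using arg_cong[OF one, of "\<lambda>a. nh_act a (xmon m)"] \<phi> \<psi>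
      by (simp add: nh_act_one nh_act_add nh_class_carrier)
    then have "hom_part (mono_deg m) (xmon m)
        = hom_part (mono_deg m) (nh_act l (xmon m)) + hom_part (mono_deg m) (nh_act j (xmon m))"
      by (metis hom_part_add)
    moreover have "nh_act l0 (xmon m) = hom_part (mono_deg m) (nh_act l (xmon m))"
      using nh_act_word_part_mono[OF \<phi>(1), of 0 m] by (simp add: l0_def \<phi>(2))
    ultimately show "nh_act \<one>\<^bsub>NH n\<^esub> (xmon m) = nh_act (l0 \<oplus>\<^bsub>NH n\<^esub> j0) (xmon m)"
      using l0 j0c by (simp add: nh_act_one nh_act_add hom_part_mono j0_act)
  qed (use l0 j0c in simp_all)
  have pow: "\<exists>l'\<in>L. \<one>\<^bsub>NH n\<^esub> = l' \<oplus>\<^bsub>NH n\<^esub> j0 [^]\<^bsub>NH n\<^esub> i" for i :: nat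
  proof (induction i)
    case 0
    show ?case by (rule bexI[of _ "\<zero>\<^bsub>NH n\<^esub>"]) simp_all
  next
    case (Suc i)
    then obtain l' where l': "l' \<in> L" "\<one>\<^bsub>NH n\<^esub> = l' \<oplus>\<^bsub>NH n\<^esub> j0 [^]\<^bsub>NH n\<^esub> i" by blast
    let ?P = "j0 [^]\<^bsub>NH n\<^esub> i"
    have P: "?P \<in> carrier (NH n)" using j0c by simp
    have l'c: "l' \<in> carrier (NH n)" using l'(1) by (rule L.a_Hcarr)
    have "?P = ?P \<otimes>\<^bsub>NH n\<^esub> (l0 \<oplus>\<^bsub>NH n\<^esub> j0)" using P by (simp flip: one0)
    also have "\<dots> = ?P \<otimes>\<^bsub>NH n\<^esub> l0 \<oplus>\<^bsub>NH n\<^esub> ?P \<otimes>\<^bsub>NH n\<^esub> j0" using P l0 j0c by (simp add: r_distr)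
    finally have "l' \<oplus>\<^bsub>NH n\<^esub> ?P = l' \<oplus>\<^bsub>NH n\<^esub> (?P \<otimes>\<^bsub>NH n\<^esub> l0 \<oplus>\<^bsub>NH n\<^esub> ?P \<otimes>\<^bsub>NH n\<^esub> j0)" by simp
    also have "\<dots> = (l' \<oplus>\<^bsub>NH n\<^esub> ?P \<otimes>\<^bsub>NH n\<^esub> l0) \<oplus>\<^bsub>NH n\<^esub> j0 [^]\<^bsub>NH n\<^esub> Suc i"
      using P l0 j0c l'c by (simp add: a_assoc)
    finally show ?case
      using l' L.a_closed[OF l'(1) Lmult[OF P l0(1)]] by (intro bexI[of _ "l' \<oplus>\<^bsub>NH n\<^esub> ?P \<otimes>\<^bsub>NH n\<^esub> l0"]) simp_all
  qed
  have lower: "nh_act (j0 [^]\<^bsub>NH n\<^esub> i) p \<in> stair_deg_less n k" if "p \<in> stair_deg_less n (k + i)" for i k p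
    using that
  proof (induction i arbitrary: k p)
    case 0
    then show ?case by (simp add: nh_act_one)
  next
    case (Suc i)
    have "nh_act j0 p \<in> stair_deg_less n (k + i)"
      using Suc.prems by (intro radical_part_degree_0_lowers[OF j0]) (simp_all add: j0_act hom_part_hom_part)
    then have "nh_act (j0 [^]\<^bsub>NH n\<^esub> i) (nh_act j0 p) \<in> stair_deg_less n k" by (rule Suc.IH)
    then show ?case using j0c by (simp add: nh_act_mult)
  qed
  (* One more than the largest degree of a staircase monomial. *)
  define N where "N = nat (Max (insert 0 (mono_deg ` stairs n))) + 1"
  have N: "mono_deg m < int N" if "m \<in> stairs n" for m
  proof -
    have "mono_deg m \<le> Max (insert 0 (mono_deg ` stairs n))"
      using that finite_stair[of n n] by (intro Max_ge) auto
    then show ?thesis by (simp add: N_def)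
  qed
  have "j0 [^]\<^bsub>NH n\<^esub> N = \<zero>\<^bsub>NH n\<^esub>"
  proof (rule NH_eqI)
    fix m assume m: "m \<in> stairs n"
    have "xmon m \<in> stair_deg_less n (0 + N)"
      using m N by (simp add: stair_deg_less_def stair_mono_poly_ring)
    then have q: "nh_act (j0 [^]\<^bsub>NH n\<^esub> N) (xmon m) \<in> stair_deg_less n 0" (is "?q \<in> _") by (rule lower)
    have "coord n ?q m' = 0" if "m' \<in> stairs n" for m'
    proof (rule ccontr)
      assume "coord n ?q m' \<noteq> 0"
      then have "mono_deg m' < int 0" using q that by (simp add: stair_deg_less_def)
      then show False using mono_deg_nonneg[of m'] by simp
    qed
    moreover have "?q \<in> poly_ring n" using q by (simp add: stair_deg_less_def)
    ultimately have "?q = 0" using coord_expand[of ?q n] by simp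
    then show "?q = nh_act \<zero>\<^bsub>NH n\<^esub> (xmon m)" by (simp add: nh_act_zero)
  qed (use j0c in simp_all)
  then show ?thesis using pow[of N] L.a_Hcarr by auto
qed

lemma radical_part_generated:
  "generate (add_monoid (NH n)) (radical_part n \<inter> (\<Union>d. nh_homogeneous n d)) = (radical_part n :: 'k::field_char_0 nh set)"
  by (rule generate_homogeneous_eq[OF radical_part_additive])
    (simp add: radical_part_def nh_act_word_part_mono sym_plus_span_hom_part nh_class_carrier word_part_carrier)

text \<open>If a maximal graded left ideal \<open>L\<close> did not contain the radical part, their sum would be everything.\<close>

lemma radical_part_subset: "radical_part n \<subseteq> (Jac_NH n :: 'k::field_char_0 nh set)"
proof -
  interpret ring "NH n :: 'k nh ring" by (rule NH_ring)
  let ?J = "radical_part n :: 'k nh set"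
  have "?J \<subseteq> L" if max: "maximal_graded_left_ideal (NH n) (nh_homogeneous n) L" for L
  proof (rule ccontr)
    assume not: "\<not> ?J \<subseteq> L"
    have gL: "graded_left_ideal (NH n) (nh_homogeneous n) L" and ne: "L \<noteq> carrier (NH n)"
      using max by (simp_all add: maximal_graded_left_ideal_def)
    have Ladd: "additive_subgroup L (NH n)" and Lmult: "\<And>r a. r \<in> carrier (NH n) \<Longrightarrow> a \<in> L \<Longrightarrow> r \<otimes>\<^bsub>NH n\<^esub> a \<in> L"
      and Lgen: "generate (add_monoid (NH n)) (L \<inter> (\<Union>d. nh_homogeneous n d)) = L"
      using gL by (simp_all add: graded_left_ideal_def)
    interpret L: additive_subgroup L "NH n" by (rule Ladd)
    interpret J: ideal ?J "NH n" by (rule radical_part_ideal)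
    define K where "K = L <+>\<^bsub>NH n\<^esub> ?J"
    have K: "K = {l \<oplus>\<^bsub>NH n\<^esub> j |l j. l \<in> L \<and> j \<in> ?J}"
      by (auto simp: K_def set_add_def')
    then have KI: "l \<oplus>\<^bsub>NH n\<^esub> j \<in> K" if "l \<in> L" "j \<in> ?J" for l j
      using that by blast
    have Kadd: "additive_subgroup K (NH n)"
      unfolding K_def by (rule add_additive_subgroups[OF Ladd radical_part_additive])
    have zero: "\<zero>\<^bsub>NH n\<^esub> \<in> L" "\<zero>\<^bsub>NH n\<^esub> \<in> ?J"
      using L.zero_closed additive_subgroup.zero_closed[OF radical_part_additive] by simp_all
    have LK: "L \<subseteq> K"
    proof
      fix l assume l: "l \<in> L"
      show "l \<in> K" using KI[OF l zero(2)] by (simp only: r_zero[OF L.a_Hcarr[OF l]])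
    qed
    have JK: "?J \<subseteq> K"
    proof
      fix j assume j: "j \<in> ?J"
      show "j \<in> K" using KI[OF zero(1) j] by (simp only: l_zero[OF J.a_Hcarr[OF j]])
    qed
    note Jgen = radical_part_generated[of n, where 'k = 'k]
    have "generate (add_monoid (NH n)) (K \<inter> (\<Union>d. nh_homogeneous n d)) = K" (is "?G = K")
    proof
      show "?G \<subseteq> K"
        by (rule add.generate_subgroup_incl[OF Int_lower1 additive_subgroup.a_subgroup[OF Kadd]])
      have "generate (add_monoid (NH n)) (L \<inter> (\<Union>d. nh_homogeneous n d)) \<subseteq> ?G"
        by (rule add.mono_generate[OF Int_mono[OF LK subset_refl]])
      then have LG: "L \<subseteq> ?G" by (simp only: Lgen)
      have "generate (add_monoid (NH n)) (?J \<inter> (\<Union>d. nh_homogeneous n d)) \<subseteq> ?G"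
        by (rule add.mono_generate[OF Int_mono[OF JK subset_refl]])
      then have JG: "?J \<subseteq> ?G" by (simp only: Jgen)
      show "K \<subseteq> ?G"
      proof
        fix a assume "a \<in> K"
        then obtain l j where lj: "a = l \<oplus>\<^bsub>NH n\<^esub> j" "l \<in> L" "j \<in> ?J" unfolding K by blast
        have "l \<otimes>\<^bsub>add_monoid (NH n)\<^esub> j \<in> ?G"
          by (rule generate.eng[OF subsetD[OF LG lj(2)] subsetD[OF JG lj(3)]])
        then show "a \<in> ?G" by (simp only: lj(1) monoid.simps)
      qed
    qed
    moreover have "r \<otimes>\<^bsub>NH n\<^esub> a \<in> K" if r: "r \<in> carrier (NH n)" and a: "a \<in> K" for r a
    proof -
      obtain l j where lj: "a = l \<oplus>\<^bsub>NH n\<^esub> j" "l \<in> L" "j \<in> ?J" using a unfolding K by blast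
      then have "r \<otimes>\<^bsub>NH n\<^esub> a = r \<otimes>\<^bsub>NH n\<^esub> l \<oplus>\<^bsub>NH n\<^esub> r \<otimes>\<^bsub>NH n\<^esub> j"
        using r L.a_Hcarr[OF lj(2)] J.a_Hcarr[OF lj(3)] by (simp only: r_distr)
      then show ?thesis using KI[OF Lmult[OF r lj(2)] J.I_l_closed[OF lj(3) r]] by (simp only:)
    qed
    ultimately have "graded_left_ideal (NH n) (nh_homogeneous n) K"
      using Kadd by (simp add: graded_left_ideal_def)
    then have "K = L \<or> K = carrier (NH n)"
      using max LK by (simp add: maximal_graded_left_ideal_def)
    then have "K = carrier (NH n)" using JK not by blast
    then have "\<one>\<^bsub>NH n\<^esub> \<in> K" by simp
    then obtain l j where "\<one>\<^bsub>NH n\<^esub> = l \<oplus>\<^bsub>NH n\<^esub> j" "l \<in> L" "j \<in> ?J" unfolding K by blast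
    then have "\<one>\<^bsub>NH n\<^esub> \<in> L" using one_in_graded_left_ideal[OF gL] by blast
    then have "carrier (NH n) \<subseteq> L" using Lmult[of _ "\<one>\<^bsub>NH n\<^esub>"] by force
    then show False using ne L.a_subset by blast
  qed
  moreover have "?J \<subseteq> carrier (NH n)" by (rule additive_subgroup.a_subset[OF radical_part_additive])
  ultimately show ?thesis
    unfolding Jac_NH_def graded_jacobson_radical_def
    by (intro Int_greatest Inter_greatest) (simp_all only: mem_Collect_eq)
qed

lemma Jac_NH_eq: "Jac_NH n = radical_part n"
  using Jac_NH_subset radical_part_subset by blast


section \<open>The semisimplification\<close>

text \<open>The coordinates of such an element are constants with constant term zero.\<close>

lemma const_part_radical_part:
  fixes a :: "'k::field_char_0 nh"
  assumes "a \<in> const_part n" "a \<in> radical_part n"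
  shows "a = \<zero>\<^bsub>NH n\<^esub>"
proof (rule NH_eqI)
  interpret ring "NH n :: 'k nh ring" by (rule NH_ring)
  show "a \<in> carrier (NH n)" using assms by (simp add: const_part_def)
  show "\<zero>\<^bsub>NH n\<^esub> \<in> carrier (NH n :: 'k nh ring)" by (rule zero_closed)
  fix m assume m: "m \<in> stairs n"
  let ?p = "nh_act a (xmon m)"
  have H: "?p \<in> H_span n" using assms(1) by (simp add: const_part_def mono_H_span[OF m])
  have "lookup ?p m' = 0" if m': "m' \<in> stairs n" for m'
  proof -
    have "lookup (coord n ?p m') 0 = 0"
      using assms(2) m m' by (simp add: radical_part_def sym_plus_span_def)
    then show ?thesis by (simp add: coord_H_span[OF H m'] lookup_mp_const_0)
  qed
  then have "?p = 0" using H_span_expand[OF H] by simp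
  then show "?p = nh_act \<zero>\<^bsub>NH n\<^esub> (xmon m)" by (simp add: nh_act_zero)
qed

text \<open>Reducing the coordinates to their constant terms splits the projection.\<close>

lemma const_part_complement:
  fixes a :: "'k::field_char_0 nh"
  assumes a: "a \<in> carrier (NH n)"
  shows "\<exists>c\<in>const_part n. a \<ominus>\<^bsub>NH n\<^esub> c \<in> radical_part n"
proof -
  interpret ring "NH n :: 'k nh ring" by (rule NH_ring)
  define F where "F m = (\<Sum>m'\<in>stairs n. mp_const (lookup (coord n (nh_act a (xmon m)) m') 0) * (xmon m' :: 'k mpoly))" for m
  have F: "F m \<in> H_span n" for m
    unfolding F_def by (intro H_span_sum H_span_const_mult mono_H_span)
  obtain c where c: "c \<in> carrier (NH n)" "\<And>m. m \<in> stairs n \<Longrightarrow> nh_act c (xmon m) = F m"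
    using NH_elt_exists_mono[of n F] H_span_poly_ring[OF F] by blast
  have "c \<in> const_part n" using c F by (intro const_partI) simp_all
  moreover have "a \<ominus>\<^bsub>NH n\<^esub> c \<in> radical_part n"
  proof -
    have "nh_act (a \<ominus>\<^bsub>NH n\<^esub> c) (xmon m) \<in> sym_plus_span n" if m: "m \<in> stairs n" for m
    proof -
      let ?p = "nh_act a (xmon m)"
      have p: "?p \<in> poly_ring n" by (rule nh_act_poly_ring[OF a stair_mono_poly_ring[OF m]])
      define s where "s m' = coord n ?p m' - mp_const (lookup (coord n ?p m') 0)" for m'
      have "nh_act (a \<ominus>\<^bsub>NH n\<^esub> c) (xmon m) = ?p - F m"
        using a c m by (simp add: a_minus_def nh_act_add nh_act_a_inv)
      also have "\<dots> = (\<Sum>m'\<in>stairs n. coord n ?p m' * xmon m') - F m"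
        using coord_expand[OF p] by simp
      also have "\<dots> = (\<Sum>m'\<in>stairs n. s m' * xmon m')"
        by (simp only: F_def s_def left_diff_distrib sum_subtractf)
      also have "\<dots> \<in> sym_plus_span n"
        by (intro sym_plus_span_sum sym_plus_mult_span stair_mono_poly_ring)
          (simp_all add: s_def sym_ring_diff coord_sym[OF p] sym_ring_const lookup_minus lookup_mp_const_0)
      finally show ?thesis .
    qed
    then show ?thesis using a c(1) by (simp add: radical_part_def)
  qed
  ultimately show ?thesis by blast
qed

lemma const_part_iso_semisimplification:
  "(\<lambda>a. Jac_NH n +>\<^bsub>NH n\<^esub> a)
    \<in> ring_iso ((NH n)\<lparr>carrier := const_part n :: 'k::field_char_0 nh set\<rparr>) (NH n Quot Jac_NH n)"
proof -
  interpret ring "NH n :: 'k nh ring" by (rule NH_ring)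
  let ?J = "radical_part n :: 'k nh set" and ?M = "const_part n :: 'k nh set"
  let ?h = "\<lambda>a. ?J +>\<^bsub>NH n\<^esub> a"
  have id: "ideal ?J (NH n)" by (rule radical_part_ideal)
  have hom: "?h \<in> Ring.ring_hom (NH n) (NH n Quot ?J)" by (rule ideal.rcos_ring_hom[OF id])
  have M: "?M \<subseteq> carrier (NH n)" by (auto simp: const_part_def)
  have sub: "subring ?M (NH n)" by (rule const_part_subring)
  have "?h \<in> ring_iso ((NH n)\<lparr>carrier := ?M\<rparr>) (NH n Quot ?J)"
  proof (rule ring_iso_memI)
    show "bij_betw ?h (carrier ((NH n)\<lparr>carrier := ?M\<rparr>)) (carrier (NH n Quot ?J))"
    proof (rule bij_betw_imageI)
      show "inj_on ?h (carrier ((NH n)\<lparr>carrier := ?M\<rparr>))"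
      proof (rule inj_onI)
        fix a c assume ac: "a \<in> carrier ((NH n)\<lparr>carrier := ?M\<rparr>)" "c \<in> carrier ((NH n)\<lparr>carrier := ?M\<rparr>)"
          and eq: "?h a = ?h c"
        then have aM: "a \<in> ?M" "c \<in> ?M" and acar: "a \<in> carrier (NH n)" "c \<in> carrier (NH n)" using M by auto
        have "a \<ominus>\<^bsub>NH n\<^esub> c \<in> ?J"
          using eq quotient_eq_iff_same_a_r_cos[OF id acar] by simp
        moreover have "a \<ominus>\<^bsub>NH n\<^esub> c \<in> ?M"
          unfolding a_minus_def by (rule subringE(7)[OF sub aM(1) subringE(5)[OF sub aM(2)]])
        ultimately have "a \<ominus>\<^bsub>NH n\<^esub> c = \<zero>\<^bsub>NH n\<^esub>" by (intro const_part_radical_part)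
        then show "a = c" using acar by (simp add: r_right_minus_eq)
      qed
      show "?h ` carrier ((NH n)\<lparr>carrier := ?M\<rparr>) = carrier (NH n Quot ?J)"
      proof
        show "?h ` carrier ((NH n)\<lparr>carrier := ?M\<rparr>) \<subseteq> carrier (NH n Quot ?J)"
          using ring_hom_closed[OF hom] M by auto
        show "carrier (NH n Quot ?J) \<subseteq> ?h ` carrier ((NH n)\<lparr>carrier := ?M\<rparr>)"
        proof
          fix X assume "X \<in> carrier (NH n Quot ?J)"
          then obtain a where a: "a \<in> carrier (NH n)" "X = ?h a"
            unfolding FactRing_def A_RCOSETS_def' by auto
          obtain c where c: "c \<in> ?M" "a \<ominus>\<^bsub>NH n\<^esub> c \<in> ?J" using const_part_complement[OF a(1)] by blast
          then have "?h a = ?h c" using M quotient_eq_iff_same_a_r_cos[OF id a(1)] by blast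
          then show "X \<in> ?h ` carrier ((NH n)\<lparr>carrier := ?M\<rparr>)" using a c by simp
        qed
      qed
    qed
    fix x y assume "x \<in> carrier ((NH n)\<lparr>carrier := ?M\<rparr>)" "y \<in> carrier ((NH n)\<lparr>carrier := ?M\<rparr>)"
    then have xy: "x \<in> carrier (NH n)" "y \<in> carrier (NH n)" using M by auto
    show "?h x \<in> carrier (NH n Quot ?J)" by (rule ring_hom_closed[OF hom xy(1)])
    show "?h (x \<otimes>\<^bsub>(NH n)\<lparr>carrier := ?M\<rparr>\<^esub> y) = ?h x \<otimes>\<^bsub>NH n Quot ?J\<^esub> ?h y"
      using ring_hom_mult[OF hom xy] by simp
    show "?h (x \<oplus>\<^bsub>(NH n)\<lparr>carrier := ?M\<rparr>\<^esub> y) = ?h x \<oplus>\<^bsub>NH n Quot ?J\<^esub> ?h y"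
      using ring_hom_add[OF hom xy] by simp
  next
    show "?h \<one>\<^bsub>(NH n)\<lparr>carrier := ?M\<rparr>\<^esub> = \<one>\<^bsub>NH n Quot ?J\<^esub>"
      using ring_hom_one[OF hom] by simp
  qed
  then show ?thesis by (simp only: Jac_NH_eq)
qed


lemma mp_const_sum: "mp_const (\<Sum>i\<in>I. f i) = (\<Sum>i\<in>I. mp_const (f i))"
  for f :: "'a \<Rightarrow> 'k::field_char_0"
  by (induction I rule: infinite_finite_induct) simp_all

section \<open>Matrices with respect to a basis of the staircase span\<close>

locale H_basis =
  fixes n :: nat and b :: "nat \<Rightarrow> 'k::field_char_0 mpoly"
  assumes basis: "is_basis_of_H n b"
begin

lemma b_H_span: "j < fact n \<Longrightarrow> b j \<in> H_span n"
  using basis by (simp add: is_basis_of_H_def)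

lemma b_poly_ring: "j < fact n \<Longrightarrow> b j \<in> poly_ring n"
  by (intro H_span_poly_ring b_H_span)

definition vec_of :: "'k mpoly \<Rightarrow> nat \<Rightarrow> 'k" where
  "vec_of f j = (THE c. c \<in> carrier_vec (fact n) \<and> f = (\<Sum>j<fact n. mp_const (c $ j) * b j)) $ j"

lemma vec_of_expand: "f \<in> H_span n \<Longrightarrow> f = (\<Sum>j<fact n. mp_const (vec_of f j) * b j)"
proof -
  assume "f \<in> H_span n"
  then have "\<exists>!c. c \<in> carrier_vec (fact n) \<and> f = (\<Sum>j<fact n. mp_const (c $ j) * b j)"
    using basis by (simp add: is_basis_of_H_def)
  from theI'[OF this] show ?thesis unfolding vec_of_def by blast
qed

lemma b_const_unique:
  assumes "f \<in> H_span n" "f = (\<Sum>j<fact n. mp_const (x j) * b j)" "f = (\<Sum>j<fact n. mp_const (y j) * b j)" "i < fact n"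
  shows "x i = y i"
proof -
  have "\<exists>!c. c \<in> carrier_vec (fact n) \<and> f = (\<Sum>j<fact n. mp_const (c $ j) * b j)"
    using basis assms(1) by (simp add: is_basis_of_H_def)
  then obtain c where c: "\<And>d. d \<in> carrier_vec (fact n) \<and> f = (\<Sum>j<fact n. mp_const (d $ j) * b j) \<Longrightarrow> d = c"
    by (rule ex1E) blast
  have "vec (fact n) z = c" if "f = (\<Sum>j<fact n. mp_const (z j) * b j)" for z
  proof (rule c[OF conjI[OF vec_carrier]])
    show "f = (\<Sum>j<fact n. mp_const (vec (fact n) z $ j) * b j)"
      by (rule trans[OF that]) (intro sum.cong refl, simp)
  qed
  from this[OF assms(2)] this[OF assms(3)] have "vec (fact n) x = vec (fact n) y" by simp
  then have "vec (fact n) x $ i = vec (fact n) y $ i" by simp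
  then show ?thesis using assms(4) by simp
qed

text \<open>The base changes between \<open>b\<close> and the staircase monomials are inverse to each other. In this way
  spanning and independence over the symmetric polynomials pass from the monomials to \<open>b\<close>.\<close>

lemma base_change_inverse:
  assumes "j < fact n" "i < fact n"
  shows "(\<Sum>m\<in>stairs n. lookup (b j) m * vec_of (xmon m) i) = (if i = j then 1 else 0)"
proof (rule b_const_unique[OF b_H_span[OF assms(1)] _ _ assms(2)])
  have "b j = (\<Sum>m\<in>stairs n. mp_const (lookup (b j) m) * xmon m)"
    by (rule H_span_expand[OF b_H_span[OF assms(1)]])
  also have "\<dots> = (\<Sum>m\<in>stairs n. mp_const (lookup (b j) m) * (\<Sum>i<fact n. mp_const (vec_of (xmon m) i) * b i))"
    by (intro sum.cong refl arg_cong2[where f = "(*)"] vec_of_expand mono_H_span)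
  also have "\<dots> = (\<Sum>i<fact n. \<Sum>m\<in>stairs n. mp_const (lookup (b j) m * vec_of (xmon m) i) * b i)"
    by (subst sum.swap) (simp add: sum_distrib_left mult.assoc)
  also have "\<dots> = (\<Sum>i<fact n. mp_const (\<Sum>m\<in>stairs n. lookup (b j) m * vec_of (xmon m) i) * b i)"
    by (simp only: mp_const_sum sum_distrib_right)
  finally show "b j = (\<Sum>i<fact n. mp_const (\<Sum>m\<in>stairs n. lookup (b j) m * vec_of (xmon m) i) * b i)" .
  have "(\<Sum>i<fact n. mp_const (if i = j then 1 else 0) * b i) = (\<Sum>i<fact n. if i = j then b i else 0)"
    by (intro sum.cong refl) simp
  then show "b j = (\<Sum>i<fact n. mp_const (if i = j then 1 else 0) * b i)"
    using assms(1) by simp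
qed

lemma b_span:
  assumes p: "p \<in> poly_ring n"
  shows "\<exists>S. (\<forall>j<fact n. S j \<in> sym_ring n) \<and> p = (\<Sum>j<fact n. S j * b j)"
proof (intro exI conjI allI impI)
  let ?S = "\<lambda>j. \<Sum>m\<in>stairs n. coord n p m * mp_const (vec_of (xmon m) j)"
  show "?S j \<in> sym_ring n" for j
    by (intro sym_ring_sum sym_ring_mult sym_ring_const coord_sym[OF p])
  have "p = (\<Sum>m\<in>stairs n. coord n p m * xmon m)" by (rule coord_expand[OF p])
  also have "\<dots> = (\<Sum>m\<in>stairs n. coord n p m * (\<Sum>j<fact n. mp_const (vec_of (xmon m) j) * b j))"
    by (intro sum.cong refl arg_cong2[where f = "(*)"] vec_of_expand mono_H_span)
  also have "\<dots> = (\<Sum>j<fact n. ?S j * b j)"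
    by (simp only: sum_distrib_left sum_distrib_right mult.assoc) (rule sum.swap)
  finally show "p = (\<Sum>j<fact n. ?S j * b j)" .
qed

lemma b_independent:
  assumes S: "\<And>j. j < fact n \<Longrightarrow> S j \<in> sym_ring n" and zero: "(\<Sum>j<fact n. S j * b j) = 0" and i: "i < fact n"
  shows "S i = 0"
proof -
  let ?\<beta> = "\<lambda>j m. mp_const (lookup (b j) m)"
  have coords: "(\<Sum>j<fact n. S j * ?\<beta> j m) = 0" if m: "m \<in> stairs n" for m
  proof -
    have "0 = (\<Sum>j<fact n. S j * (\<Sum>m\<in>stairs n. ?\<beta> j m * xmon m))"
      unfolding zero[symmetric]
      by (intro sum.cong refl arg_cong2[where f = "(*)"] H_span_expand b_H_span) simp
    also have "\<dots> = (\<Sum>m\<in>stairs n. (\<Sum>j<fact n. S j * ?\<beta> j m) * xmon m)"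
      by (simp only: sum_distrib_left sum_distrib_right mult.assoc) (rule sum.swap)
    finally show ?thesis
      using m S by (intro stair_independent[of n n "\<lambda>m. \<Sum>j<fact n. S j * ?\<beta> j m"] sym_ring_sum sym_ring_mult sym_ring_const) simp_all
  qed
  have "S i = (\<Sum>j<fact n. if i = j then S j else 0)" using i by simp
  also have "\<dots> = (\<Sum>j<fact n. S j * mp_const (if i = j then 1 else 0))"
    by (intro sum.cong refl) simp
  also have "\<dots> = (\<Sum>j<fact n. S j * mp_const (\<Sum>m\<in>stairs n. lookup (b j) m * vec_of (xmon m) i))"
    by (intro sum.cong refl) (simp only: base_change_inverse[OF _ i] lessThan_iff)
  also have "\<dots> = (\<Sum>j<fact n. \<Sum>m\<in>stairs n. mp_const (vec_of (xmon m) i) * (S j * ?\<beta> j m))"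
    by (simp only: mp_const_sum mp_const_simps(4) sum_distrib_left)
      (intro sum.cong refl, simp only: mult_ac)
  also have "\<dots> = (\<Sum>m\<in>stairs n. mp_const (vec_of (xmon m) i) * (\<Sum>j<fact n. S j * ?\<beta> j m))"
    by (subst sum.swap) (simp only: sum_distrib_left)
  also have "\<dots> = 0" by (simp add: coords)
  finally show ?thesis .
qed

abbreviation is_matrix_of :: "'k nh \<Rightarrow> 'k mpoly mat \<Rightarrow> bool" where
  "is_matrix_of a A \<equiv> A \<in> carrier (sym_matrix_ring n) \<and>
     (\<forall>j<fact n. nh_act a (b j) = (\<Sum>i<fact n. A $$ (i, j) * b i))"

lemma sym_matrix_carrier_iff:
  "A \<in> carrier (sym_matrix_ring n :: 'k mpoly mat ring) \<longleftrightarrow>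
    A \<in> carrier_mat (fact n) (fact n) \<and> (\<forall>i<fact n. \<forall>j<fact n. A $$ (i, j) \<in> sym_ring n)"
proof -
  have "elements_mat A \<subseteq> sym_ring n \<longleftrightarrow> (\<forall>i<fact n. \<forall>j<fact n. A $$ (i, j) \<in> sym_ring n)"
    if A: "A \<in> carrier_mat (fact n) (fact n)"
  proof (intro iffI allI impI)
    fix i j :: nat assume "elements_mat A \<subseteq> sym_ring n" "i < fact n" "j < fact n"
    then show "A $$ (i, j) \<in> sym_ring n" using elements_matI[OF A _ _ refl, of i j] by blast
  next
    assume sym: "\<forall>i<fact n. \<forall>j<fact n. A $$ (i, j) \<in> sym_ring n"
    show "elements_mat A \<subseteq> sym_ring n"
    proof
      fix x assume "x \<in> elements_mat A"
      then obtain i j where "i < dim_row A" "j < dim_col A" "x = A $$ (i, j)" using elements_matD by blast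
      then show "x \<in> sym_ring n" using sym A by simp
    qed
  qed
  then show ?thesis by (auto simp: sym_matrix_ring_def)
qed

lemma sym_matrix_ring_ops [simp]:
  "monoid.mult (sym_matrix_ring n :: 'k mpoly mat ring) = (*)"
  "one (sym_matrix_ring n :: 'k mpoly mat ring) = 1\<^sub>m (fact n)"
  "add (sym_matrix_ring n :: 'k mpoly mat ring) = (+)"
  by (simp_all add: sym_matrix_ring_def ring_mat_def)

lemma nh_matrix_eqI:
  assumes "is_matrix_of a A"
  shows "nh_matrix n b a = A"
  unfolding nh_matrix_def
proof (rule the_equality)
  show "is_matrix_of a A" by (rule assms)
  fix B assume B: "is_matrix_of a B"
  show "B = A"
  proof (rule eq_matI)
    fix i j assume "i < dim_row A" "j < dim_col A"
    then have ij: "i < fact n" "j < fact n" using assms by (auto simp: sym_matrix_carrier_iff)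
    have "B $$ (i, j) - A $$ (i, j) = 0"
    proof (rule b_independent[of "\<lambda>i. B $$ (i, j) - A $$ (i, j)"])
      show "(\<Sum>i<fact n. (B $$ (i, j) - A $$ (i, j)) * b i) = 0"
        using assms B ij(2) by (simp add: left_diff_distrib sum_subtractf)
    qed (use assms B ij in \<open>simp_all add: sym_matrix_carrier_iff sym_ring_diff\<close>)
    then show "B $$ (i, j) = A $$ (i, j)" by simp
  qed (use assms B in \<open>auto simp: sym_matrix_carrier_iff\<close>)
qed

lemma nh_matrix_spec:
  assumes a: "a \<in> carrier (NH n)"
  shows "is_matrix_of a (nh_matrix n b a)"
proof -
  define S where "S j = (SOME S. (\<forall>i<fact n. S i \<in> sym_ring n) \<and> nh_act a (b j) = (\<Sum>i<fact n. S i * b i))" for j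
  have S: "(\<forall>i<fact n. S j i \<in> sym_ring n) \<and> nh_act a (b j) = (\<Sum>i<fact n. S j i * b i)" if "j < fact n" for j
    unfolding S_def by (rule someI_ex[OF b_span[OF nh_act_poly_ring[OF a b_poly_ring[OF that]]]])
  define A where "A = mat (fact n) (fact n) (\<lambda>(i, j). S j i)"
  have A: "is_matrix_of a A"
    using S by (simp add: sym_matrix_carrier_iff A_def)
  show ?thesis unfolding nh_matrix_eqI[OF A] by (rule A)
qed

lemma nh_act_b_expand:
  assumes "a \<in> carrier (NH n)" "\<And>j. j < fact n \<Longrightarrow> S j \<in> sym_ring n"
  shows "nh_act a (\<Sum>j<fact n. S j * b j) = (\<Sum>j<fact n. S j * nh_act a (b j))"
  unfolding nh_act_sum_right[OF assms(1)]
  by (intro sum.cong refl nh_act_sym_mult[OF assms(1)] assms(2)) simp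

lemma nh_matrix_surj:
  assumes A: "A \<in> carrier (sym_matrix_ring n)"
  shows "\<exists>a\<in>carrier (NH n). is_matrix_of a A"
proof -
  define B where "B j = (\<Sum>i<fact n. A $$ (i, j) * b i)" for j
  define F where "F m = (\<Sum>j<fact n. mp_const (vec_of (xmon m) j) * B j)" for m
  have B: "B j \<in> poly_ring n" if "j < fact n" for j
  proof -
    have "A $$ (i, j) * b i \<in> poly_ring n" if "i < fact n" for i
      using A \<open>j < fact n\<close> that by (intro poly_ring_sym_mult b_poly_ring) (simp_all add: sym_matrix_carrier_iff)
    then show ?thesis unfolding B_def poly_ring_eq_mpolys_in by (intro mpolys_in_sum) simp
  qed
  then have "F m \<in> poly_ring n" for m
    unfolding F_def poly_ring_eq_mpolys_in by (intro mpolys_in_sum mpolys_in_mult mpolys_in_const) auto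
  then obtain a where a: "a \<in> carrier (NH n)" "\<And>m. m \<in> stairs n \<Longrightarrow> nh_act a (xmon m) = F m"
    using NH_elt_exists_mono[of n F] by blast
  have "nh_act a (b j) = B j" if j: "j < fact n" for j
  proof -
    have "nh_act a (b j) = (\<Sum>m\<in>stairs n. mp_const (lookup (b j) m) * F m)"
      unfolding nh_act_coords[OF a(1) b_poly_ring[OF j]]
      by (intro sum.cong refl arg_cong2[where f = "(*)"] a(2) coord_H_span b_H_span j)
    also have "\<dots> = (\<Sum>i<fact n. \<Sum>m\<in>stairs n. mp_const (lookup (b j) m * vec_of (xmon m) i) * B i)"
      unfolding F_def by (subst sum.swap) (simp add: sum_distrib_left mult.assoc)
    also have "\<dots> = (\<Sum>i<fact n. mp_const (\<Sum>m\<in>stairs n. lookup (b j) m * vec_of (xmon m) i) * B i)"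
      by (simp only: mp_const_sum sum_distrib_right)
    also have "\<dots> = (\<Sum>i<fact n. mp_const (if i = j then 1 else 0) * B i)"
      by (intro sum.cong refl) (simp only: base_change_inverse[OF j] lessThan_iff)
    also have "\<dots> = (\<Sum>i<fact n. if i = j then B i else 0)" by (intro sum.cong refl) simp
    finally show ?thesis using j by simp
  qed
  then show ?thesis using A a(1) by (auto simp: B_def)
qed

lemma nh_matrix_inj:
  assumes a: "a \<in> carrier (NH n)" and c: "c \<in> carrier (NH n)" and eq: "nh_matrix n b a = nh_matrix n b c"
  shows "a = c"
proof (rule NH_eqI[OF a c])
  fix m assume m: "m \<in> stairs n"
  obtain S where S: "\<And>j. j < fact n \<Longrightarrow> S j \<in> sym_ring n" "xmon m = (\<Sum>j<fact n. S j * b j)"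
    using b_span[OF stair_mono_poly_ring[OF m]] by blast
  have "nh_act a (b j) = nh_act c (b j)" if "j < fact n" for j
    using nh_matrix_spec[OF a] nh_matrix_spec[OF c] that by (simp add: eq)
  then show "nh_act a (xmon m) = nh_act c (xmon m)"
    unfolding S(2) by (simp add: nh_act_b_expand[OF a S(1)] nh_act_b_expand[OF c S(1)])
qed

lemma nh_matrix_mult:
  assumes a: "a \<in> carrier (NH n)" and c: "c \<in> carrier (NH n)"
  shows "nh_matrix n b (a \<otimes>\<^bsub>NH n\<^esub> c) = nh_matrix n b a * nh_matrix n b c"
proof (rule nh_matrix_eqI)
  let ?A = "nh_matrix n b a" and ?C = "nh_matrix n b c"
  have A: "?A \<in> carrier_mat (fact n) (fact n)" "\<And>i j. i < fact n \<Longrightarrow> j < fact n \<Longrightarrow> ?A $$ (i, j) \<in> sym_ring n"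
    "\<And>j. j < fact n \<Longrightarrow> nh_act a (b j) = (\<Sum>i<fact n. ?A $$ (i, j) * b i)"
    using nh_matrix_spec[OF a] by (simp_all add: sym_matrix_carrier_iff)
  have C: "?C \<in> carrier_mat (fact n) (fact n)" "\<And>i j. i < fact n \<Longrightarrow> j < fact n \<Longrightarrow> ?C $$ (i, j) \<in> sym_ring n"
    "\<And>j. j < fact n \<Longrightarrow> nh_act c (b j) = (\<Sum>i<fact n. ?C $$ (i, j) * b i)"
    using nh_matrix_spec[OF c] by (simp_all add: sym_matrix_carrier_iff)
  have entry: "(?A * ?C) $$ (i, j) = (\<Sum>k<fact n. ?A $$ (i, k) * ?C $$ (k, j))" if "i < fact n" "j < fact n" for i j
    using A(1) C(1) that by (simp add: scalar_prod_def atLeast0LessThan)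
  have "?A * ?C \<in> carrier (sym_matrix_ring n)"
    using A(1,2) C(1,2) by (auto simp: sym_matrix_carrier_iff entry simp del: index_mult_mat(1) intro!: sym_ring_sum sym_ring_mult)
  moreover have "nh_act (a \<otimes>\<^bsub>NH n\<^esub> c) (b j) = (\<Sum>i<fact n. (?A * ?C) $$ (i, j) * b i)" if j: "j < fact n" for j
  proof -
    have "nh_act (a \<otimes>\<^bsub>NH n\<^esub> c) (b j) = nh_act a (\<Sum>k<fact n. ?C $$ (k, j) * b k)"
      by (simp only: nh_act_mult[OF a c] C(3)[OF j])
    also have "\<dots> = (\<Sum>k<fact n. ?C $$ (k, j) * nh_act a (b k))"
      by (rule nh_act_b_expand[OF a C(2)[OF _ j]])
    also have "\<dots> = (\<Sum>k<fact n. ?C $$ (k, j) * (\<Sum>i<fact n. ?A $$ (i, k) * b i))"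
      by (intro sum.cong refl arg_cong2[where f = "(*)"] A(3)) simp
    also have "\<dots> = (\<Sum>k<fact n. \<Sum>i<fact n. ?A $$ (i, k) * ?C $$ (k, j) * b i)"
      by (simp add: sum_distrib_left ac_simps)
    also have "\<dots> = (\<Sum>i<fact n. \<Sum>k<fact n. ?A $$ (i, k) * ?C $$ (k, j) * b i)" by (rule sum.swap)
    also have "\<dots> = (\<Sum>i<fact n. (?A * ?C) $$ (i, j) * b i)"
      by (intro sum.cong refl) (simp only: entry[OF _ j] sum_distrib_right lessThan_iff)
    finally show ?thesis .
  qed
  ultimately show "is_matrix_of (a \<otimes>\<^bsub>NH n\<^esub> c) (?A * ?C)" by blast
qed

lemma nh_matrix_add:
  assumes a: "a \<in> carrier (NH n)" and c: "c \<in> carrier (NH n)"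
  shows "nh_matrix n b (a \<oplus>\<^bsub>NH n\<^esub> c) = nh_matrix n b a + nh_matrix n b c"
  using nh_matrix_spec[OF a] nh_matrix_spec[OF c]
  by (intro nh_matrix_eqI)
    (auto simp: sym_matrix_carrier_iff nh_act_add[OF a c] sym_ring_add distrib_right sum.distrib)

lemma nh_matrix_one: "nh_matrix n b \<one>\<^bsub>NH n\<^esub> = 1\<^sub>m (fact n)"
proof (rule nh_matrix_eqI, intro conjI allI impI)
  show "1\<^sub>m (fact n) \<in> carrier (sym_matrix_ring n :: 'k mpoly mat ring)"
    by (simp add: sym_matrix_carrier_iff sym_ring_1 sym_ring_0)
  fix j :: nat assume j: "j < fact n"
  have "(\<Sum>i<fact n. 1\<^sub>m (fact n) $$ (i, j) * b i) = (\<Sum>i<fact n. if i = j then b i else 0)"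
    using j by (intro sum.cong refl) simp
  then show "nh_act \<one>\<^bsub>NH n\<^esub> (b j) = (\<Sum>i<fact n. 1\<^sub>m (fact n) $$ (i, j) * b i)"
    using j by (simp add: nh_act_one)
qed

lemma nh_matrix_iso: "nh_matrix n b \<in> ring_iso (NH n) (sym_matrix_ring n)"
proof (rule ring_iso_memI)
  show "nh_matrix n b a \<in> carrier (sym_matrix_ring n)" if "a \<in> carrier (NH n)" for a
    by (rule conjunct1[OF nh_matrix_spec[OF that]])
  show "bij_betw (nh_matrix n b) (carrier (NH n)) (carrier (sym_matrix_ring n))"
  proof (rule bij_betw_imageI)
    show "inj_on (nh_matrix n b) (carrier (NH n))" by (intro inj_onI nh_matrix_inj)
    show "nh_matrix n b ` carrier (NH n) = carrier (sym_matrix_ring n)"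
    proof
      show "nh_matrix n b ` carrier (NH n) \<subseteq> carrier (sym_matrix_ring n)"
        by (intro image_subsetI conjunct1[OF nh_matrix_spec])
      show "carrier (sym_matrix_ring n) \<subseteq> nh_matrix n b ` carrier (NH n)"
      proof
        fix A :: "'k mpoly mat" assume "A \<in> carrier (sym_matrix_ring n)"
        then obtain a where a: "a \<in> carrier (NH n)" "is_matrix_of a A" using nh_matrix_surj by blast
        show "A \<in> nh_matrix n b ` carrier (NH n)"
          using imageI[OF a(1), of "nh_matrix n b"] by (simp only: nh_matrix_eqI[OF a(2)])
      qed
    qed
  qed
qed (simp_all add: nh_matrix_mult nh_matrix_add nh_matrix_one)

text \<open>The coordinates of elements of \<open>H\<close> are constants, and conversely.\<close>

lemma nh_matrix_const_part: "nh_matrix n b ` const_part n = const_matrices n"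
proof
  show "nh_matrix n b ` const_part n \<subseteq> const_matrices n"
  proof
    fix A assume "A \<in> nh_matrix n b ` const_part n"
    then obtain a where a: "a \<in> const_part n" "A = nh_matrix n b a" by blast
    define B where "B = mat (fact n) (fact n) (\<lambda>(i, j). vec_of (nh_act a (b j)) i)"
    have "nh_act a (b j) = (\<Sum>i<fact n. map_mat mp_const B $$ (i, j) * b i)" if j: "j < fact n" for j
    proof -
      have "nh_act a (b j) \<in> H_span n" using a(1) b_H_span[OF j] by (simp add: const_part_def)
      then have "nh_act a (b j) = (\<Sum>i<fact n. mp_const (vec_of (nh_act a (b j)) i) * b i)"
        by (rule vec_of_expand)
      also have "\<dots> = (\<Sum>i<fact n. map_mat mp_const B $$ (i, j) * b i)"
        using j by (intro sum.cong refl) (simp add: B_def)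
      finally show ?thesis .
    qed
    moreover have "map_mat mp_const B \<in> carrier (sym_matrix_ring n)"
      by (simp add: sym_matrix_carrier_iff B_def sym_ring_const)
    ultimately have "nh_matrix n b a = map_mat mp_const B"
      by (intro nh_matrix_eqI conjI allI impI)
    then show "A \<in> const_matrices n" by (auto simp: a const_matrices_def B_def)
  qed
  show "const_matrices n \<subseteq> nh_matrix n b ` const_part n"
  proof
    fix A :: "'k mpoly mat" assume "A \<in> const_matrices n"
    then obtain B where B: "B \<in> carrier_mat (fact n) (fact n)" "A = map_mat mp_const B"
      by (auto simp: const_matrices_def)
    then have "A \<in> carrier (sym_matrix_ring n)" by (simp add: sym_matrix_carrier_iff sym_ring_const)
    then obtain a where a: "a \<in> carrier (NH n)" "is_matrix_of a A" using nh_matrix_surj by blast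
    have ab: "nh_act a (b j) \<in> H_span n" if j: "j < fact n" for j
    proof -
      have "nh_act a (b j) = (\<Sum>i<fact n. mp_const (B $$ (i, j)) * b i)"
        using a(2) B j by simp
      also have "\<dots> \<in> H_span n" by (intro H_span_sum H_span_const_mult b_H_span) simp
      finally show ?thesis .
    qed
    have "nh_act a (xmon m) \<in> H_span n" if m: "m \<in> stairs n" for m
    proof -
      have "nh_act a (xmon m) = nh_act a (\<Sum>j<fact n. mp_const (vec_of (xmon m) j) * b j)"
        by (rule arg_cong[OF vec_of_expand[OF mono_H_span[OF m]]])
      also have "\<dots> = (\<Sum>j<fact n. mp_const (vec_of (xmon m) j) * nh_act a (b j))"
        by (rule nh_act_b_expand[OF a(1) sym_ring_const])
      also have "\<dots> \<in> H_span n" by (intro H_span_sum H_span_const_mult ab) simp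
      finally show ?thesis .
    qed
    then have "a \<in> const_part n" using a(1) by (intro const_partI)
    from imageI[OF this, of "nh_matrix n b"] show "A \<in> nh_matrix n b ` const_part n"
      by (simp only: nh_matrix_eqI[OF a(2)])
  qed
qed

end

theorem theorem1p9:
  fixes n :: nat
  assumes "n \<ge> 1"
  shows "\<exists>M :: 'k::field_char_0 nh set.
           is_max_fd_sl2_subrep n M \<and>
           subring M (NH n) \<and>
           subalgebra (nh_scalars n) M (NH n) \<and>
           (\<lambda>a. Jac_NH n +>\<^bsub>NH n\<^esub> a) \<in> ring_iso ((NH n)\<lparr>carrier := M\<rparr>) (NH n Quot Jac_NH n) \<and>
           (\<forall>b. is_basis_of_H n b \<longrightarrow>
              nh_matrix n b \<in> ring_iso (NH n) (sym_matrix_ring n) \<and>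
              nh_matrix n b ` M = const_matrices n)"
proof (intro exI[of _ "const_part n"] conjI allI impI)
  show "is_max_fd_sl2_subrep n (const_part n :: 'k nh set)" by (rule const_part_max)
  show "subring (const_part n :: 'k nh set) (NH n)" by (rule const_part_subring)
  show "subalgebra (nh_scalars n) (const_part n :: 'k nh set) (NH n)" by (rule const_part_subspace)
  show "(\<lambda>a. Jac_NH n +>\<^bsub>NH n\<^esub> a) \<in> ring_iso ((NH n)\<lparr>carrier := const_part n :: 'k nh set\<rparr>) (NH n Quot Jac_NH n)"
    by (rule const_part_iso_semisimplification)
  fix b :: "nat \<Rightarrow> 'k mpoly" assume "is_basis_of_H n b"
  then interpret H_basis n b by unfold_locales
  show "nh_matrix n b \<in> ring_iso (NH n) (sym_matrix_ring n)" by (rule nh_matrix_iso)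
  show "nh_matrix n b ` const_part n = const_matrices n" by (rule nh_matrix_const_part)
qed


end
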